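(* Let $\bm w$ be a Markov stick-breaking weights sequence with length variables $\bm v=(v_j)_{j\ge1}$ such that almost surely $\sum_{j\ge1}w_j=1$ and $w_j>0$ for every $j\ge1$. Assume that at least one of the following holds: (A) the law of $(v_1,v_2)$ and Lebesgue measure on $[0,1]^2$ are mutually absolutely continuous; (B) the support of $(w_1,w_2)$ is convex, and there is a version $\phi$ of the conditional law $\mathbb P[v_3\in\cdot\mid v_2]$ that is left continuous with respect to the weak topology (i.e. $\phi(u_n)\to\phi(u)$ weakly whenever $u_n<u$, $u_n\to u$); (C) there exists $0<\varepsilon<1$ such that $\{(x_1,x_2)\in[0,1]^2: x_2=\varepsilon\}$ is contained in the support of $(v_1,v_2)$, and there is a version $\psi_2$ of $\mathbb P[v_3\in\cdot\mid v_2]$ that is weakly continuous, i.e. $\psi_2(u_n,\cdot)\to\psi_2(u,\cdot)$ weakly whenever $u_n\to u$ in the support of $v_2$. Then $\bm w$ is invariant under size-biased permutations if and only if the length variables are independent with $v_j\sim\mathrm{Beta}(1-\sigma,\theta+j\sigma)$ for all $j\ge1$, for some $\sigma\in[0,1)$ and $\theta>-\sigma$.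
   Context: Length variables $\bm v=(v_j)_{j\ge1}$ are $[0,1]$-valued random variables defining stick-breaking weights $w_1=v_1$, $w_j=v_j\prod_{i<j}(1-v_i)$; $\bm w$ is a Markov stick-breaking weights sequence if $\bm v$ is a Markov chain. For weights with $\sum_jw_j=1$, a size-biased permutation is $(w_{\varrho_j})_{j\ge1}$ where the random permutation $\bm\varrho$ satisfies $\mathbb P[\varrho_1=j\mid\bm w]=w_j$ and $\mathbb P[\varrho_{k+1}=j\mid\bm w,\varrho_1,\dots,\varrho_k]=\frac{w_j}{1-\sum_{i=1}^k w_{\varrho_i}}\mathbb 1\{j\notin\{\varrho_1,\dots,\varrho_k\}\}$ on the event $\sum_{i\le k}w_{\varrho_i}<1$ (otherwise $\varrho_{k+1}$ is the smallest positive integer not in $\{\varrho_1,\dots,\varrho_k\}$). $\bm w$ is invariant under size-biased permutations if $(w_{\varrho_j})_{j\ge1}$ has the same law as $(w_j)_{j\ge1}$. *)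

theory Defs
  imports "HOL-Probability.Probability"
begin

text \<open>Indexing convention: the paper's length variable v_j (j \<ge> 1) is v (j-1) here,
  i.e. we index from 0.  Likewise w j here is the paper's w_(j+1).\<close>

definition stick_weights :: "(nat \<Rightarrow> 'a \<Rightarrow> real) \<Rightarrow> nat \<Rightarrow> 'a \<Rightarrow> real" where
  "stick_weights v j x = v j x * (\<Prod>i<j. 1 - v i x)"

definition gen_sigma :: "'a measure \<Rightarrow> (nat \<Rightarrow> 'a \<Rightarrow> real) \<Rightarrow> nat set \<Rightarrow> 'a measure" where
  "gen_sigma M v I = sigma (space M) {v i -` A \<inter> space M | i A. i \<in> I \<and> A \<in> sets borel}"

definition markov_chain :: "'a measure \<Rightarrow> (nat \<Rightarrow> 'a \<Rightarrow> real) \<Rightarrow> bool" where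
  "markov_chain M v \<longleftrightarrow> (\<forall>n. \<forall>A \<in> sets borel.
     AE x in M. real_cond_exp M (gen_sigma M v {..n}) (indicator {y \<in> space M. v (Suc n) y \<in> A}) x
              = real_cond_exp M (gen_sigma M v {n}) (indicator {y \<in> space M. v (Suc n) y \<in> A}) x)"

text \<open>Size-biased permutation of a deterministic weight sequence w: the probability of one
  step choosing j, given that the (distinct) indices in the list rs were chosen before.\<close>
definition sb_step :: "(nat \<Rightarrow> real) \<Rightarrow> nat list \<Rightarrow> nat \<Rightarrow> real" where
  "sb_step w rs j =
     (if (\<Sum>i\<in>set rs. w i) < 1
      then (if j \<notin> set rs then w j / (1 - (\<Sum>i\<in>set rs. w i)) else 0)
      else (if j = (LEAST n. n \<notin> set rs) then 1 else 0))"

text \<open>Probability that (rho_1, ..., rho_k) = rev rs (rs lists the chosen indices in reverse order).\<close>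
fun sb_prob_rev :: "(nat \<Rightarrow> real) \<Rightarrow> nat list \<Rightarrow> real" where
  "sb_prob_rev w [] = 1"
| "sb_prob_rev w (j # rs) = sb_prob_rev w rs * sb_step w rs j"

definition sb_prob :: "(nat \<Rightarrow> real) \<Rightarrow> nat list \<Rightarrow> real" where
  "sb_prob w js = sb_prob_rev w (rev js)"

text \<open>Invariance under size-biased permutations: for every k, the law of
  (w_{rho_1},...,w_{rho_k}) (the mixture over the law of w of the conditional law given w)
  equals the law of (w_1,...,w_k).  Equality of all finite-dimensional distributions is
  equality of the laws of the sequences on the product sigma-algebra.\<close>
definition sb_invariant :: "'a measure \<Rightarrow> (nat \<Rightarrow> 'a \<Rightarrow> real) \<Rightarrow> bool" where
  "sb_invariant M w \<longleftrightarrow> (\<forall>k. \<forall>A \<in> sets (PiM {..<k} (\<lambda>_. borel :: real measure)).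
     (\<integral>\<^sup>+ x. (\<integral>\<^sup>+ js. ennreal (sb_prob (\<lambda>j. w j x) js)
                        * indicator A (\<lambda>i\<in>{..<k}. w (js ! i) x)
              \<partial>count_space {js. length js = k}) \<partial>M)
     = emeasure M {x \<in> space M. (\<lambda>i\<in>{..<k}. w i x) \<in> A})"

definition support :: "'b::topological_space measure \<Rightarrow> 'b set" where
  "support N = {x. \<forall>U. open U \<longrightarrow> x \<in> U \<longrightarrow> emeasure N U > 0}"

definition cond_law_version ::
  "'a measure \<Rightarrow> ('a \<Rightarrow> real) \<Rightarrow> ('a \<Rightarrow> real) \<Rightarrow> (real \<Rightarrow> real measure) \<Rightarrow> bool" where
  "cond_law_version M X Y \<phi> \<longleftrightarrow>
     (\<forall>u. prob_space (\<phi> u) \<and> sets (\<phi> u) = sets borel) \<and>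
     (\<forall>B \<in> sets borel. (\<lambda>u. measure (\<phi> u) B) \<in> borel_measurable borel) \<and>
     (\<forall>A \<in> sets borel. \<forall>B \<in> sets borel.
        measure M {x \<in> space M. X x \<in> A \<and> Y x \<in> B}
        = (\<integral>x. indicator A (X x) * measure (\<phi> (X x)) B \<partial>M))"

definition beta_density :: "real \<Rightarrow> real \<Rightarrow> real \<Rightarrow> real" where
  "beta_density a b x = indicator {0<..<1} x * x powr (a - 1) * (1 - x) powr (b - 1) / Beta a b"

definition beta_measure :: "real \<Rightarrow> real \<Rightarrow> real measure" where
  "beta_measure a b = density lborel (\<lambda>x. ennreal (beta_density a b x))"

end

theory Submission
  imports Defs
begin

text \<open>Summing over ordered selections of indices, invariance of the weights says that, for each n,
  the law of w reweighted by 1 - w 0 - ... - w n is unchanged when w n and w (n + 1) are exchanged.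
  In length variables: the law of v reweighted by 1 - v n is invariant under replacing
  (a, b) = (v n, v (n + 1)) by ((1 - a) b, a / (1 - (1 - a) b)), the other v i being untouched.

  By the Markov property the conditional law of v 2 given the past is a function of v 1, and this
  symmetry makes the function agree at v 1 and at v 0 / (1 - (1 - v 0) v 1). Each of the three
  hypotheses turns that into constancy, so v 2 is independent of (v 0, v 1). In an independent
  pair with the above symmetry the second law determines the first; applied conditionally on
  events of v 0, this makes v 1 independent of v 0. The moments of such a pair form a sequence whose
  ratios leave only beta laws and point masses; a point mass would make all weights equal, which is
  impossible as they tend to 0. Beta laws are equivalent to Lebesgue measure, so the argument
  repeats for every later index and also determines the parameters.

  Conversely, beta laws with these parameters have the exchange symmetry, and moving a size-biased
  pick to the front by adjacent exchanges gives a telescoping sum.\<close>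

section \<open>Moments of laws with the exchange symmetry\<close>

text \<open>The weight 1 - a is the analytic obstacle: the symmetry sees the first law only after
  multiplication by 1 - a, so it can determine only moments with at least one factor 1 - a, and
  those only up to a common constant. Total mass one, together with the absence of an atom at 1,
  recovers the rest.

  The order in which independence appears is dictated by the same symmetry. The exchange of v 0 and
  v 1 leaves v 2 alone and so controls the conditional law of v 2, while the product structure that
  the moment identities require is first available for the pair (v 1, v 2). Hence independence of v
  2 from (v 0, v 1) precedes that of v 1 from v 0, and only then can the pair (v 0, v 1) be
  treated.\<close>

definition unit_law :: "real measure \<Rightarrow> bool" where
  "unit_law \<mu> \<longleftrightarrow> prob_space \<mu> \<and> sets \<mu> = sets borel \<and> (AE a in \<mu>. 0 < a \<and> a < 1)"

text \<open>For independent a, b with laws \<mu>, \<nu>: reweighting by 1 - a makes (a, (1 - a) b) exchangeable.\<close>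

definition tilt_sym :: "real measure \<Rightarrow> real measure \<Rightarrow> bool" where
  "tilt_sym \<mu> \<nu> \<longleftrightarrow> (\<forall>f::real \<times> real \<Rightarrow> ennreal. f \<in> borel_measurable borel \<longrightarrow>
     (\<integral>\<^sup>+ a. \<integral>\<^sup>+ b. ennreal (1 - a) * f (a, b) \<partial>\<nu> \<partial>\<mu>) =
     (\<integral>\<^sup>+ a. \<integral>\<^sup>+ b. ennreal (1 - a) * f ((1 - a) * b, a / (1 - (1 - a) * b)) \<partial>\<nu> \<partial>\<mu>))"

definition mom :: "real measure \<Rightarrow> nat \<Rightarrow> nat \<Rightarrow> real" where
  "mom \<mu> i n = (\<integral>a. a ^ i * (1 - a) ^ n \<partial>\<mu>)"

lemma unit_law_prob: "unit_law \<mu> \<Longrightarrow> prob_space \<mu>"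
  and unit_law_sets: "unit_law \<mu> \<Longrightarrow> sets \<mu> = sets borel"
  and unit_law_AE: "unit_law \<mu> \<Longrightarrow> AE a in \<mu>. 0 < a \<and> a < 1"
  by (auto simp: unit_law_def)

lemma mom_bounded:
  assumes "unit_law \<mu>"
  shows "AE a in \<mu>. 0 < a ^ i * (1 - a) ^ n \<and> a ^ i * (1 - a) ^ n \<le> 1"
  using unit_law_AE[OF assms] by eventually_elim (auto intro!: mult_le_one power_le_one)

lemma mom_integrable:
  assumes "unit_law \<mu>"
  shows "integrable \<mu> (\<lambda>a. a ^ i * (1 - a) ^ n)"
proof -
  interpret prob_space \<mu> by (rule unit_law_prob[OF assms])
  show ?thesis
  proof (rule integrable_const_bound[where B = 1])
    show "AE x in \<mu>. norm (x ^ i * (1 - x) ^ n) \<le> 1"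
      using mom_bounded[OF assms, of i n] by eventually_elim auto
  qed (auto simp: measurable_cong_sets[OF unit_law_sets[OF assms] refl])
qed

lemma nn_integral_mom:
  assumes "unit_law \<mu>"
  shows "(\<integral>\<^sup>+a. ennreal (a ^ i * (1 - a) ^ n) \<partial>\<mu>) = ennreal (mom \<mu> i n)"
  unfolding mom_def using mom_bounded[OF assms, of i n]
  by (intro nn_integral_eq_integral mom_integrable assms) (auto elim!: eventually_mono)

text \<open>Strict positivity, from concentration on the open interval, is what allows the
  identities below to be divided by moments.\<close>

lemma mom_pos:
  assumes "unit_law \<mu>"
  shows "mom \<mu> i n > 0"
proof -
  interpret prob_space \<mu> by (rule unit_law_prob[OF assms])
  have "(\<integral>a. a ^ i * (1 - a) ^ n \<partial>\<mu>) > (\<integral>a. 0 \<partial>\<mu>)"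
  proof (rule integral_less_AE_space)
    show "AE x in \<mu>. 0 < x ^ i * (1 - x) ^ n"
      using mom_bounded[OF assms, of i n] by (auto elim!: eventually_mono)
  qed (use mom_integrable[OF assms] in \<open>auto simp: emeasure_space_1\<close>)
  then show ?thesis by (simp add: mom_def)
qed

lemma mom_split:
  assumes "unit_law \<mu>"
  shows "mom \<mu> i n = mom \<mu> (Suc i) n + mom \<mu> i (Suc n)"
proof -
  have "a ^ i * (1 - a) ^ n = a ^ Suc i * (1 - a) ^ n + a ^ i * (1 - a) ^ Suc n" for a :: real
    by (simp add: algebra_simps)
  then have "mom \<mu> i n = (\<integral>a. a ^ Suc i * (1 - a) ^ n + a ^ i * (1 - a) ^ Suc n \<partial>\<mu>)"
    unfolding mom_def by presburger
  also have "\<dots> = mom \<mu> (Suc i) n + mom \<mu> i (Suc n)"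
    unfolding mom_def by (intro Bochner_Integration.integral_add mom_integrable assms)
  finally show ?thesis .
qed

lemma mom_0_0: "unit_law \<mu> \<Longrightarrow> mom \<mu> 0 0 = 1"
  using prob_space.prob_space[OF unit_law_prob, of \<mu>] by (simp add: mom_def)

text \<open>There is no atom at 1. This decay later fixes the normalising constant that moments with
  a factor 1 - a leave open.\<close>

lemma mom_tendsto_0:
  assumes "unit_law \<mu>"
  shows "(\<lambda>i. mom \<mu> i 0) \<longlonglongrightarrow> 0"
proof -
  interpret prob_space \<mu> by (rule unit_law_prob[OF assms])
  have "(\<lambda>i. \<integral>a. a ^ i * (1 - a) ^ 0 \<partial>\<mu>) \<longlonglongrightarrow> (\<integral>a. 0 \<partial>\<mu>)"
  proof (rule integral_dominated_convergence[where w = "\<lambda>_. 1"])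
    show "AE x in \<mu>. (\<lambda>i. x ^ i * (1 - x) ^ 0) \<longlonglongrightarrow> 0"
      using unit_law_AE[OF assms] by eventually_elim (auto intro!: LIMSEQ_power_zero)
    show "AE x in \<mu>. norm (x ^ i * (1 - x) ^ 0) \<le> 1" for i
      using mom_bounded[OF assms, of i 0] by eventually_elim auto
  qed (auto simp: measurable_cong_sets[OF unit_law_sets[OF assms] refl])
  then show ?thesis by (simp add: mom_def)
qed

text \<open>All moments lie between 0 and 1, so the Taylor remainder of the characteristic function
  at order n is at most 2 |t|^n / n!, and the moments determine the characteristic function.\<close>

lemma unit_law_eqI_moments:
  assumes "unit_law \<mu>" "unit_law \<nu>" and eq: "\<And>i. mom \<mu> i 0 = mom \<nu> i 0"
  shows "\<mu> = \<nu>"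
proof (rule Levy_uniqueness)
  have rd: "real_distribution \<mu>" if "unit_law \<mu>" for \<mu>
    using that sets_eq_imp_space_eq[OF unit_law_sets[OF that]]
    by (auto simp: real_distribution_def real_distribution_axioms_def unit_law_def)
  show "real_distribution \<mu>" "real_distribution \<nu>" using rd assms by auto
  have approx: "cmod (char \<mu> t - (\<Sum>k\<le>n. ((\<i> * t) ^ k / fact k) * mom \<mu> k 0)) \<le> 2 * \<bar>t\<bar> ^ n / fact n"
    if u: "unit_law \<mu>" for \<mu> t n
  proof -
    interpret real_distribution \<mu> by (rule rd[OF u])
    have int: "integrable \<mu> (\<lambda>x. x ^ k)" for k
      using mom_integrable[OF u, of k 0] by simp
    have "expectation (\<lambda>x. \<bar>x\<bar> ^ n) \<le> expectation (\<lambda>x. 1)"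
    proof (rule integral_mono_AE)
      show "AE x in \<mu>. \<bar>x\<bar> ^ n \<le> 1"
        using unit_law_AE[OF u] by eventually_elim (auto intro!: power_le_one)
      show "integrable \<mu> (\<lambda>x. \<bar>x\<bar> ^ n)"
        using integrable_norm[OF int[of n]] by (simp add: power_abs)
    qed auto
    then have le1: "expectation (\<lambda>x. \<bar>x\<bar> ^ n) \<le> 1" using prob_space by simp
    have "cmod (char \<mu> t - (\<Sum>k\<le>n. ((\<i> * t) ^ k / fact k) * expectation (\<lambda>x. x ^ k)))
        \<le> (2 * \<bar>t\<bar> ^ n / fact n) * expectation (\<lambda>x. \<bar>x\<bar> ^ n)"
      by (rule char_approx1) (rule int)
    also have "\<dots> \<le> (2 * \<bar>t\<bar> ^ n / fact n) * 1"
      by (rule mult_left_mono[OF le1]) auto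
    finally show ?thesis by (simp add: mom_def)
  qed
  show "char \<mu> = char \<nu>"
  proof
    fix t
    have "cmod (char \<mu> t - char \<nu> t) \<le> 4 * (\<bar>t\<bar> ^ n / fact n)" for n
      using norm_triangle_le_diff[OF add_mono[OF approx[OF assms(1), of t n] approx[OF assms(2), of t n]]]
      by (simp add: eq)
    moreover have "(\<lambda>n. 4 * (\<bar>t\<bar> ^ n / fact n)) \<longlonglongrightarrow> 4 * 0"
      by (intro tendsto_mult tendsto_const) (use summable_LIMSEQ_zero[OF summable_exp[of "\<bar>t\<bar>"]] in
        \<open>simp add: divide_inverse mult.commute\<close>)
    ultimately have "cmod (char \<mu> t - char \<nu> t) \<le> 4 * 0"
      by (intro LIMSEQ_le_const) auto
    then show "char \<mu> t = char \<nu> t" by simp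
  qed
qed

text \<open>Splitting 1 = a + (1 - a) extends the proportionality to all moments with a factor 1 -
  a, hence the defect \<open>D m\<close> of the m-th moments does not depend on m. It tends to 0
  because neither law charges 1, and \<open>D 0\<close> = 1 - c then forces c = 1.\<close>

lemma unit_law_eqI_tilted_moments:
  assumes u: "unit_law \<mu>" "unit_law \<nu>"
    and eq: "\<And>n. mom \<mu> 0 (Suc n) = c * mom \<nu> 0 (Suc n)"
  shows "\<mu> = \<nu>"
proof -
  have A: "mom \<mu> m (Suc n) = c * mom \<nu> m (Suc n)" for m n
  proof (induction m arbitrary: n)
    case (Suc m)
    have "mom \<mu> (Suc m) (Suc n) = mom \<mu> m (Suc n) - mom \<mu> m (Suc (Suc n))"
      using mom_split[OF u(1), of m "Suc n"] by simp
    also have "\<dots> = c * (mom \<nu> m (Suc n) - mom \<nu> m (Suc (Suc n)))"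
      by (simp add: Suc.IH algebra_simps)
    also have "\<dots> = c * mom \<nu> (Suc m) (Suc n)"
      using mom_split[OF u(2), of m "Suc n"] by simp
    finally show ?case .
  qed (use eq in auto)
  define D where "D m = mom \<mu> m 0 - c * mom \<nu> m 0" for m
  have step: "D (Suc m) = D m" for m
    using mom_split[OF u(1), of m 0] mom_split[OF u(2), of m 0] A[of m 0]
    by (simp add: D_def algebra_simps)
  have const: "D m = D 0" for m by (induction m) (auto simp: step)
  have "D \<longlonglongrightarrow> 0 - c * 0"
    unfolding D_def by (intro tendsto_intros mom_tendsto_0 u)
  moreover have "D = (\<lambda>_. D 0)" using const by (rule ext)
  then have "D \<longlonglongrightarrow> D 0" by (metis tendsto_const)
  ultimately have D0: "D 0 = 0 - c * 0" by (rule LIMSEQ_unique[rotated])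
  then have c: "c = 1" by (simp add: D_def mom_0_0 u)
  have "mom \<mu> i 0 = mom \<nu> i 0" for i using const[of i] D0 by (simp add: D_def c)
  then show ?thesis by (rule unit_law_eqI_moments[OF u])
qed

text \<open>The test functions are monomials x^i y^j z^k in the first weight x = a, the second
  weight y = (1 - a) b and the remainder z = (1 - a) (1 - b). The exchange swaps x and y and fixes
  z, and each monomial factors into a moment of either law; the factor 1 - a of the tilt is the
  \<open>Suc\<close>.\<close>

lemma tilt_sym_mom:
  assumes u: "unit_law \<mu>" "unit_law \<nu>" and sym: "tilt_sym \<mu> \<nu>"
  shows "mom \<mu> i (Suc (j + k)) * mom \<nu> j k = mom \<mu> j (Suc (i + k)) * mom \<nu> i k"
proof -
  let ?f = "\<lambda>i j (a, b). ennreal (a ^ i * ((1 - a) * b) ^ j * ((1 - a) * (1 - b)) ^ k)"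
  have [measurable]: "?f i j \<in> borel_measurable (borel :: (real \<times> real) measure)" for i j
    unfolding borel_prod[symmetric] by measurable
  have val: "(\<integral>\<^sup>+ a. \<integral>\<^sup>+ b. ennreal (1 - a) * ?f i j (a, b) \<partial>\<nu> \<partial>\<mu>)
      = ennreal (mom \<mu> i (Suc (j + k)) * mom \<nu> j k)" for i j
  proof -
    have "(\<integral>\<^sup>+ a. \<integral>\<^sup>+ b. ennreal (1 - a) * ?f i j (a, b) \<partial>\<nu> \<partial>\<mu>)
      = (\<integral>\<^sup>+ a. \<integral>\<^sup>+ b. ennreal (a ^ i * (1 - a) ^ Suc (j + k)) * ennreal (b ^ j * (1 - b) ^ k) \<partial>\<nu> \<partial>\<mu>)"
      using unit_law_AE[OF u(1)]
    proof (intro nn_integral_cong_AE, eventually_elim)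
      case a: (elim a)
      show ?case using unit_law_AE[OF u(2)]
      proof (intro nn_integral_cong_AE, eventually_elim)
        case b: (elim b)
        then show ?case using a
          by (simp add: ennreal_mult[symmetric] power_mult_distrib power_add mult_ac)
      qed
    qed
    also have "\<dots> = (\<integral>\<^sup>+ a. ennreal (a ^ i * (1 - a) ^ Suc (j + k)) * ennreal (mom \<nu> j k) \<partial>\<mu>)"
      by (subst nn_integral_cmult)
        (auto simp: nn_integral_mom[OF u(2)] measurable_cong_sets[OF unit_law_sets[OF u(2)] refl])
    also have "\<dots> = ennreal (mom \<mu> i (Suc (j + k))) * ennreal (mom \<nu> j k)"
      by (subst nn_integral_multc)
        (auto simp: nn_integral_mom[OF u(1)] measurable_cong_sets[OF unit_law_sets[OF u(1)] refl]
          simp del: power_Suc)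
    finally show ?thesis
      using mom_pos[OF u(1), of i "Suc (j+k)"] mom_pos[OF u(2), of j k] by (simp add: ennreal_mult)
  qed
  have "(\<integral>\<^sup>+ a. \<integral>\<^sup>+ b. ennreal (1 - a) * ?f i j (a, b) \<partial>\<nu> \<partial>\<mu>)
      = (\<integral>\<^sup>+ a. \<integral>\<^sup>+ b. ennreal (1 - a) * ?f i j ((1 - a) * b, a / (1 - (1 - a) * b)) \<partial>\<nu> \<partial>\<mu>)"
    using sym unfolding tilt_sym_def by (rule allE[of _ "?f i j"]) simp
  also have "\<dots> = (\<integral>\<^sup>+ a. \<integral>\<^sup>+ b. ennreal (1 - a) * ?f j i (a, b) \<partial>\<nu> \<partial>\<mu>)"
    using unit_law_AE[OF u(1)]
  proof (intro nn_integral_cong_AE, eventually_elim)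
    case a: (elim a)
    show ?case using unit_law_AE[OF u(2)]
    proof (intro nn_integral_cong_AE, eventually_elim)
      case b: (elim b)
      have "(1 - a) * b < 1 * 1" using a b by (intro mult_strict_mono) auto
      then have ne: "1 - (1 - a) * b \<noteq> 0" by auto
      \<comment> \<open>In the new coordinates the second weight is the old first weight a, and the
        remainder is unchanged.\<close>
      have e1: "(1 - (1 - a) * b) * (a / (1 - (1 - a) * b)) = a" using ne by simp
      have e2: "(1 - (1 - a) * b) * (1 - a / (1 - (1 - a) * b)) = (1 - a) * (1 - b)"
        unfolding right_diff_distrib e1 by (simp add: algebra_simps)
      show ?case by (simp only: e1 e2 prod.case) (simp add: mult_ac)
    qed
  qed
  finally show ?thesis
    unfolding val using mom_pos[OF u(1), of i "Suc (j + k)"] mom_pos[OF u(2), of j k]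
      mom_pos[OF u(1), of j "Suc (i + k)"] mom_pos[OF u(2), of i k]
    by (subst (asm) ennreal_inj) (auto simp: less_imp_le)
qed

text \<open>The case i = 1, j = 0 with the powers of a and b eliminated. It is a recursion in k for
  either law when the other is known.\<close>

lemma tilt_sym_ratio:
  assumes u: "unit_law \<mu>" "unit_law \<nu>" and sym: "tilt_sym \<mu> \<nu>"
  shows "mom \<mu> 0 (Suc k) * mom \<nu> 0 k
    = mom \<mu> 0 (Suc (Suc k)) * (2 * mom \<nu> 0 k - mom \<nu> 0 (Suc k))"
  using tilt_sym_mom[OF assms, of 1 0 k] mom_split[OF u(1), of 0 "Suc k"] mom_split[OF u(2), of 0 k]
  by (simp add: algebra_simps)

text \<open>The ratio identity recovers all tilted moments of the first law from those of the second,
  up to one normalising constant.\<close>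

lemma tilt_sym_left_unique:
  assumes u: "unit_law \<mu>" "unit_law \<mu>'" "unit_law \<nu>"
    and sym: "tilt_sym \<mu> \<nu>" "tilt_sym \<mu>' \<nu>"
  shows "\<mu> = \<mu>'"
proof (rule unit_law_eqI_tilted_moments[OF u(1,2)])
  let ?c = "mom \<mu> 0 (Suc 0) / mom \<mu>' 0 (Suc 0)"
  fix n
  show "mom \<mu> 0 (Suc n) = ?c * mom \<mu>' 0 (Suc n)"
  proof (induction n)
    case 0
    then show ?case using mom_pos[OF u(2), of 0 "Suc 0"] by simp
  next
    case (Suc k)
    let ?d = "2 * mom \<nu> 0 k - mom \<nu> 0 (Suc k)"
    \<comment> \<open>\<open>?d\<close> is the integral of (1 + b) (1 - b)^k against \<nu>, hence
      positive, and the recursion can be solved for the next moment.\<close>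
    have "?d > 0"
      using mom_split[OF u(3), of 0 k] mom_pos[OF u(3), of 1 k] mom_pos[OF u(3), of 0 k] by simp
    moreover have "mom \<mu> 0 (Suc (Suc k)) * ?d = (?c * mom \<mu>' 0 (Suc (Suc k))) * ?d"
      using tilt_sym_ratio[OF u(1,3) sym(1), of k] tilt_sym_ratio[OF u(2,3) sym(2), of k] Suc.IH
      by (metis mult.assoc)
    ultimately show ?case by (simp only: mult_cancel_right) auto
  qed
qed

section \<open>Beta laws and their moments\<close>

lemma beta_density_integral:
  assumes "p > 0" "q > (0::real)"
  shows "integrable lborel (\<lambda>x. indicator {0<..<1} x * x powr (p - 1) * (1 - x) powr (q - 1))"
    and "(\<integral>x. indicator {0<..<1} x * x powr (p - 1) * (1 - x) powr (q - 1) \<partial>lborel) = Beta p q"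
proof -
  \<comment> \<open>The open and the closed interval give the same integrand because 0
    \<open>powr\<close> any exponent is 0.\<close>
  have eq: "(\<lambda>x::real. indicator {0<..<1} x * x powr (p - 1) * (1 - x) powr (q - 1))
      = (\<lambda>x. indicat_real {0..1} x *\<^sub>R (x powr (p - 1) * (1 - x) powr (q - 1)))"
    by (auto simp: indicator_def fun_eq_iff)
  show "integrable lborel (\<lambda>x. indicator {0<..<1} x * x powr (p - 1) * (1 - x) powr (q - 1))"
    unfolding eq using integrable_Beta[OF assms] by (simp add: set_integrable_def)
  show "(\<integral>x. indicator {0<..<1} x * x powr (p - 1) * (1 - x) powr (q - 1) \<partial>lborel) = Beta p q"
    unfolding eq
    using set_borel_integral_eq_integral(2)[OF integrable_Beta[OF assms]]
      integral_unique[OF has_integral_Beta_real[OF assms]]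
    by (simp add: set_lebesgue_integral_def)
qed

lemma Beta_real_pos: "p > 0 \<Longrightarrow> q > (0::real) \<Longrightarrow> Beta p q > 0"
  by (simp add: Beta_def Gamma_real_pos)

lemma beta_density_measurable[measurable]: "beta_density p q \<in> borel_measurable borel"
  unfolding beta_density_def[abs_def] by measurable

lemma beta_density_nonneg: "p > 0 \<Longrightarrow> q > 0 \<Longrightarrow> beta_density p q x \<ge> 0"
  using Beta_real_pos[of p q] by (auto simp: beta_density_def indicator_def)

lemma sets_beta_measure[measurable_cong]: "sets (beta_measure p q) = sets borel"
  by (simp add: beta_measure_def)

lemma unit_law_beta:
  assumes "p > 0" "q > 0"
  shows "unit_law (beta_measure p q)"
  unfolding unit_law_def
proof safe
  have "emeasure (beta_measure p q) (space (beta_measure p q)) = (\<integral>\<^sup>+x. ennreal (beta_density p q x) \<partial>lborel)"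
    by (simp add: beta_measure_def emeasure_density)
  also have "\<dots> = ennreal (\<integral>x. beta_density p q x \<partial>lborel)"
    using beta_density_integral(1)[OF assms] beta_density_nonneg[OF assms]
    by (intro nn_integral_eq_integral) (auto simp: beta_density_def[abs_def])
  also have "(\<integral>x. beta_density p q x \<partial>lborel) = 1"
    using beta_density_integral(2)[OF assms] Beta_real_pos[OF assms] by (simp add: beta_density_def[abs_def])
  finally show "prob_space (beta_measure p q)" by (intro prob_spaceI) simp
  show "AE a in beta_measure p q. 0 < a \<and> a < 1"
    unfolding beta_measure_def
    by (subst AE_density) (auto simp: beta_density_def indicator_def intro!: AE_I2)
qed (auto simp: sets_beta_measure)

lemma mom_beta:
  assumes "p > 0" "q > 0"
  shows "mom (beta_measure p q) i n = Beta (p + i) (q + n) / Beta p q"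
proof -
  have "mom (beta_measure p q) i n = (\<integral>x. beta_density p q x *\<^sub>R (x ^ i * (1 - x) ^ n) \<partial>lborel)"
    unfolding mom_def beta_measure_def
    by (subst integral_density) (auto intro!: beta_density_nonneg assms)
  also have "\<dots> = (\<integral>x. (indicator {0<..<1} x * x powr ((p + i) - 1) * (1 - x) powr ((q + n) - 1)) / Beta p q \<partial>lborel)"
    by (intro Bochner_Integration.integral_cong refl)
      (auto simp: beta_density_def indicator_def powr_add powr_diff powr_realpow field_simps)
  also have "\<dots> = Beta (p + i) (q + n) / Beta p q"
    using beta_density_integral(2)[of "p + i" "q + n"] assms by simp
  finally show ?thesis .
qed

text \<open>The functional equation of the Beta function in its second argument. A ratio of
  consecutive moments of the form (q + n) / (p + q + n) is the signature by which beta laws are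
  recognised below.\<close>

lemma mom_beta_ratio:
  assumes "p > 0" "q > 0"
  shows "mom (beta_measure p q) 0 (Suc n) * (p + q + n) = mom (beta_measure p q) 0 n * (q + n)"
proof -
  have "q + real n \<notin> \<int>\<^sub>\<le>\<^sub>0"
    using nonpos_Ints_nonpos[of "q + real n"] assms by (auto simp: add_pos_nonneg)
  from Beta_plus1_right[OF this, of p] Beta_real_pos[OF assms] show ?thesis
    by (simp add: mom_beta[OF assms] field_simps)
qed

text \<open>Inserting the beta moment ratio into \<open>tilt_sym_ratio\<close> leaves a recursion
  for \<nu> with ratio (q + 1 - p + n) / (q + 1 + n), that of a beta law with parameters p and q + 1
  - p.\<close>

lemma tilt_sym_beta_right:
  assumes pq: "p > 0" "q > 0" and u: "unit_law \<nu>" and sym: "tilt_sym (beta_measure p q) \<nu>"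
  shows "q + 1 - p > 0 \<and> \<nu> = beta_measure p (q + 1 - p)"
proof -
  let ?\<mu> = "beta_measure p q"
  note u\<mu> = unit_law_beta[OF pq]
  have ratio: "mom \<nu> 0 (Suc n) * (q + 1 + n) = mom \<nu> 0 n * (q + 1 - p + n)" for n
  proof -
    let ?a = "mom ?\<mu> 0 (Suc n)" and ?a' = "mom ?\<mu> 0 (Suc (Suc n))"
    let ?b = "mom \<nu> 0 n" and ?b' = "mom \<nu> 0 (Suc n)"
    have 1: "?a' * (p + q + 1 + n) = ?a * (q + 1 + n)"
      using mom_beta_ratio[OF pq, of "Suc n"] by (simp add: algebra_simps)
    have 2: "?a * ?b = ?a' * (2 * ?b - ?b')"
      by (rule tilt_sym_ratio[OF u\<mu> u sym])
    have "?a' * (?b * (p + q + 1 + n)) = (?a * ?b) * (q + 1 + n)"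
      by (metis 1 mult.assoc mult.commute)
    also have "\<dots> = ?a' * ((2 * ?b - ?b') * (q + 1 + n))"
      unfolding 2 by (rule mult.assoc)
    finally have "?b * (p + q + 1 + n) = (2 * ?b - ?b') * (q + 1 + n)"
      using mom_pos[OF u\<mu>, of 0 "Suc (Suc n)"] by (metis mult_left_cancel less_irrefl)
    then show ?thesis by (simp add: algebra_simps)
  qed
  \<comment> \<open>At n = 0 the recursion equates a positive multiple of a positive moment with q +
    1 - p itself.\<close>
  have pos: "q + 1 - p > 0"
  proof -
    have "mom \<nu> 0 1 * (q + 1) > 0" using mom_pos[OF u] pq by simp
    then show ?thesis using ratio[of 0] by (simp add: mom_0_0[OF u])
  qed
  have eq: "mom \<nu> 0 n = mom (beta_measure p (q + 1 - p)) 0 n" for n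
  proof (induction n)
    case (Suc n)
    have "mom \<nu> 0 (Suc n) * (q + 1 + n) = mom (beta_measure p (q + 1 - p)) 0 (Suc n) * (q + 1 + n)"
      using ratio[of n] mom_beta_ratio[OF pq(1) pos, of n] Suc.IH by (simp add: algebra_simps)
    moreover have "q + 1 + real n \<noteq> 0" using pq by simp
    ultimately show ?case by (metis mult_right_cancel)
  qed (simp add: mom_0_0 u unit_law_beta[OF pq(1) pos])
  have "\<nu> = beta_measure p (q + 1 - p)"
    by (rule unit_law_eqI_tilted_moments[OF u unit_law_beta[OF pq(1) pos], of 1]) (simp add: eq)
  with pos show ?thesis by simp
qed

section \<open>Which first laws admit the symmetry\<close>

lemma Dirac_if_no_variance:
  assumes u: "unit_law \<mu>"
    and var: "mom \<mu> 0 1 * mom \<mu> 0 3 = mom \<mu> 0 2 ^ 2"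
  shows "\<exists>c. AE a in \<mu>. a = c"
proof -
  \<comment> \<open>\<open>r\<close> is the mean of 1 - a under the normalised law with density
    proportional to 1 - a against \<mu>; the hypothesis says that the variance of 1 - a under that
    law vanishes.\<close>
  define r where "r = mom \<mu> 0 2 / mom \<mu> 0 1"
  let ?g = "\<lambda>a. a ^ 0 * (1 - a) ^ 3 - 2 * r * (a ^ 0 * (1 - a) ^ 2) + r ^ 2 * (a ^ 0 * (1 - a) ^ 1)"
  have g: "?g a = (1 - a) * ((1 - a) - r) ^ 2" for a by (simp add: power2_eq_square power3_eq_cube algebra_simps)
  have int: "integrable \<mu> ?g"
    by (intro Bochner_Integration.integrable_add Bochner_Integration.integrable_diff
        integrable_mult_right mom_integrable u)
  have "(\<integral>a. ?g a \<partial>\<mu>) = mom \<mu> 0 3 - 2 * r * mom \<mu> 0 2 + r ^ 2 * mom \<mu> 0 1"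
    using mom_integrable[OF u, of 0 1] mom_integrable[OF u, of 0 2] mom_integrable[OF u, of 0 3]
    unfolding mom_def by simp
  also have "\<dots> = 0"
    using var mom_pos[OF u, of 0 1] by (simp add: r_def field_simps power2_eq_square)
  finally have I0: "(\<integral>a. ?g a \<partial>\<mu>) = 0" .
  have "AE a in \<mu>. 0 \<le> ?g a"
    using unit_law_AE[OF u] unfolding g by eventually_elim auto
  from integral_nonneg_eq_0_iff_AE[OF int this] I0 have "AE a in \<mu>. ?g a = 0" by blast
  then have "AE a in \<mu>. a = 1 - r"
    using unit_law_AE[OF u] by eventually_elim (auto simp only: g, auto)
  then show ?thesis by blast
qed

lemma inverse_arith_progression:
  fixes X :: "nat \<Rightarrow> real"
  assumes "\<And>k. 2 * X (Suc k) = X k + X (Suc (Suc k))"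
  shows "X k = X 0 + k * (X 1 - X 0)"
proof (induction k rule: less_induct)
  case (less k)
  show ?case
  proof (cases "k < 2")
    case True
    then have "k = 0 \<or> k = 1" by auto
    then show ?thesis by auto
  next
    case False
    then obtain m where m: "k = Suc (Suc m)" by (metis add_2_eq_Suc le_Suc_ex not_less)
    show ?thesis using assms[of m] less[of m] less[of "Suc m"] by (simp add: m algebra_simps)
  qed
qed

text \<open>If the tilted law is a beta law with parameters p and Q, then \<open>X k\<close> equals
  (p + Q + k) / p, which suggests this quantity. The identities for the exponent pairs (1, 0), (2,
  0) and (1, 2) are linear in three moments of \<nu>; eliminating these leaves a relation among four
  consecutive moments of \<mu>, the vanishing second difference of \<open>X\<close>.\<close>

lemma tilt_sym_progression:
  assumes u: "unit_law \<mu>" "unit_law \<nu>" and sym: "tilt_sym \<mu> \<nu>"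
  defines "X \<equiv> \<lambda>k. mom \<mu> 0 (Suc k) / (mom \<mu> 0 (Suc k) - mom \<mu> 0 (Suc (Suc k)))"
  shows "2 * X (Suc k) = X k + X (Suc (Suc k))"
proof -
  define a b c d where "a = mom \<mu> 0 (Suc k)" and "b = mom \<mu> 0 (Suc (Suc k))"
    and "c = mom \<mu> 0 (Suc (Suc (Suc k)))" and "d = mom \<mu> 0 (Suc (Suc (Suc (Suc k))))"
  note defs = a_def b_def c_def d_def
  have m1: "mom \<mu> 1 (Suc k) = a - b" "mom \<mu> 1 (Suc (Suc k)) = b - c"
    "mom \<mu> 1 (Suc (Suc (Suc k))) = c - d"
    using mom_split[OF u(1), of 0 "Suc k"] mom_split[OF u(1), of 0 "Suc (Suc k)"]
      mom_split[OF u(1), of 0 "Suc (Suc (Suc k))"] by (simp_all add: defs)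
  have m2: "mom \<mu> 2 (Suc k) = a - 2 * b + c" "mom \<mu> 2 (Suc (Suc k)) = b - 2 * c + d"
    using mom_split[OF u(1), of 1 "Suc k"] mom_split[OF u(1), of 1 "Suc (Suc k)"] m1
    by (simp_all add: numeral_2_eq_2)
  have pos: "a > 0" "b > 0" "c > 0" "d > 0" "a - b > 0" "b - c > 0" "c - d > 0"
    unfolding m1[symmetric] unfolding defs by (intro mom_pos u)+
  note \<nu>pos = mom_pos[OF u(2)]
  let ?B = "\<lambda>j. mom \<nu> j k"
  have e1: "(a - b) * ?B 0 = b * ?B 1"
    using tilt_sym_mom[OF u sym, of 1 0 k] m1 by (simp add: defs)
  have e2: "(a - 2 * b + c) * ?B 0 = c * ?B 2"
    using tilt_sym_mom[OF u sym, of 2 0 k] m2 by (simp add: defs)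
  have e3: "(c - d) * ?B 2 = (b - 2 * c + d) * ?B 1"
    using tilt_sym_mom[OF u sym, of 1 2 k] m1 m2 by (simp add: numeral_2_eq_2 defs)
  have "((c - d) * (a - 2 * b + c) * b) * ?B 0 = (c - d) * b * (c * ?B 2)"
    unfolding e2[symmetric] by (simp add: mult_ac)
  also have "\<dots> = (b - 2 * c + d) * c * (b * ?B 1)"
    using e3 by (simp add: mult_ac)
  also have "\<dots> = ((b - 2 * c + d) * (a - b) * c) * ?B 0"
    unfolding e1[symmetric] by (simp add: mult_ac)
  finally have key: "(c - d) * (a - 2 * b + c) * b = (b - 2 * c + d) * (a - b) * c"
    using \<nu>pos[of 0 k] by (simp only: mult_cancel_right) auto
  have "2 * (b / (b - c)) = a / (a - b) + c / (c - d)"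
    using key pos by (simp add: divide_simps) (simp add: algebra_simps)
  then show ?thesis by (simp add: X_def defs)
qed


text \<open>The progression has common difference 1 / p, and difference 0 means zero variance. It only
  identifies the tilted law, as a beta law with parameters p and Q; that the law itself is a
  probability measure forces Q > 1, because otherwise a harmonic series would converge.\<close>

lemma tilt_sym_left_cases:
  assumes u: "unit_law \<mu>" "unit_law \<nu>" and sym: "tilt_sym \<mu> \<nu>"
  shows "(\<exists>c. AE a in \<mu>. a = c) \<or> (\<exists>p q. 0 < p \<and> 0 < q \<and> \<mu> = beta_measure p q)"
proof -
  define \<alpha> where "\<alpha> n = mom \<mu> 0 (Suc n)" for n
  define X where "X k = \<alpha> k / (\<alpha> k - \<alpha> (Suc k))" for k
  define d where "d = X 1 - X 0"
  have \<alpha>pos: "\<alpha> n > 0" for n by (simp add: \<alpha>_def mom_pos u)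
  have \<alpha>dec: "\<alpha> n - \<alpha> (Suc n) > 0" for n
    using mom_split[OF u(1), of 0 "Suc n"] mom_pos[OF u(1), of 1 "Suc n"] by (simp add: \<alpha>_def)
  have X1: "X k > 1" for k
    using \<alpha>pos[of "Suc k"] \<alpha>dec[of k] by (simp add: X_def field_simps)
  have Xk: "X k = X 0 + k * d" for k
    unfolding d_def
    by (rule inverse_arith_progression, unfold X_def \<alpha>_def, rule tilt_sym_progression[OF u sym])
  consider "d < 0" | "d = 0" | "d > 0" by linarith
  then show ?thesis
  proof cases
    case 1
    \<comment> \<open>A negative difference would make some \<open>X k\<close> negative, against
      \<open>X k\<close> > 1.\<close>
    obtain k :: nat where "X 0 / - d < k" using reals_Archimedean2 by blast
    then have "X 0 + k * d < 0" using 1 by (simp add: field_simps)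
    with X1[of k] show ?thesis unfolding Xk[of k] by simp
  next
    case 2
    then have "X 1 = X 0" by (simp add: d_def)
    then have "\<alpha> 0 * \<alpha> 2 = \<alpha> 1 ^ 2"
      using \<alpha>dec[of 0] \<alpha>dec[of 1] by (simp add: X_def field_simps power2_eq_square numeral_2_eq_2)
    then show ?thesis
      using Dirac_if_no_variance[OF u(1)] by (simp add: \<alpha>_def numeral_2_eq_2 numeral_3_eq_3)
  next
    case 3
    \<comment> \<open>The parameters solve \<open>X k\<close> = (p + Q + k) / p for all k.\<close>
    define p where "p = 1 / d"
    define Q where "Q = (X 0 - 1) / d"
    have p: "p > 0" and Q: "Q > 0" using 3 X1[of 0] by (auto simp: p_def Q_def)
    have ratio: "\<alpha> (Suc k) * (p + Q + k) = \<alpha> k * (Q + k)" for k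
    proof -
      have "p + Q + k = X k / d" "Q + k = (X k - 1) / d"
        using 3 by (simp_all add: Xk[of k] p_def Q_def field_simps)
      moreover have "\<alpha> (Suc k) * X k = \<alpha> k * (X k - 1)"
        using \<alpha>dec[of k] by (simp add: X_def field_simps)
      ultimately show ?thesis by simp
    qed
    let ?B = "beta_measure p Q"
    note uB = unit_law_beta[OF p Q]
    have A0: "mom \<mu> 0 (Suc n) = \<alpha> 0 * mom ?B 0 n" for n
    proof (induction n)
      case (Suc n)
      have "mom \<mu> 0 (Suc (Suc n)) * (p + Q + n) = \<alpha> 0 * mom ?B 0 (Suc n) * (p + Q + n)"
        using ratio[of n] mom_beta_ratio[OF p Q, of n] Suc.IH by (simp add: \<alpha>_def algebra_simps)
      moreover have "p + Q + n \<noteq> 0" using p Q by simp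
      ultimately show ?case by (simp only: mult_cancel_right) auto
    qed (simp add: \<alpha>_def mom_0_0 uB)
    have A: "mom \<mu> m (Suc n) = \<alpha> 0 * mom ?B m n" for m n
    proof (induction m arbitrary: n)
      case (Suc m)
      then show ?case
        using mom_split[OF u(1), of m "Suc n"] mom_split[OF uB, of m n]
        by (simp add: algebra_simps)
    qed (rule A0)
    have "Q > 1"
    proof (rule ccontr)
      assume "\<not> Q > 1"
      then have Q1: "Q \<le> 1" by simp
      \<comment> \<open>\<open>s m\<close> is the m-th moment of the beta law with parameters p and
        1; for Q at most 1 the law \<open>?B\<close> has moments at least as large.\<close>
      define s where "s m = p / (p + real m)" for m
      have lb: "mom ?B m 0 \<ge> s m" for m
      proof (induction m)
        case (Suc m)
        have ne: "p + real m \<notin> \<int>\<^sub>\<le>\<^sub>0"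
          using nonpos_Ints_nonpos[of "p + real m"] p by (auto simp: add_pos_nonneg)
        have eq: "(p + m + Q) * mom ?B (Suc m) 0 = (p + m) * mom ?B m 0"
          using Beta_plus1_left[OF ne, of Q] Beta_real_pos[OF p Q]
          by (simp add: mom_beta[OF p Q] field_simps)
        have "p = (p + m) * s m" using p by (simp add: s_def)
        also have "\<dots> \<le> (p + m) * mom ?B m 0" using p Suc.IH by (intro mult_left_mono) auto
        also have "\<dots> \<le> (p + m + 1) * mom ?B (Suc m) 0"
          unfolding eq[symmetric] using Q1 mom_pos[OF uB, of "Suc m" 0] by (intro mult_right_mono) auto
        finally show ?case using p by (simp add: s_def field_simps)
      qed (use p in \<open>simp add: mom_0_0 uB s_def\<close>)
      \<comment> \<open>Summing a^m (1 - a) over m telescopes, so these tilted moments have sum at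
        most 1, whereas a lower bound of order 1 / m would make the sum diverge.\<close>
      have sum: "(\<Sum>m<N. mom \<mu> m 1) = 1 - mom \<mu> N 0" for N
      proof (induction N)
        case (Suc N)
        then show ?case using mom_split[OF u(1), of N 0] by simp
      qed (simp add: mom_0_0 u)
      have "summable s"
      proof (rule bounded_imp_summable)
        show "0 \<le> s n" for n using p by (simp add: s_def)
        fix N
        have "\<alpha> 0 * (\<Sum>m\<le>N. s m) \<le> (\<Sum>m<Suc N. mom \<mu> m 1)"
          unfolding sum_distrib_left lessThan_Suc_atMost
          using lb \<alpha>pos[of 0] A[of _ 0] by (intro sum_mono) auto
        also have "\<dots> \<le> 1" unfolding sum using mom_pos[OF u(1), of "Suc N" 0] by simp
        finally show "(\<Sum>m\<le>N. s m) \<le> 1 / \<alpha> 0" using \<alpha>pos[of 0] by (simp add: field_simps)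
      qed
      then have "summable (\<lambda>m. (p + 1) / p * s m)" by (rule summable_mult)
      then have "summable (\<lambda>m. inverse (real (Suc m)))"
      proof (rule summable_comparison_test'[where N = 0])
        fix m
        have "(p + 1) / p * s m = (p + 1) / (p + m)" using p by (simp add: s_def)
        moreover have "inverse (real (Suc m)) \<le> (p + 1) / (p + m)"
          using p by (simp add: field_simps)
        ultimately show "norm (inverse (real (Suc m))) \<le> (p + 1) / p * s m" by simp
      qed
      then have "summable (\<lambda>m. inverse (real m))" by (subst (asm) summable_Suc_iff)
      with not_summable_harmonic[where 'a = real] show False by (simp add: inverse_eq_divide)
    qed
    then have q: "Q - 1 > 0" by simp
    \<comment> \<open>Removing the tilt divides the beta density with parameters p and Q by 1 - a,
      which lowers the second parameter by one.\<close>
    have "\<mu> = beta_measure p (Q - 1)"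
    proof (rule unit_law_eqI_tilted_moments[OF u(1) unit_law_beta[OF p q]])
      show "mom \<mu> 0 (Suc n) = (\<alpha> 0 * Beta p (Q - 1) / Beta p Q) * mom (beta_measure p (Q - 1)) 0 (Suc n)" for n
        using Beta_real_pos[OF p q] Beta_real_pos[OF p Q]
        by (simp add: A0 mom_beta[OF p q] mom_beta[OF p Q] algebra_simps)
    qed
    with p q show ?thesis by blast
  qed
qed

text \<open>Fix one b for which the relation holds for almost every a. Then a \<mapsto> a / (1 - (1
  - a) b) maps (0, 1) onto itself and is differentiable, so it sends the exceptional null set to a
  null set, outside of which h takes the value h b.\<close>

lemma moebius_invariant_AE_const:
  fixes h :: "real \<Rightarrow> real"
  assumes [measurable]: "h \<in> borel_measurable borel"
    and ae: "AE a in lborel. AE b in lborel. 0 < a \<and> a < 1 \<and> 0 < b \<and> b < 1 \<longrightarrow> h b = h (a / (1 - (1 - a) * b))"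
  shows "\<exists>c. AE b in lborel. 0 < b \<and> b < 1 \<longrightarrow> h b = c"
proof -
  let ?Q = "\<lambda>a b. 0 < a \<and> a < 1 \<and> 0 < b \<and> b < (1::real) \<longrightarrow> h b = h (a / (1 - (1 - a) * b))"
  have "{x \<in> space (lborel \<Otimes>\<^sub>M lborel). ?Q (fst x) (snd x)} \<in> sets (lborel \<Otimes>\<^sub>M lborel)"
    by measurable
  \<comment> \<open>The order of the quantifiers is exchanged so that a single good b can be
    fixed.\<close>
  from lborel_pair.AE_commute[where P = ?Q, OF this] ae
  have "AE b in lborel. AE a in lborel. ?Q a b" by blast
  moreover have "\<not> (AE b in lborel. \<not> (0 < b \<and> b < (1::real)))"
  proof
    assume "AE b in lborel. \<not> (0 < b \<and> b < (1::real))"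
    then have "emeasure lborel {b \<in> space lborel. 0 < b \<and> b < (1::real)} = 0"
      by (subst (asm) AE_iff_measurable[OF _ refl]) auto
    moreover have "{b \<in> space lborel. 0 < b \<and> b < (1::real)} = {0<..<1}" by auto
    ultimately show False by simp
  qed
  ultimately have "\<exists>b. (AE a in lborel. ?Q a b) \<and> 0 < b \<and> b < 1"
    by (metis (mono_tags, lifting) eventually_mono)
  then obtain b where b: "0 < b" "b < 1" and "AE a in lborel. ?Q a b" by auto
  then obtain N where N: "N \<in> null_sets lborel" "{a \<in> space lborel. \<not> ?Q a b} \<subseteq> N"
    unfolding eventually_ae_filter by auto
  define m where "m a = a / (1 - (1 - a) * b)" for a
  have den: "1 - (1 - a) * b > 0" if "0 \<le> a" "a \<le> 1" for a
  proof -
    have "(1 - a) * b \<le> 1 * b" using that b by (intro mult_right_mono) auto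
    with b show ?thesis by linarith
  qed
  have "negligible N" using N(1) by (simp add: negligible_iff_null_sets null_sets_completionI)
  then have neg: "negligible (N \<inter> {0..1})" by (rule negligible_subset) auto
  have "m differentiable_on N \<inter> {0..1}"
    unfolding differentiable_on_def m_def
  proof
    fix a assume "a \<in> N \<inter> {0..1}"
    then have "1 - (1 - a) * b \<noteq> 0" using den[of a] by auto
    then show "(\<lambda>a. a / (1 - (1 - a) * b)) differentiable at a within N \<inter> {0..1}"
      by (intro differentiable_divide differentiable_diff differentiable_mult
          differentiable_ident differentiable_const)
  qed
  then have "negligible (m ` (N \<inter> {0..1}))"
    by (rule negligible_differentiable_image_negligible[OF order_refl neg])
  moreover have "{u. 0 < u \<and> u < 1 \<and> h u \<noteq> h b} \<subseteq> m ` (N \<inter> {0..1})"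
  proof
    fix u assume "u \<in> {u. 0 < u \<and> u < 1 \<and> h u \<noteq> h b}"
    then have u: "0 < u" "u < 1" "h u \<noteq> h b" by auto
    \<comment> \<open>The preimage of u under the Moebius map \<open>m\<close>.\<close>
    define a where "a = u * (1 - b) / (1 - u * b)"
    have "u * b < 1 * 1" using u b by (intro mult_strict_mono) auto
    then have ub: "1 - u * b > 0" by simp
    have a0: "a > 0" using u b ub by (simp add: a_def)
    have a1: "a < 1" using u b ub by (simp add: a_def field_simps)
    have "1 - (1 - a) * b = (1 - b) / (1 - u * b)" using ub by (simp add: a_def field_simps)
    then have "m a = u" using ub b by (simp add: m_def a_def)
    moreover from this have "a \<in> N" using N(2) u b a0 a1 by (auto simp: m_def)
    ultimately show "u \<in> m ` (N \<inter> {0..1})" using a0 a1 by force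
  qed
  ultimately have "negligible {u. 0 < u \<and> u < 1 \<and> h u \<noteq> h b}" by (rule negligible_subset)
  moreover have "{u. 0 < u \<and> u < 1 \<and> h u \<noteq> h b} \<in> sets lborel" by measurable
  ultimately have "{u. 0 < u \<and> u < 1 \<and> h u \<noteq> h b} \<in> null_sets lborel"
    by (simp add: negligible_iff_null_sets null_sets_completion_iff)
  then have "AE u in lborel. u \<notin> {u. 0 < u \<and> u < 1 \<and> h u \<noteq> h b}" by (rule AE_not_in)
  then show ?thesis by (auto intro!: exI[of _ "h b"] elim!: eventually_mono)
qed

section \<open>Invariance as an exchange symmetry\<close>

lemma stick_weights_sum: "(\<Sum>i<n. stick_weights v i x) = 1 - (\<Prod>i<n. 1 - v i x)"
  by (induction n) (auto simp: stick_weights_def algebra_simps)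

text \<open>Some index outside the finite set still carries positive weight. Consequently the
  fallback branch of \<open>sb_step\<close> is never reached for such weights.\<close>

lemma sum_less_1_if_sums:
  fixes u :: "nat \<Rightarrow> real"
  assumes "u sums 1" "\<And>j. u j > 0" "finite S"
  shows "(\<Sum>i\<in>S. u i) < 1"
proof -
  obtain n where n: "n \<notin> S" using assms(3) ex_new_if_finite infinite_UNIV_nat by blast
  have "(\<Sum>i\<in>insert n S. u i) \<le> suminf u"
    using assms by (intro sum_le_suminf) (auto simp: sums_iff less_imp_le)
  also have "\<dots> = 1" using assms(1) by (simp add: sums_iff)
  finally have "u n + (\<Sum>i\<in>S. u i) \<le> 1" using n assms(3) by simp
  with assms(2)[of n] show ?thesis by linarith
qed

lemma sum_set_distinct: "distinct js \<Longrightarrow> (\<Sum>i\<in>set js. u i) = (\<Sum>l<length js. u (js ! l))"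
  using sum.reindex_bij_betw[OF bij_betw_nth[OF _ refl refl], of js u] by simp

lemma sum_nth_less_1:
  fixes u :: "nat \<Rightarrow> real"
  assumes u: "u sums 1" "\<And>j. u j > 0" and js: "distinct js" "i \<le> length js"
  shows "(\<Sum>l<i. u (js ! l)) < 1"
proof -
  have "(\<Sum>l<i. u (js ! l)) = (\<Sum>l<length (take i js). u (take i js ! l))"
    using js by (intro sum.cong) auto
  also have "\<dots> = (\<Sum>m\<in>set (take i js). u m)"
    by (rule sum_set_distinct[OF distinct_take[OF js(1)], symmetric])
  also have "\<dots> < 1" by (rule sum_less_1_if_sums[OF u]) simp
  finally show ?thesis .
qed

lemma sb_prob_snoc: "sb_prob u (js @ [j]) = sb_prob u js * sb_step u (rev js) j"
  by (simp add: sb_prob_def)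

lemma sb_prob_eq:
  fixes u :: "nat \<Rightarrow> real"
  assumes u: "u sums 1" "\<And>j. u j > 0"
  shows "sb_prob u js = (if distinct js then \<Prod>i<length js. u (js ! i) / (1 - (\<Sum>l<i. u (js ! l))) else 0)"
proof (induction js rule: rev_induct)
  case Nil
  then show ?case by (simp add: sb_prob_def)
next
  case (snoc j js)
  have lt: "(\<Sum>i\<in>set js. u i) < 1" by (rule sum_less_1_if_sums[OF u]) auto
  show ?case
  proof (cases "distinct js")
    case True
    have "(\<Prod>i<length js. u ((js @ [j]) ! i) / (1 - (\<Sum>l<i. u ((js @ [j]) ! l))))
        = (\<Prod>i<length js. u (js ! i) / (1 - (\<Sum>l<i. u (js ! l))))"
      by (intro prod.cong arg_cong2[where f = "(/)"] arg_cong2[where f = "(-)"] sum.cong)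
        (auto simp: nth_append)
    moreover have "(\<Sum>l<length js. u ((js @ [j]) ! l)) = (\<Sum>l<length js. u (js ! l))"
      by (intro sum.cong) (auto simp: nth_append)
    ultimately show ?thesis
      using True lt by (simp add: sb_prob_snoc snoc sb_step_def sum_set_distinct)
  qed (simp add: sb_prob_snoc snoc)
qed

lemma sb_prob_pos:
  fixes u :: "nat \<Rightarrow> real"
  assumes u: "u sums 1" "\<And>j. u j > 0" and js: "distinct js"
  shows "sb_prob u js > 0"
  using js sum_nth_less_1[OF u js]
  by (auto simp: sb_prob_eq[OF u] less_imp_le intro!: prod_pos divide_pos_pos u)

text \<open>vswap n exchanges the weights at positions n and n + 1, written in length variables.\<close>

definition vswap :: "nat \<Rightarrow> (nat \<Rightarrow> real) \<Rightarrow> nat \<Rightarrow> real" where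
  "vswap n u = u(n := (1 - u n) * u (Suc n), Suc n := u n / (1 - (1 - u n) * u (Suc n)))"

lemma countable_lists_length: "countable {js :: nat list. length js = k}"
  by (rule countable_subset[OF subset_UNIV]) auto

abbreviation listM :: "nat \<Rightarrow> (nat \<Rightarrow> real) measure" where
  "listM k \<equiv> PiM {..<k} (\<lambda>_. borel)"

locale stick_breaking = prob_space M for M :: "'a measure" +
  fixes v :: "nat \<Rightarrow> 'a \<Rightarrow> real"
  assumes v_measurable[measurable]: "v j \<in> borel_measurable M"
    and v_range: "x \<in> space M \<Longrightarrow> v j x \<in> {0..1}"
    and weights_AE: "AE x in M. (\<lambda>j. stick_weights v j x) sums 1 \<and> (\<forall>j. stick_weights v j x > 0)"
begin

abbreviation w :: "nat \<Rightarrow> 'a \<Rightarrow> real" where "w \<equiv> stick_weights v"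

lemma w_measurable[measurable]: "w j \<in> borel_measurable M"
  unfolding stick_weights_def[abs_def] by measurable

lemma sb_prob_measurable[measurable]: "(\<lambda>x. sb_prob (\<lambda>j. w j x) js) \<in> borel_measurable M"
proof -
  have "(\<lambda>x. sb_prob_rev (\<lambda>j. w j x) rs) \<in> borel_measurable M" for rs
    by (induction rs) (auto simp: sb_step_def)
  then show ?thesis unfolding sb_prob_def by simp
qed

lemma v_AE: "AE x in M. \<forall>j. 0 < v j x \<and> v j x < 1"
  using weights_AE AE_space
proof eventually_elim
  case (elim x)
  show ?case
  proof
    fix j
    have "v j x \<noteq> 0" using elim by (auto simp: stick_weights_def dest: spec[of _ j])
    \<comment> \<open>v j = 1 would use up the whole stick and make the next weight zero.\<close>
    moreover have "v j x \<noteq> 1" using elim by (auto simp: stick_weights_def dest: spec[of _ "Suc j"])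
    ultimately show "0 < v j x \<and> v j x < 1" using v_range[of x j] elim by auto
  qed
qed

text \<open>Invariance equates two finite-dimensional laws. The law \<open>N\<close> of the selected
  weights is a pushforward of counting measure times M with density \<open>sb_prob\<close>, which
  carries the equality from sets to integrals.\<close>

lemma sb_invariant_nn_integral:
  assumes inv: "sb_invariant M w"
    and f[measurable]: "f \<in> borel_measurable (listM k)"
  shows "(\<integral>\<^sup>+ x. (\<integral>\<^sup>+ js. ennreal (sb_prob (\<lambda>j. w j x) js) * f (\<lambda>i\<in>{..<k}. w (js ! i) x)
              \<partial>count_space {js. length js = k}) \<partial>M)
     = (\<integral>\<^sup>+ x. f (\<lambda>i\<in>{..<k}. w i x) \<partial>M)"
proof -
  let ?L = "{js :: nat list. length js = k}" and ?P = "listM k"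
  interpret L: sigma_finite_measure "count_space ?L"
    by (rule sigma_finite_measure_count_space_countable[OF countable_lists_length])
  interpret LM: pair_sigma_finite "count_space ?L" M ..
  have sb[measurable]: "(\<lambda>(js, x). ennreal (sb_prob (\<lambda>j. w j x) js)) \<in> borel_measurable (count_space ?L \<Otimes>\<^sub>M M)"
    by (intro measurable_pair_measure_countable1[OF countable_lists_length]) simp
  have W[measurable]: "(\<lambda>(js, x). \<lambda>i\<in>{..<k}. w (js ! i) x) \<in> count_space ?L \<Otimes>\<^sub>M M \<rightarrow>\<^sub>M ?P"
    by (intro measurable_pair_measure_countable1[OF countable_lists_length]) simp
  have W1[measurable]: "(\<lambda>x. \<lambda>i\<in>{..<k}. w i x) \<in> M \<rightarrow>\<^sub>M ?P" by simp
  define N where "N = distr (density (count_space ?L \<Otimes>\<^sub>M M) (\<lambda>(js, x). ennreal (sb_prob (\<lambda>j. w j x) js))) ?P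
     (\<lambda>(js, x). \<lambda>i\<in>{..<k}. w (js ! i) x)"
  have int: "(\<integral>\<^sup>+ y. g y \<partial>N) = (\<integral>\<^sup>+ x. (\<integral>\<^sup>+ js. ennreal (sb_prob (\<lambda>j. w j x) js) * g (\<lambda>i\<in>{..<k}. w (js ! i) x)
      \<partial>count_space ?L) \<partial>M)" if [measurable]: "g \<in> borel_measurable ?P" for g
  proof -
    have "(\<integral>\<^sup>+ y. g y \<partial>N) = (\<integral>\<^sup>+ p. (\<lambda>(js, x). ennreal (sb_prob (\<lambda>j. w j x) js)) p
        * g ((\<lambda>(js, x). \<lambda>i\<in>{..<k}. w (js ! i) x) p) \<partial>(count_space ?L \<Otimes>\<^sub>M M))"
      unfolding N_def by (subst nn_integral_distr, measurable) (subst nn_integral_density, measurable)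
    also have "\<dots> = (\<integral>\<^sup>+ x. (\<integral>\<^sup>+ js. (\<lambda>(js, x). ennreal (sb_prob (\<lambda>j. w j x) js)) (js, x)
        * g ((\<lambda>(js, x). \<lambda>i\<in>{..<k}. w (js ! i) x) (js, x)) \<partial>count_space ?L) \<partial>M)"
      by (rule LM.nn_integral_snd[symmetric]) measurable
    finally show ?thesis by simp
  qed
  have "N = distr M ?P (\<lambda>x. \<lambda>i\<in>{..<k}. w i x)"
  proof (rule measure_eqI)
    fix A assume "A \<in> sets N"
    then have A[measurable]: "A \<in> sets ?P" by (simp add: N_def)
    have "emeasure N A = (\<integral>\<^sup>+ y. indicator A y \<partial>N)" using \<open>A \<in> sets N\<close> by simp
    also have "\<dots> = emeasure M {x \<in> space M. (\<lambda>i\<in>{..<k}. w i x) \<in> A}"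
      using inv A by (subst int) (auto simp: sb_invariant_def)
    finally show "emeasure N A = emeasure (distr M ?P (\<lambda>x. \<lambda>i\<in>{..<k}. w i x)) A"
      by (simp add: emeasure_distr vimage_def Int_def conj_commute)
  qed (simp add: N_def)
  then show ?thesis using int[OF f] by (simp add: nn_integral_distr)
qed

text \<open>Every selection of distinct positions has positive conditional probability, so an event
  that is null for the first k weights is null at every such selection.\<close>

lemma sb_invariant_AE_notin:
  assumes inv: "sb_invariant M w"
    and A[measurable]: "A \<in> sets (listM k)"
    and null: "AE x in M. (\<lambda>i\<in>{..<k}. w i x) \<notin> A"
  shows "AE x in M. \<forall>js. length js = k \<and> distinct js \<longrightarrow> (\<lambda>i\<in>{..<k}. w (js ! i) x) \<notin> A"
proof -
  let ?L = "{js :: nat list. length js = k}" and ?P = "listM k"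
  interpret L: sigma_finite_measure "count_space ?L"
    by (rule sigma_finite_measure_count_space_countable[OF countable_lists_length])
  have W[measurable]: "(\<lambda>x. \<lambda>i\<in>{..<k}. w (js ! i) x) \<in> M \<rightarrow>\<^sub>M ?P" for js by simp
  let ?F = "\<lambda>js x. ennreal (sb_prob (\<lambda>j. w j x) js) * indicator A (\<lambda>i\<in>{..<k}. w (js ! i) x)"
  interpret LM: pair_sigma_finite "count_space ?L" M ..
  have F: "(\<lambda>(js, x). ?F js x) \<in> borel_measurable (count_space ?L \<Otimes>\<^sub>M M)"
    by (rule measurable_pair_measure_countable1[OF countable_lists_length]) simp
  have "(\<integral>\<^sup>+ x. (\<integral>\<^sup>+ js. ?F js x \<partial>count_space ?L) \<partial>M) = (\<integral>\<^sup>+ x. indicator A (\<lambda>i\<in>{..<k}. w i x) \<partial>M)"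
    by (rule sb_invariant_nn_integral[OF inv]) simp
  also have "\<dots> = (\<integral>\<^sup>+ x. 0 \<partial>M)"
    using null by (intro nn_integral_cong_AE) (auto elim!: eventually_mono)
  finally have "(\<integral>\<^sup>+ x. (\<integral>\<^sup>+ js. ?F js x \<partial>count_space ?L) \<partial>M) = 0" by simp
  moreover have "(\<lambda>x. \<integral>\<^sup>+ js. ?F js x \<partial>count_space ?L) \<in> borel_measurable M"
    using L.borel_measurable_nn_integral_fst[OF measurable_compose[OF measurable_pair_swap' F]] by simp
  ultimately have "AE x in M. (\<integral>\<^sup>+ js. ?F js x \<partial>count_space ?L) = 0"
    by (simp add: nn_integral_0_iff_AE)
  then show ?thesis using weights_AE
  proof eventually_elim
    case (elim x)
    then have *: "?F js x = 0" if "length js = k" for js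
      using that by (auto simp: nn_integral_0_iff_AE AE_count_space)
    show ?case
    proof (safe)
      fix js :: "nat list" assume k: "k = length js" and d: "distinct js"
        and inA: "(\<lambda>i\<in>{..<length js}. w (js ! i) x) \<in> A"
      have "sb_prob (\<lambda>j. w j x) js > 0" using elim d by (intro sb_prob_pos) auto
      then show False using *[of js] inA k by (simp add: not_le ennreal_eq_0_iff)
    qed
  qed
qed

text \<open>Multiplying by the remaining masses cancels the denominators in \<open>sb_prob\<close>.
  What is left is a sum over selections of distinct indices of the plain product of the selected
  weights, and this product does not change when the selection is reordered.\<close>

lemma sb_invariant_symmetric:
  assumes inv: "sb_invariant M w"
    and g[measurable]: "g \<in> borel_measurable (listM k)"
    and \<tau>: "\<tau> permutes {..<k}"
  shows "(\<integral>\<^sup>+ x. ennreal (\<Prod>i<k. 1 - (\<Sum>l<i. w l x)) * g (\<lambda>i\<in>{..<k}. w i x) \<partial>M)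
    = (\<integral>\<^sup>+ x. ennreal (\<Prod>i<k. 1 - (\<Sum>l<i. w l x)) * g (\<lambda>i\<in>{..<k}. w (\<tau> i) x) \<partial>M)"
proof -
  let ?L = "{js :: nat list. length js = k}" and ?P = "listM k"
  let ?S = "\<lambda>g x. \<integral>\<^sup>+ js. (if distinct js then ennreal (\<Prod>i<k. w (js ! i) x) * g (\<lambda>i\<in>{..<k}. w (js ! i) x) else 0)
      \<partial>count_space ?L"
  have main: "(\<integral>\<^sup>+ x. ennreal (\<Prod>i<k. 1 - (\<Sum>l<i. w l x)) * g (\<lambda>i\<in>{..<k}. w i x) \<partial>M)
      = (\<integral>\<^sup>+ x. ?S g x \<partial>M)" if [measurable]: "g \<in> borel_measurable ?P" for g
  proof -
    let ?f = "\<lambda>y. ennreal (\<Prod>i<k. 1 - (\<Sum>l<i. y l)) * g y"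
    have comp: "(\<lambda>y. y i) \<in> borel_measurable ?P" if "i < k" for i
      using that by simp
    have [measurable]: "(\<lambda>y. \<Prod>i<k. 1 - (\<Sum>l<i. y l)) \<in> borel_measurable ?P"
      by (intro borel_measurable_prod borel_measurable_diff borel_measurable_sum comp) auto
    have "(\<integral>\<^sup>+ x. ennreal (\<Prod>i<k. 1 - (\<Sum>l<i. w l x)) * g (\<lambda>i\<in>{..<k}. w i x) \<partial>M)
      = (\<integral>\<^sup>+ x. ?f (\<lambda>i\<in>{..<k}. w i x) \<partial>M)"
      by (intro nn_integral_cong arg_cong2[where f = times] arg_cong[where f = ennreal] prod.cong
          arg_cong2[where f = "(-)"] sum.cong) auto
    also have "\<dots> = (\<integral>\<^sup>+ x. (\<integral>\<^sup>+ js. ennreal (sb_prob (\<lambda>j. w j x) js) * ?f (\<lambda>i\<in>{..<k}. w (js ! i) x)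
              \<partial>count_space ?L) \<partial>M)"
      by (rule sb_invariant_nn_integral[OF inv, symmetric]) simp
    also have "\<dots> = (\<integral>\<^sup>+ x. ?S g x \<partial>M)"
      using weights_AE
    proof (intro nn_integral_cong_AE, eventually_elim)
      case (elim x)
      show ?case
      proof (rule nn_integral_cong)
        fix js assume "js \<in> space (count_space ?L)"
        then have len: "length js = k" by simp
        show "ennreal (sb_prob (\<lambda>j. w j x) js) * ?f (\<lambda>i\<in>{..<k}. w (js ! i) x)
          = (if distinct js then ennreal (\<Prod>i<k. w (js ! i) x) * g (\<lambda>i\<in>{..<k}. w (js ! i) x) else 0)"
        proof (cases "distinct js")
          case True
          have pos: "1 - (\<Sum>l<i. w (js ! l) x) > 0" if "i < k" for i
            using sum_nth_less_1[of "\<lambda>j. w j x" js i] elim True that len by simp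
          have "(\<Prod>i<k. 1 - (\<Sum>l<i. (\<lambda>i\<in>{..<k}. w (js ! i) x) l)) = (\<Prod>i<k. 1 - (\<Sum>l<i. w (js ! l) x))"
            by (intro prod.cong arg_cong2[where f = "(-)"] sum.cong) auto
          moreover have "sb_prob (\<lambda>j. w j x) js * (\<Prod>i<k. 1 - (\<Sum>l<i. w (js ! l) x)) = (\<Prod>i<k. w (js ! i) x)"
          proof -
            have "w (js ! i) x / (1 - (\<Sum>l<i. w (js ! l) x)) * (1 - (\<Sum>l<i. w (js ! l) x)) = w (js ! i) x"
              if "i < k" for i using pos[OF that] by simp
            then show ?thesis
              using elim True len by (subst sb_prob_eq) (auto simp: prod.distrib[symmetric] intro!: prod.cong)
          qed
          moreover have "sb_prob (\<lambda>j. w j x) js \<ge> 0"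
            using elim True by (intro less_imp_le sb_prob_pos) auto
          moreover have "(\<Prod>i<k. 1 - (\<Sum>l<i. w (js ! l) x)) \<ge> 0"
            using pos by (intro prod_nonneg) (auto simp: less_imp_le)
          ultimately show ?thesis using True
            by (simp add: mult.assoc[symmetric] ennreal_mult[symmetric])
        next
          case False
          then show ?thesis using elim by (subst sb_prob_eq) auto
        qed
      qed
    qed
    finally show ?thesis .
  qed
  have \<tau>k: "\<tau> i < k \<longleftrightarrow> i < k" for i using permutes_in_image[OF \<tau>, of i] by simp
  have [measurable]: "(\<lambda>y. \<lambda>i\<in>{..<k}. y (\<tau> i)) \<in> ?P \<rightarrow>\<^sub>M ?P"
    by (rule measurable_restrict) (auto simp: \<tau>k)
  let ?g = "\<lambda>y. g (\<lambda>i\<in>{..<k}. y (\<tau> i))"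
  have res: "(\<lambda>i\<in>{..<k}. (\<lambda>i\<in>{..<k}. z i) (\<tau> i)) = (\<lambda>i\<in>{..<k}. z (\<tau> i))" for z :: "nat \<Rightarrow> real"
    by (auto simp: \<tau>k restrict_def)
  \<comment> \<open>Reordering the entries of a selection by \<tau> permutes the index set of the
    sum.\<close>
  let ?sw = "\<lambda>\<tau> js. map (\<lambda>i. js ! \<tau> i) [0..<k] :: nat list"
  have bij: "bij_betw (?sw \<tau>) ?L ?L"
  proof (rule bij_betw_byWitness[where f' = "?sw (inv \<tau>)"])
    have ik: "inv \<tau> i < k \<longleftrightarrow> i < k" for i using permutes_in_image[OF permutes_inv[OF \<tau>], of i] by simp
    show "\<forall>js\<in>?L. ?sw (inv \<tau>) (?sw \<tau> js) = js"
    proof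
      fix js :: "nat list" assume "js \<in> ?L"
      then show "?sw (inv \<tau>) (?sw \<tau> js) = js"
        by (intro nth_equalityI) (simp_all add: ik permutes_inverses[OF \<tau>])
    qed
    show "\<forall>js\<in>?L. ?sw \<tau> (?sw (inv \<tau>) js) = js"
    proof
      fix js :: "nat list" assume "js \<in> ?L"
      then show "?sw \<tau> (?sw (inv \<tau>) js) = js"
        by (intro nth_equalityI) (simp_all add: \<tau>k permutes_inverses[OF \<tau>])
    qed
  qed auto
  have S_eq: "?S g x = ?S ?g x" for x
  proof -
    have "?S g x = (\<integral>\<^sup>+ js. (if distinct (?sw \<tau> js) then ennreal (\<Prod>i<k. w (?sw \<tau> js ! i) x)
        * g (\<lambda>i\<in>{..<k}. w (?sw \<tau> js ! i) x) else 0) \<partial>count_space ?L)"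
      by (rule nn_integral_bij_count_space[OF bij, symmetric])
    also have "\<dots> = ?S ?g x"
    proof (rule nn_integral_cong)
      fix js assume "js \<in> space (count_space ?L)"
      then have len: "length js = k" by simp
      have "?sw \<tau> js = permute_list \<tau> js" using len by (simp add: permute_list_def)
      then have "mset (?sw \<tau> js) = mset js" using \<tau> len by simp
      then have d: "distinct (?sw \<tau> js) \<longleftrightarrow> distinct js" by (rule mset_eq_imp_distinct_iff)
      have "(\<Prod>i<k. w (?sw \<tau> js ! i) x) = (\<Prod>i<k. w (js ! \<tau> i) x)" by (intro prod.cong) auto
      also have "\<dots> = (\<Prod>i<k. w (js ! i) x)"
        using prod.permute[OF \<tau>, of "\<lambda>i. w (js ! i) x"] by (simp add: comp_def)
      finally have "(\<Prod>i<k. w (?sw \<tau> js ! i) x) = (\<Prod>i<k. w (js ! i) x)" .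
      moreover have "(\<lambda>i\<in>{..<k}. w (?sw \<tau> js ! i) x) = (\<lambda>i\<in>{..<k}. w (js ! \<tau> i) x)"
        by (auto simp: restrict_def)
      ultimately show "(if distinct (?sw \<tau> js) then ennreal (\<Prod>i<k. w (?sw \<tau> js ! i) x)
          * g (\<lambda>i\<in>{..<k}. w (?sw \<tau> js ! i) x) else 0)
        = (if distinct js then ennreal (\<Prod>i<k. w (js ! i) x) * ?g (\<lambda>i\<in>{..<k}. w (js ! i) x) else 0)"
        using res[of "\<lambda>i. w (js ! i) x"] by (simp only: d)
    qed
    finally show ?thesis .
  qed
  have g': "?g \<in> borel_measurable ?P" by measurable
  show ?thesis using main[OF g] main[OF g', unfolded res] S_eq[unfolded res] by (simp only:)
qed

text \<open>Under the transposition of n and n + 1 every remaining mass \<open>s i\<close> with i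
  \<noteq> n + 1 is unchanged. Dividing the product of all remaining masses by the invariant
  quantity \<open>Q\<close> leaves \<open>s (Suc n)\<close> / \<open>s n\<close>, that is 1 - v
  n.\<close>

lemma sb_invariant_vswap:
  assumes inv: "sb_invariant M w"
    and G[measurable]: "G \<in> borel_measurable (listM k)"
    and n: "Suc n < k"
  shows "(\<integral>\<^sup>+ x. ennreal (1 - v n x) * G (\<lambda>j\<in>{..<k}. v j x) \<partial>M)
    = (\<integral>\<^sup>+ x. ennreal (1 - v n x) * G (\<lambda>j\<in>{..<k}. vswap n (\<lambda>i. v i x) j) \<partial>M)"
proof -
  let ?P = "listM k"
  define s where "s i y = 1 - (\<Sum>l<i. y l)" for i and y :: "nat \<Rightarrow> real"
  define Q where "Q y = (\<Prod>i\<in>{..<k} - {Suc n}. s i y) * s n y" for y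
  \<comment> \<open>\<open>V\<close> recovers length variables from weights: each weight is divided
    by the mass remaining before it.\<close>
  define V where "V y = (\<lambda>j\<in>{..<k}. y j / s j y)" for y
  define g where "g y = ennreal (inverse (Q y)) * G (V y)" for y
  define \<tau> where "\<tau> = Transposition.transpose n (Suc n)"
  have comp: "(\<lambda>y. y i) \<in> borel_measurable ?P" if "i < k" for i
    using that by simp
  have s_meas: "s i \<in> borel_measurable ?P" if "i < k" for i
    unfolding s_def[abs_def] using that
    by (intro borel_measurable_diff borel_measurable_sum comp) auto
  have [measurable]: "Q \<in> borel_measurable ?P"
    unfolding Q_def[abs_def] using n by (intro borel_measurable_times borel_measurable_prod s_meas) auto
  have [measurable]: "V \<in> ?P \<rightarrow>\<^sub>M ?P"
    unfolding V_def[abs_def] by (intro measurable_restrict borel_measurable_divide s_meas comp) auto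
  have g[measurable]: "g \<in> borel_measurable ?P" unfolding g_def[abs_def] by measurable
  have \<tau>: "\<tau> permutes {..<k}" unfolding \<tau>_def using n by (intro permutes_swap_id) auto
  have s_restrict: "s i (\<lambda>j\<in>{..<k}. y j) = s i y" if "i < k" for i y
    unfolding s_def using that by (intro arg_cong2[where f = "(-)"] sum.cong) auto
  have Q_restrict: "Q (\<lambda>j\<in>{..<k}. y j) = Q y" for y
    unfolding Q_def using n by (intro arg_cong2[where f = times] prod.cong) (auto simp: s_restrict)
  have V_restrict: "V (\<lambda>j\<in>{..<k}. y j) = V y" for y
    unfolding V_def using s_restrict by (auto simp: fun_eq_iff)
  have s_swap: "s i (\<lambda>j. y (\<tau> j)) = s i y" if "i \<noteq> Suc n" for i y
  proof (cases "i < Suc n")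
    case True
    then have "\<tau> l = l" if "l < i" for l using that by (simp add: \<tau>_def Transposition.transpose_def)
    then show ?thesis by (simp add: s_def)
  next
    case False
    with that have "\<tau> permutes {..<i}" unfolding \<tau>_def by (intro permutes_swap_id) auto
    from sum.permute[OF this, of y] show ?thesis by (simp add: s_def comp_def)
  qed
  have Q_swap: "Q (\<lambda>j. y (\<tau> j)) = Q y" for y
    unfolding Q_def by (intro arg_cong2[where f = times] prod.cong) (auto simp: s_swap)
  have sw: "s i (\<lambda>j. w j x) = (\<Prod>l<i. 1 - v l x)" for i x
    by (simp add: s_def stick_weights_sum)
  have prod_s: "(\<Prod>i<k. s i y) = s (Suc n) y * (\<Prod>i\<in>{..<k} - {Suc n}. s i y)" for y
    using n by (subst prod.remove[of _ "Suc n"]) auto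
  have sym: "(\<integral>\<^sup>+ x. ennreal (\<Prod>i<k. s i (\<lambda>l. w l x)) * g (\<lambda>i\<in>{..<k}. w i x) \<partial>M)
    = (\<integral>\<^sup>+ x. ennreal (\<Prod>i<k. s i (\<lambda>l. w l x)) * g (\<lambda>i\<in>{..<k}. w (\<tau> i) x) \<partial>M)"
    unfolding s_def by (rule sb_invariant_symmetric[OF inv g \<tau>])
  have AE: "AE x in M. ennreal (\<Prod>i<k. s i (\<lambda>l. w l x)) * g (\<lambda>i\<in>{..<k}. w i x)
      = ennreal (1 - v n x) * G (\<lambda>j\<in>{..<k}. v j x) \<and>
    ennreal (\<Prod>i<k. s i (\<lambda>l. w l x)) * g (\<lambda>i\<in>{..<k}. w (\<tau> i) x)
      = ennreal (1 - v n x) * G (\<lambda>j\<in>{..<k}. vswap n (\<lambda>i. v i x) j)"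
    using v_AE
  proof eventually_elim
    case (elim x)
    have ne: "v i x \<noteq> 1" for i using elim by (metis less_irrefl)
    have s_pos: "s i (\<lambda>j. w j x) > 0" for i unfolding sw using elim by (intro prod_pos) auto
    have Qpos: "Q (\<lambda>j. w j x) > 0" unfolding Q_def using s_pos by (auto intro!: mult_pos_pos prod_pos)
    have "(\<Prod>i<k. s i (\<lambda>l. w l x)) * s n (\<lambda>l. w l x) = (1 - v n x) * s n (\<lambda>l. w l x) * Q (\<lambda>j. w j x)"
      unfolding prod_s Q_def by (simp add: sw mult_ac)
    then have "(\<Prod>i<k. s i (\<lambda>l. w l x)) = (1 - v n x) * Q (\<lambda>j. w j x)"
      using s_pos[of n] by simp
    then have wt: "(\<Prod>i<k. s i (\<lambda>l. w l x)) * inverse (Q (\<lambda>j. w j x)) = 1 - v n x"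
      using Qpos by simp
    have wt': "ennreal (\<Prod>i<k. s i (\<lambda>l. w l x)) * ennreal (inverse (Q (\<lambda>j. w j x))) = ennreal (1 - v n x)"
      unfolding wt[symmetric] using s_pos Qpos by (intro ennreal_mult[symmetric] prod_nonneg) (auto simp: less_imp_le)
    have V1: "V (\<lambda>j. w j x) = (\<lambda>j\<in>{..<k}. v j x)"
      using s_pos unfolding V_def sw by (auto simp: stick_weights_def restrict_def fun_eq_iff less_le)
    have V2: "V (\<lambda>j. w (\<tau> j) x) = (\<lambda>j\<in>{..<k}. vswap n (\<lambda>i. v i x) j)"
    proof -
      have "w (\<tau> j) x / s j (\<lambda>j. w (\<tau> j) x) = vswap n (\<lambda>i. v i x) j" for j
      proof -
        consider "j = n" | "j = Suc n" | "j \<noteq> n" "j \<noteq> Suc n" by blast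
        then show ?thesis
        proof cases
          case 1
          then show ?thesis
            using s_pos[of n] s_swap[of n "\<lambda>j. w j x"]
            by (simp add: vswap_def \<tau>_def sw) (simp add: stick_weights_def ne)
        next
          case 2
          have base: "s n (\<lambda>j. w (\<tau> j) x) = s n (\<lambda>j. w j x)"
            by (rule s_swap) simp
          \<comment> \<open>Only the cut between the two positions sees the exchange: the mass
            removed there is w (n + 1) instead of w n.\<close>
          have "s (Suc n) (\<lambda>j. w (\<tau> j) x) = s n (\<lambda>j. w (\<tau> j) x) - w (Suc n) x"
            by (simp add: s_def \<tau>_def)
          also have "\<dots> = s n (\<lambda>j. w j x) * (1 - (1 - v n x) * v (Suc n) x)"
            unfolding base sw by (simp add: stick_weights_def algebra_simps)
          finally show ?thesis using 2 s_pos[of n]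
            by (simp add: vswap_def \<tau>_def sw) (simp add: stick_weights_def ne)
        next
          case 3
          then have "\<tau> j = j" by (simp add: \<tau>_def Transposition.transpose_def)
          then show ?thesis using 3 s_pos[of j] s_swap[of j "\<lambda>j. w j x"]
            by (simp add: vswap_def sw) (simp add: stick_weights_def ne)
        qed
      qed
      then show ?thesis unfolding V_def by (auto simp: restrict_def)
    qed
    show ?case
      unfolding g_def Q_restrict V_restrict V1
      using Q_restrict[of "\<lambda>i. w (\<tau> i) x"] V_restrict[of "\<lambda>i. w (\<tau> i) x"]
      by (simp add: Q_swap[of "\<lambda>j. w j x"] V2 mult.assoc[symmetric] wt')
  qed
  have "(\<integral>\<^sup>+ x. ennreal (1 - v n x) * G (\<lambda>j\<in>{..<k}. v j x) \<partial>M)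
    = (\<integral>\<^sup>+ x. ennreal (\<Prod>i<k. s i (\<lambda>l. w l x)) * g (\<lambda>i\<in>{..<k}. w i x) \<partial>M)"
    by (rule nn_integral_cong_AE, use AE in eventually_elim, metis)
  also note sym
  also have "(\<integral>\<^sup>+ x. ennreal (\<Prod>i<k. s i (\<lambda>l. w l x)) * g (\<lambda>i\<in>{..<k}. w (\<tau> i) x) \<partial>M)
    = (\<integral>\<^sup>+ x. ennreal (1 - v n x) * G (\<lambda>j\<in>{..<k}. vswap n (\<lambda>i. v i x) j) \<partial>M)"
    by (rule nn_integral_cong_AE, use AE in eventually_elim, blast)
  finally show ?thesis .
qed

end

section \<open>The conditional law of the next length variable\<close>

locale markov_stick_breaking = stick_breaking +
  assumes markov: "markov_chain M v"
begin

abbreviation past :: "nat \<Rightarrow> 'a measure" where "past n \<equiv> gen_sigma M v {..n}"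

lemma space_gen_sigma: "space (gen_sigma M v I) = space M"
  unfolding gen_sigma_def by (rule space_measure_of) auto

lemma gen_sigma_gen: "i \<in> I \<Longrightarrow> A \<in> sets borel \<Longrightarrow> v i -` A \<inter> space M \<in> sets (gen_sigma M v I)"
  unfolding gen_sigma_def by (subst sets_measure_of) (auto intro!: sigma_sets.Basic)

lemma measurable_gen_sigma: "i \<in> I \<Longrightarrow> v i \<in> borel_measurable (gen_sigma M v I)"
  by (rule measurableI) (auto simp: space_gen_sigma gen_sigma_gen)

lemma subalgebra_gen_sigma: "subalgebra M (gen_sigma M v I)"
proof -
  have "sets (gen_sigma M v I) \<subseteq> sets M"
    unfolding gen_sigma_def
    by (subst sets_measure_of) (auto intro!: sets.sigma_sets_subset)
  then show ?thesis by (simp add: subalgebra_def space_gen_sigma)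
qed

lemma sigma_finite_subalgebra_gen_sigma: "sigma_finite_subalgebra M (gen_sigma M v I)"
  by (intro finite_measure_subalgebra_is_sigma_finite finite_measure_subalgebra.intro
      finite_measure_subalgebra_axioms.intro subalgebra_gen_sigma finite_measure_axioms)

lemma sets_gen_sigma_singleton:
  assumes "C \<in> sets (gen_sigma M v {n})"
  shows "\<exists>A\<in>sets borel. C = v n -` A \<inter> space M"
proof -
  have "gen_sigma M v {n} = vimage_algebra (space M) (v n) borel"
    unfolding gen_sigma_def vimage_algebra_def by (rule arg_cong[where f = "sigma (space M)"]) auto
  with assms show ?thesis by (auto simp: sets_vimage_algebra2)
qed

text \<open>h (v n) is a version of the conditional probability of v (n + 1) lying in B given v n.\<close>

definition kernel :: "nat \<Rightarrow> real set \<Rightarrow> (real \<Rightarrow> real) \<Rightarrow> bool" where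
  "kernel n B h \<longleftrightarrow> h \<in> borel_measurable borel \<and> (\<forall>u. 0 \<le> h u) \<and>
     (\<forall>A\<in>sets borel. emeasure M {x \<in> space M. v n x \<in> A \<and> v (Suc n) x \<in> B}
        = (\<integral>\<^sup>+ x. indicator A (v n x) * ennreal (h (v n x)) \<partial>M))"

text \<open>Restricted to the event that v (n + 1) lies in B, the law of v n is dominated by its
  full law; h is the Radon-Nikodym density.\<close>

lemma kernel_exists:
  assumes B[measurable]: "B \<in> sets borel"
  shows "\<exists>h. kernel n B h"
proof -
  let ?D = "distr M borel (v n)"
  let ?N = "distr (density M (\<lambda>x. indicator B (v (Suc n) x))) borel (v n)"
  interpret D: prob_space ?D by (rule prob_space_distr) simp
  have N: "emeasure ?N A = emeasure M {x \<in> space M. v n x \<in> A \<and> v (Suc n) x \<in> B}"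
    if [measurable]: "A \<in> sets borel" for A
  proof -
    have "emeasure ?N A = (\<integral>\<^sup>+ x. indicator {x \<in> space M. v n x \<in> A \<and> v (Suc n) x \<in> B} x \<partial>M)"
      by (subst emeasure_distr, measurable, subst emeasure_density, measurable)
        (intro nn_integral_cong, auto simp: indicator_def)
    then show ?thesis by simp
  qed
  have "absolutely_continuous ?D ?N"
    unfolding absolutely_continuous_def
  proof
    fix A assume "A \<in> null_sets ?D"
    then have A[measurable]: "A \<in> sets borel" and "emeasure M {x \<in> space M. v n x \<in> A} = 0"
      by (auto simp: null_sets_def emeasure_distr vimage_def Int_def conj_commute)
    moreover have "emeasure M {x \<in> space M. v n x \<in> A \<and> v (Suc n) x \<in> B} \<le> emeasure M {x \<in> space M. v n x \<in> A}"
      by (rule emeasure_mono) auto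
    ultimately show "A \<in> null_sets ?N" by (intro null_setsI) (auto simp: N)
  qed
  then obtain f where f[measurable]: "f \<in> borel_measurable ?D" and df: "density ?D f = ?N"
    using D.Radon_Nikodym[of ?N] by auto
  have [measurable]: "f \<in> borel_measurable borel" using f by simp
  have int: "emeasure ?N A = (\<integral>\<^sup>+ x. indicator A (v n x) * f (v n x) \<partial>M)" if [measurable]: "A \<in> sets borel" for A
    unfolding df[symmetric]
    by (subst emeasure_density, measurable, subst nn_integral_distr, measurable) (simp add: mult.commute)
  have "(\<integral>\<^sup>+ x. f (v n x) \<partial>M) = emeasure ?N UNIV" by (subst int) auto
  also have "\<dots> \<noteq> \<infinity>" by (subst N) auto
  finally have fin: "AE x in M. f (v n x) \<noteq> \<infinity>" by (intro nn_integral_noteq_infinite) auto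
  \<comment> \<open>\<open>enn2real\<close> sends an infinite value of the density to 0, which
    affects only a null set.\<close>
  have "kernel n B (\<lambda>u. enn2real (f u))"
    unfolding kernel_def
  proof (intro conjI ballI allI)
    fix A :: "real set" assume A: "A \<in> sets borel"
    show "emeasure M {x \<in> space M. v n x \<in> A \<and> v (Suc n) x \<in> B}
        = (\<integral>\<^sup>+ x. indicator A (v n x) * ennreal (enn2real (f (v n x))) \<partial>M)"
      unfolding N[OF A, symmetric] int[OF A]
      using fin by (intro nn_integral_cong_AE) (auto elim!: eventually_mono simp: less_top)
  qed auto
  then show ?thesis by blast
qed

text \<open>h (v n) is the conditional probability given v n alone; the Markov property makes it the
  conditional probability given the whole past, so events of v n may be replaced by past
  events.\<close>

lemma kernel_past:
  assumes k: "kernel n B h" and B[measurable]: "B \<in> sets borel" and C: "C \<in> sets (past n)"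
  shows "emeasure M (C \<inter> {x \<in> space M. v (Suc n) x \<in> B}) = (\<integral>\<^sup>+ x. indicator C x * ennreal (h (v n x)) \<partial>M)"
proof -
  interpret P: sigma_finite_subalgebra M "past n" by (rule sigma_finite_subalgebra_gen_sigma)
  interpret S: sigma_finite_subalgebra M "gen_sigma M v {n}" by (rule sigma_finite_subalgebra_gen_sigma)
  have h[measurable]: "h \<in> borel_measurable borel" and h0: "\<And>u. 0 \<le> h u"
    and eq: "\<And>A. A \<in> sets borel \<Longrightarrow> emeasure M {x \<in> space M. v n x \<in> A \<and> v (Suc n) x \<in> B}
        = (\<integral>\<^sup>+ x. indicator A (v n x) * ennreal (h (v n x)) \<partial>M)"
    using k unfolding kernel_def by auto
  let ?I = "indicator {y \<in> space M. v (Suc n) y \<in> B} :: 'a \<Rightarrow> real"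
  have intI: "integrable M ?I" by (rule integrable_real_indicator) (auto simp: less_top[symmetric])
  have "(\<integral>\<^sup>+ x. ennreal (h (v n x)) \<partial>M) = emeasure M {x \<in> space M. v n x \<in> UNIV \<and> v (Suc n) x \<in> B}"
    by (subst eq) auto
  then have "(\<integral>\<^sup>+ x. ennreal (h (v n x)) \<partial>M) < \<infinity>" by (simp add: less_top[symmetric])
  then have inth: "integrable M (\<lambda>x. h (v n x))"
    by (intro integrableI_nonneg) (simp_all add: h0)
  have "AE x in M. real_cond_exp M (gen_sigma M v {n}) ?I x = h (v n x)"
  proof (rule S.real_cond_exp_charact)
    fix C assume "C \<in> sets (gen_sigma M v {n})"
    then obtain A where A[measurable]: "A \<in> sets borel" and C: "C = v n -` A \<inter> space M"
      using sets_gen_sigma_singleton by blast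
    have "ennreal (\<integral>x\<in>C. ?I x \<partial>M) = (\<integral>\<^sup>+ x. ennreal (indicator C x *\<^sub>R ?I x) \<partial>M)"
      unfolding set_lebesgue_integral_def C
      by (intro nn_integral_eq_integral[symmetric] integrable_mult_indicator intI) auto
    also have "\<dots> = (\<integral>\<^sup>+ x. indicator {x \<in> space M. v n x \<in> A \<and> v (Suc n) x \<in> B} x \<partial>M)"
      by (intro nn_integral_cong) (auto simp: C indicator_def)
    also have "\<dots> = (\<integral>\<^sup>+ x. indicator A (v n x) * ennreal (h (v n x)) \<partial>M)"
      by (subst eq[symmetric]) auto
    also have "\<dots> = (\<integral>\<^sup>+ x. ennreal (indicator C x *\<^sub>R h (v n x)) \<partial>M)"
      by (intro nn_integral_cong) (auto simp: C indicator_def)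
    also have "\<dots> = ennreal (\<integral>x\<in>C. h (v n x) \<partial>M)"
      unfolding set_lebesgue_integral_def C using h0
      by (intro nn_integral_eq_integral integrable_mult_indicator inth) (auto simp: indicator_def)
    finally show "(\<integral>x\<in>C. ?I x \<partial>M) = (\<integral>x\<in>C. h (v n x) \<partial>M)"
      unfolding set_lebesgue_integral_def using h0
      by (subst (asm) ennreal_inj) (auto intro!: integral_nonneg_AE AE_I2)
  qed (auto intro!: intI inth measurable_compose[OF measurable_gen_sigma h])
  moreover have "AE x in M. real_cond_exp M (past n) ?I x = real_cond_exp M (gen_sigma M v {n}) ?I x"
    using markov B unfolding markov_chain_def by blast
  ultimately have ce: "AE x in M. real_cond_exp M (past n) ?I x = h (v n x)"
    by eventually_elim simp
  have CM[measurable]: "C \<in> sets M" using C subalgebra_gen_sigma by (auto simp: subalgebra_def)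
  have "emeasure M (C \<inter> {x \<in> space M. v (Suc n) x \<in> B}) = (\<integral>\<^sup>+ x. ennreal (indicator C x *\<^sub>R ?I x) \<partial>M)"
  proof -
    have "(\<integral>\<^sup>+ x. ennreal (indicator C x *\<^sub>R ?I x) \<partial>M)
      = (\<integral>\<^sup>+ x. indicator (C \<inter> {x \<in> space M. v (Suc n) x \<in> B}) x \<partial>M)"
      by (intro nn_integral_cong) (auto simp: indicator_def)
    then show ?thesis by simp
  qed
  also have "\<dots> = ennreal (\<integral>x\<in>C. ?I x \<partial>M)"
    unfolding set_lebesgue_integral_def
    by (intro nn_integral_eq_integral integrable_mult_indicator intI) auto
  also have "(\<integral>x\<in>C. ?I x \<partial>M) = (\<integral>x\<in>C. real_cond_exp M (past n) ?I x \<partial>M)"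
    by (rule P.real_cond_exp_intA[OF intI C])
  also have "\<dots> = (\<integral>x\<in>C. h (v n x) \<partial>M)"
    unfolding set_lebesgue_integral_def using ce by (intro integral_cong_AE) (auto elim!: eventually_mono)
  also have "ennreal (\<integral>x\<in>C. h (v n x) \<partial>M) = (\<integral>\<^sup>+ x. ennreal (indicator C x *\<^sub>R h (v n x)) \<partial>M)"
    unfolding set_lebesgue_integral_def using h0
    by (intro nn_integral_eq_integral[symmetric] integrable_mult_indicator inth) auto
  also have "\<dots> = (\<integral>\<^sup>+ x. indicator C x * ennreal (h (v n x)) \<partial>M)"
    by (intro nn_integral_cong) (auto simp: indicator_def)
  finally show ?thesis .
qed

text \<open>The measures with densities 1_B (v (n + 1)) and h (v n) agree on the past, hence
  integrate past-measurable functions equally.\<close>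

lemma kernel_nn_integral:
  assumes k: "kernel n B h" and B[measurable]: "B \<in> sets borel" and f: "f \<in> borel_measurable (past n)"
  shows "(\<integral>\<^sup>+ x. f x * indicator B (v (Suc n) x) \<partial>M) = (\<integral>\<^sup>+ x. f x * ennreal (h (v n x)) \<partial>M)"
proof -
  have h[measurable]: "h \<in> borel_measurable borel" using k unfolding kernel_def by auto
  have sub: "sets (past n) \<subseteq> sets M" "space (past n) = space M"
    using subalgebra_gen_sigma[of "{..n}"] by (auto simp: subalgebra_def)
  have fM[measurable]: "f \<in> borel_measurable M" by (rule measurable_from_subalg[OF subalgebra_gen_sigma f])
  let ?d1 = "density M (\<lambda>x. indicator B (v (Suc n) x))" and ?d2 = "density M (\<lambda>x. ennreal (h (v n x)))"
  have s: "subalgebra ?d1 (past n)" "subalgebra ?d2 (past n)" using sub by (auto simp: subalgebra_def)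
  have "restr_to_subalg ?d1 (past n) = restr_to_subalg ?d2 (past n)"
  proof (rule measure_eqI)
    fix C assume "C \<in> sets (restr_to_subalg ?d1 (past n))"
    then have C: "C \<in> sets (past n)" by (simp add: sets_restr_to_subalg[OF s(1)])
    then have [measurable]: "C \<in> sets M" using sub by auto
    have "emeasure (restr_to_subalg ?d1 (past n)) C = (\<integral>\<^sup>+ x. indicator B (v (Suc n) x) * indicator C x \<partial>M)"
      by (simp add: emeasure_restr_to_subalg[OF s(1) C] emeasure_density)
    also have "\<dots> = (\<integral>\<^sup>+ x. indicator (C \<inter> {x \<in> space M. v (Suc n) x \<in> B}) x \<partial>M)"
      by (intro nn_integral_cong) (auto simp: indicator_def)
    also have "\<dots> = emeasure M (C \<inter> {x \<in> space M. v (Suc n) x \<in> B})"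
      by (rule nn_integral_indicator) measurable
    also have "\<dots> = (\<integral>\<^sup>+ x. ennreal (h (v n x)) * indicator C x \<partial>M)"
      unfolding kernel_past[OF k B C] by (simp add: mult.commute)
    also have "\<dots> = emeasure (restr_to_subalg ?d2 (past n)) C"
      by (simp add: emeasure_restr_to_subalg[OF s(2) C] emeasure_density)
    finally show "emeasure (restr_to_subalg ?d1 (past n)) C = emeasure (restr_to_subalg ?d2 (past n)) C" .
  qed (simp add: sets_restr_to_subalg[OF s(1)] sets_restr_to_subalg[OF s(2)])
  then have "(\<integral>\<^sup>+ x. f x \<partial>?d1) = (\<integral>\<^sup>+ x. f x \<partial>?d2)"
    using nn_integral_subalgebra2[OF s(1) f] nn_integral_subalgebra2[OF s(2) f] by simp
  then show ?thesis by (simp add: nn_integral_density mult.commute)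
qed

text \<open>The argument is the index of the last past variable: at 0 this says that v 1 is
  independent of v 0, at \<open>Suc 0\<close> that v 2 is independent of the pair (v 0, v
  1).\<close>

definition indep_past :: "nat \<Rightarrow> bool" where
  "indep_past n \<longleftrightarrow> (\<forall>B\<in>sets borel. \<forall>C\<in>sets (past n).
     prob (C \<inter> {x \<in> space M. v (Suc n) x \<in> B}) = prob C * prob {x \<in> space M. v (Suc n) x \<in> B})"

lemma indep_past_if_kernel_const:
  assumes "\<And>B. B \<in> sets borel \<Longrightarrow> \<exists>h c. kernel n B h \<and> (AE x in M. h (v n x) = c)"
  shows "indep_past n"
  unfolding indep_past_def
proof (intro ballI)
  fix B :: "real set" and C assume B: "B \<in> sets borel" and C: "C \<in> sets (past n)"
  obtain h c where k: "kernel n B h" and c: "AE x in M. h (v n x) = c" using assms[OF B] by blast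
  have eq: "emeasure M (C \<inter> {x \<in> space M. v (Suc n) x \<in> B}) = ennreal c * emeasure M C" if C: "C \<in> sets (past n)" for C
  proof -
    have [measurable]: "C \<in> sets M" using C subalgebra_gen_sigma by (auto simp: subalgebra_def)
    have "(\<integral>\<^sup>+ x. indicator C x * ennreal (h (v n x)) \<partial>M) = (\<integral>\<^sup>+ x. ennreal c * indicator C x \<partial>M)"
      using c by (intro nn_integral_cong_AE) (auto elim!: eventually_mono simp: mult.commute)
    then show ?thesis by (simp add: kernel_past[OF k B C] nn_integral_cmult_indicator)
  qed
  have h0: "h u \<ge> 0" for u using k unfolding kernel_def by auto
  have "AE x in M. c \<ge> 0" using c by eventually_elim (use h0 in metis)
  then have c0: "c \<ge> 0" by simp
  have pr: "prob (C \<inter> {x \<in> space M. v (Suc n) x \<in> B}) = c * prob C" if "C \<in> sets (past n)" for C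
    using eq[OF that] c0 by (simp add: emeasure_eq_measure ennreal_mult[symmetric])
  have "space M \<in> sets (past n)" using sets.top[of "past n"] by (simp add: space_gen_sigma)
  from pr[OF this] have "prob {x \<in> space M. v (Suc n) x \<in> B} = c"
    by (simp add: prob_space Int_absorb1 subset_eq)
  with pr[OF C] show "prob (C \<inter> {x \<in> space M. v (Suc n) x \<in> B}) = prob C * prob {x \<in> space M. v (Suc n) x \<in> B}"
    by simp
qed

section \<open>Transport of events and kernels through the exchange\<close>

lemma vswap_3:
  assumes inv: "sb_invariant M w"
    and f[measurable]: "f \<in> borel_measurable (borel :: (real \<times> real \<times> real) measure)"
  shows "(\<integral>\<^sup>+ x. ennreal (1 - v n x) * f (v n x, v (Suc n) x, v (Suc (Suc n)) x) \<partial>M)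
    = (\<integral>\<^sup>+ x. ennreal (1 - v n x) * f ((1 - v n x) * v (Suc n) x,
        v n x / (1 - (1 - v n x) * v (Suc n) x), v (Suc (Suc n)) x) \<partial>M)"
proof -
  have [measurable]: "f \<in> borel_measurable (borel \<Otimes>\<^sub>M borel \<Otimes>\<^sub>M borel)"
    using f by (simp add: borel_prod)
  have comp: "(\<lambda>y. y i) \<in> borel_measurable (listM (Suc (Suc (Suc n))))" if "i < Suc (Suc (Suc n))" for i
    using that by simp
  have [measurable]: "(\<lambda>y. y n) \<in> borel_measurable (listM (Suc (Suc (Suc n))))"
    "(\<lambda>y. y (Suc n)) \<in> borel_measurable (listM (Suc (Suc (Suc n))))"
    "(\<lambda>y. y (Suc (Suc n))) \<in> borel_measurable (listM (Suc (Suc (Suc n))))"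
    by (auto intro!: comp)
  have "(\<lambda>y. f (y n, y (Suc n), y (Suc (Suc n)))) \<in> borel_measurable (listM (Suc (Suc (Suc n))))"
    by measurable
  from sb_invariant_vswap[OF inv this, of n] show ?thesis by (simp add: vswap_def)
qed

text \<open>The weight 1 - v n is almost surely positive, so reweighting hides no event and the
  exchange preserves null events of the pair.\<close>

lemma tilt_null:
  assumes inv: "sb_invariant M w" and N: "{p. Q (fst p) (snd p)} \<in> sets (borel :: (real \<times> real) measure)"
    and ae: "AE x in M. Q (v n x) (v (Suc n) x)"
  shows "AE x in M. Q ((1 - v n x) * v (Suc n) x) (v n x / (1 - (1 - v n x) * v (Suc n) x))"
proof -
  let ?f = "indicator {p. \<not> Q (fst p) (fst (snd p))} :: real \<times> real \<times> real \<Rightarrow> ennreal"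
  have "{p. Q (fst p) (snd p)} \<in> sets (borel \<Otimes>\<^sub>M borel)" unfolding borel_prod by (rule N)
  then have [measurable]: "Measurable.pred (borel \<Otimes>\<^sub>M borel) (\<lambda>p. Q (fst p) (snd p))"
    by (simp add: pred_def space_pair_measure)
  have "(\<lambda>(p :: real \<times> real \<times> real). (fst p, fst (snd p))) \<in> borel \<Otimes>\<^sub>M borel \<Otimes>\<^sub>M borel \<rightarrow>\<^sub>M borel \<Otimes>\<^sub>M borel"
    by measurable
  from measurable_compose[OF this, of "\<lambda>p. Q (fst p) (snd p)" "count_space UNIV"]
  have [measurable]: "Measurable.pred (borel \<Otimes>\<^sub>M borel \<Otimes>\<^sub>M borel) (\<lambda>(p :: real \<times> real \<times> real). Q (fst p) (fst (snd p)))"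
    by simp
  have m[measurable]: "?f \<in> borel_measurable (borel \<Otimes>\<^sub>M borel \<Otimes>\<^sub>M borel)" by measurable
  then have "?f \<in> borel_measurable borel" by (simp add: borel_prod)
  note eq = vswap_3[OF inv this, of n]
  have "(\<integral>\<^sup>+ x. ennreal (1 - v n x) * ?f (v n x, v (Suc n) x, v (Suc (Suc n)) x) \<partial>M) = (\<integral>\<^sup>+ x. 0 \<partial>M)"
    using ae by (intro nn_integral_cong_AE) (auto elim!: eventually_mono)
  with eq have "(\<integral>\<^sup>+ x. ennreal (1 - v n x) * ?f ((1 - v n x) * v (Suc n) x,
        v n x / (1 - (1 - v n x) * v (Suc n) x), v (Suc (Suc n)) x) \<partial>M) = 0" by simp
  moreover have "(\<lambda>x. ennreal (1 - v n x) * ?f ((1 - v n x) * v (Suc n) x,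
        v n x / (1 - (1 - v n x) * v (Suc n) x), v (Suc (Suc n)) x)) \<in> borel_measurable M"
    by measurable
  ultimately have "AE x in M. ennreal (1 - v n x) * ?f ((1 - v n x) * v (Suc n) x,
        v n x / (1 - (1 - v n x) * v (Suc n) x), v (Suc (Suc n)) x) = 0"
    by (simp only: nn_integral_0_iff_AE)
  then show ?thesis
    using v_AE
  proof eventually_elim
    case (elim x)
    then have "ennreal (1 - v n x) \<noteq> 0" by (auto simp: ennreal_eq_0_iff not_le)
    with elim(1) show ?case by (auto simp: indicator_def split: if_splits)
  qed
qed

text \<open>The exchange fixes v (n + 2) and is an involution, so integrating against the indicator of
  the set where the two values of h are ordered one way isolates the positive part of their
  difference.\<close>

lemma kernel_swap:
  assumes inv: "sb_invariant M w" and k: "kernel (Suc n) B h" and B[measurable]: "B \<in> sets borel"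
  defines "b' \<equiv> \<lambda>x. v n x / (1 - (1 - v n x) * v (Suc n) x)"
  shows "AE x in M. h (v (Suc n) x) = h (b' x)"
proof -
  have h[measurable]: "h \<in> borel_measurable borel" and h0: "\<And>u. 0 \<le> h u"
    using k unfolding kernel_def by auto
  let ?a = "v n" and ?b = "v (Suc n)" and ?c = "v (Suc (Suc n))"
  let ?a' = "\<lambda>x. (1 - ?a x) * ?b x"
  have [measurable]: "b' \<in> borel_measurable M" unfolding b'_def by measurable
  have key: "(\<integral>\<^sup>+ x. ennreal (1 - ?a x) * f (?a' x, b' x) * ennreal (h (?b x)) \<partial>M)
    = (\<integral>\<^sup>+ x. ennreal (1 - ?a x) * f (?a' x, b' x) * ennreal (h (b' x)) \<partial>M)"
    if [measurable]: "f \<in> borel_measurable (borel \<Otimes>\<^sub>M borel)" for f :: "real \<times> real \<Rightarrow> ennreal"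
  proof -
    have mp[measurable]: "?a \<in> borel_measurable (past (Suc n))" "?b \<in> borel_measurable (past (Suc n))"
      by (auto intro!: measurable_gen_sigma)
    have "(\<lambda>(p::real\<times>real\<times>real). f (fst p, fst (snd p)) * indicator B (snd (snd p)))
        \<in> borel_measurable (borel \<Otimes>\<^sub>M borel \<Otimes>\<^sub>M borel)" by measurable
    then have m1: "(\<lambda>(p::real\<times>real\<times>real). f (fst p, fst (snd p)) * indicator B (snd (snd p)))
        \<in> borel_measurable borel" by (simp add: borel_prod)
    have "(\<lambda>(p::real\<times>real\<times>real). f (fst p, fst (snd p)) * ennreal (h (fst (snd p))))
        \<in> borel_measurable (borel \<Otimes>\<^sub>M borel \<Otimes>\<^sub>M borel)" by measurable
    then have m2: "(\<lambda>(p::real\<times>real\<times>real). f (fst p, fst (snd p)) * ennreal (h (fst (snd p))))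
        \<in> borel_measurable borel" by (simp add: borel_prod)
    \<comment> \<open>The kernel replaces h (v (n + 1)) by the indicator of B at v (n + 2), which
      the exchange does not move. Exchanging, returning to h, and exchanging again restores the
      arguments of f, while h is now evaluated at \<open>b'\<close>.\<close>
    have "(\<integral>\<^sup>+ x. ennreal (1 - ?a x) * f (?a' x, b' x) * ennreal (h (?b x)) \<partial>M)
      = (\<integral>\<^sup>+ x. ennreal (1 - ?a x) * f (?a' x, b' x) * indicator B (?c x) \<partial>M)"
      unfolding b'_def by (rule kernel_nn_integral[OF k B, symmetric]) measurable
    also have "\<dots> = (\<integral>\<^sup>+ x. ennreal (1 - ?a x) * f (?a x, ?b x) * indicator B (?c x) \<partial>M)"
      using vswap_3[OF inv m1, of n] by (simp add: b'_def mult.assoc)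
    also have "\<dots> = (\<integral>\<^sup>+ x. ennreal (1 - ?a x) * f (?a x, ?b x) * ennreal (h (?b x)) \<partial>M)"
      by (rule kernel_nn_integral[OF k B]) measurable
    also have "\<dots> = (\<integral>\<^sup>+ x. ennreal (1 - ?a x) * f (?a' x, b' x) * ennreal (h (b' x)) \<partial>M)"
      using vswap_3[OF inv m2, of n] by (simp add: b'_def mult.assoc)
    finally show ?thesis .
  qed
  \<comment> \<open>The exchange undoes itself, so v (n + 1) is a function of the exchanged pair.
    The set where one value of h exceeds the other is therefore a set of values of that pair, as the
    test function requires.\<close>
  have invol: "AE x in M. ?a' x / (1 - (1 - ?a' x) * b' x) = ?b x"
    using v_AE
  proof eventually_elim
    case (elim x)
    have "0 < ?a x" "?a x < 1" "0 < ?b x" "?b x < 1" using elim by auto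
    then have "?a' x < 1 * 1" by (intro mult_strict_mono) auto
    then have "(1 - ?a' x) * b' x = ?a x" by (simp add: b'_def)
    moreover have "1 - ?a x \<noteq> 0" using elim by (metis less_irrefl diff_eq_eq add_0)
    ultimately show ?case by simp
  qed
  have "(\<integral>\<^sup>+ x. ennreal (h (?b x)) \<partial>M) = emeasure M {x \<in> space M. ?b x \<in> UNIV \<and> ?c x \<in> B}"
    using k unfolding kernel_def by (auto dest!: bspec[of _ _ UNIV])
  then have fin: "(\<integral>\<^sup>+ x. ennreal (h (?b x)) \<partial>M) < \<infinity>" by (simp add: less_top[symmetric])
  \<comment> \<open>Finiteness allows the two equal integrals to be subtracted.\<close>
  have bound: "(\<integral>\<^sup>+ x. ennreal (1 - ?a x) * indicator E (?a' x, b' x) * ennreal (h (?b x)) \<partial>M) < \<infinity>" for E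
  proof -
    have "(\<integral>\<^sup>+ x. ennreal (1 - ?a x) * indicator E (?a' x, b' x) * ennreal (h (?b x)) \<partial>M)
      \<le> (\<integral>\<^sup>+ x. ennreal (h (?b x)) \<partial>M)"
    proof (intro nn_integral_mono_AE, use v_AE in eventually_elim)
      case (elim x)
      have "ennreal (1 - ?a x) * indicator E (?a' x, b' x) \<le> 1 * 1"
        using elim by (intro mult_mono) (auto simp: indicator_def ennreal_le_1 less_imp_le)
      then have "ennreal (1 - ?a x) * indicator E (?a' x, b' x) * ennreal (h (?b x)) \<le> 1 * ennreal (h (?b x))"
        by (intro mult_right_mono) auto
      then show ?case by simp
    qed
    with fin show ?thesis by (rule le_less_trans[rotated])
  qed
  have le: "AE x in M. H x \<le> H' x"
    if [measurable]: "H \<in> borel_measurable M" "H' \<in> borel_measurable M" "E \<in> sets (borel \<Otimes>\<^sub>M borel)"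
      and nn: "\<And>x. 0 \<le> H x" "\<And>x. 0 \<le> H' x" and E: "AE x in M. (?a' x, b' x) \<in> E \<longleftrightarrow> H' x < H x"
      and eq: "(\<integral>\<^sup>+ x. ennreal (1 - ?a x) * indicator E (?a' x, b' x) * ennreal (H x) \<partial>M)
        = (\<integral>\<^sup>+ x. ennreal (1 - ?a x) * indicator E (?a' x, b' x) * ennreal (H' x) \<partial>M)"
      and fin: "(\<integral>\<^sup>+ x. ennreal (1 - ?a x) * indicator E (?a' x, b' x) * ennreal (H x) \<partial>M) < \<infinity>"
    for H H' E
  proof -
    let ?X = "\<lambda>H x. ennreal (1 - ?a x) * indicator E (?a' x, b' x) * ennreal (H x)"
    have "AE x in M. ?X H' x \<le> ?X H x"
      using E by eventually_elim (auto simp: indicator_def intro!: mult_left_mono ennreal_leI)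
    then have "(\<integral>\<^sup>+ x. ?X H x - ?X H' x \<partial>M) = integral\<^sup>N M (?X H) - integral\<^sup>N M (?X H')"
      using fin eq by (intro nn_integral_diff) auto
    also have "\<dots> = 0" using eq fin by (simp add: ennreal_minus_eq_0)
    finally have "AE x in M. ?X H x - ?X H' x = 0" by (simp add: nn_integral_0_iff_AE)
    then show ?thesis using E v_AE
    proof eventually_elim
      case (elim x)
      show ?case
      proof (rule ccontr)
        assume "\<not> ?thesis"
        then have lt: "H' x < H x" by simp
        have "?X H x \<le> ?X H' x" using elim(1) by (simp only: ennreal_minus_eq_0)
        then have "ennreal ((1 - ?a x) * H x) \<le> ennreal ((1 - ?a x) * H' x)"
          using elim(2,3) nn lt by (simp add: ennreal_mult less_imp_le)
        then have "(1 - ?a x) * H x \<le> (1 - ?a x) * H' x"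
          using elim(3) nn by (subst (asm) ennreal_le_iff) (auto intro!: mult_nonneg_nonneg simp: less_imp_le)
        with lt elim(3) show False by (auto dest!: mult_left_le_imp_le)
      qed
    qed
  qed
  let ?m = "\<lambda>p::real\<times>real. fst p / (1 - (1 - fst p) * snd p)"
  have pred: "{p. R (h (?m p)) (h (snd p))} \<in> sets (borel \<Otimes>\<^sub>M borel)"
    if "R = (<) \<or> R = (>)" for R :: "real \<Rightarrow> real \<Rightarrow> bool"
  proof -
    have "{p \<in> space (borel \<Otimes>\<^sub>M borel). R (h (?m p)) (h (snd p))} \<in> sets (borel \<Otimes>\<^sub>M borel)"
      using that by (elim disjE) (simp only:, measurable)+
    then show ?thesis by (simp add: space_pair_measure)
  qed
  have 1: "AE x in M. h (?b x) \<le> h (b' x)"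
  proof (rule le[OF _ _ pred h0 h0])
    let ?E = "{p. h (?m p) > h (snd p)}"
    show "AE x in M. (?a' x, b' x) \<in> ?E \<longleftrightarrow> h (b' x) < h (?b x)"
      using invol by eventually_elim simp
    show "(\<integral>\<^sup>+ x. ennreal (1 - ?a x) * indicator ?E (?a' x, b' x) * ennreal (h (?b x)) \<partial>M)
        = (\<integral>\<^sup>+ x. ennreal (1 - ?a x) * indicator ?E (?a' x, b' x) * ennreal (h (b' x)) \<partial>M)"
      by (intro key borel_measurable_indicator pred) simp
    show "(\<integral>\<^sup>+ x. ennreal (1 - ?a x) * indicator ?E (?a' x, b' x) * ennreal (h (?b x)) \<partial>M) < \<infinity>"
      by (rule bound)
  qed auto
  have 2: "AE x in M. h (b' x) \<le> h (?b x)"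
  proof (rule le[OF _ _ pred h0 h0])
    let ?E = "{p. h (?m p) < h (snd p)}"
    show "AE x in M. (?a' x, b' x) \<in> ?E \<longleftrightarrow> h (?b x) < h (b' x)"
      using invol by eventually_elim simp
    have eq: "(\<integral>\<^sup>+ x. ennreal (1 - ?a x) * indicator ?E (?a' x, b' x) * ennreal (h (?b x)) \<partial>M)
        = (\<integral>\<^sup>+ x. ennreal (1 - ?a x) * indicator ?E (?a' x, b' x) * ennreal (h (b' x)) \<partial>M)"
      by (intro key borel_measurable_indicator pred) simp
    show "(\<integral>\<^sup>+ x. ennreal (1 - ?a x) * indicator ?E (?a' x, b' x) * ennreal (h (b' x)) \<partial>M)
        = (\<integral>\<^sup>+ x. ennreal (1 - ?a x) * indicator ?E (?a' x, b' x) * ennreal (h (?b x)) \<partial>M)"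
      by (rule eq[symmetric])
    show "(\<integral>\<^sup>+ x. ennreal (1 - ?a x) * indicator ?E (?a' x, b' x) * ennreal (h (b' x)) \<partial>M) < \<infinity>"
      unfolding eq[symmetric] by (rule bound)
  qed auto
  from 1 2 show ?thesis by eventually_elim simp
qed

text \<open>Only null sets matter here, so the assumptions are two transfers between the laws of the
  length variables and Lebesgue measure. They are met by the assumed mutual absolute continuity at n
  = 0 and by independent pairs of beta laws at any n.\<close>

lemma indep_past_if_ac_square:
  assumes inv: "sb_invariant M w"
    and ac1: "\<And>Q. {p. Q (fst p) (snd p)} \<in> sets (borel :: (real \<times> real) measure) \<Longrightarrow>
      AE x in M. Q (v n x) (v (Suc n) x) \<Longrightarrow>
      AE a in lborel. AE b in lborel. 0 < a \<and> a < 1 \<and> 0 < b \<and> b < 1 \<longrightarrow> Q a b"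
    and ac2: "\<And>Q. {b. Q b} \<in> sets borel \<Longrightarrow> AE b in lborel. 0 < b \<and> b < 1 \<longrightarrow> Q b \<Longrightarrow> AE x in M. Q (v (Suc n) x)"
  shows "indep_past (Suc n)"
proof (rule indep_past_if_kernel_const)
  fix B :: "real set" assume B: "B \<in> sets borel"
  obtain h where k: "kernel (Suc n) B h" using kernel_exists[OF B] by blast
  have h[measurable]: "h \<in> borel_measurable borel" using k unfolding kernel_def by auto
  have "{p \<in> space (borel \<Otimes>\<^sub>M borel). h (snd p) = h (fst p / (1 - (1 - fst p) * snd p))}
      \<in> sets (borel \<Otimes>\<^sub>M borel)" by measurable
  then have m: "{p. h (snd p) = h (fst p / (1 - (1 - fst p) * snd p))} \<in> sets borel"
    by (simp add: space_pair_measure) (simp only: borel_prod)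
  have "AE a in lborel. AE b in lborel. 0 < a \<and> a < 1 \<and> 0 < b \<and> b < 1 \<longrightarrow> h b = h (a / (1 - (1 - a) * b))"
    by (rule ac1[OF m kernel_swap[OF inv k B]])
  then obtain c where c: "AE b in lborel. 0 < b \<and> b < 1 \<longrightarrow> h b = c"
    using moebius_invariant_AE_const[OF h] by blast
  have "{b. h b = c} \<in> sets borel" by measurable
  from ac2[OF this c] k show "\<exists>h c. kernel (Suc n) B h \<and> (AE x in M. h (v (Suc n) x) = c)" by blast
qed

end

section \<open>The convexity and continuity hypotheses\<close>

lemma closed_support: "closed (support N)"
proof -
  have "- support N = \<Union>{U. open U \<and> \<not> emeasure N U > 0}" by (auto simp: support_def)
  then show ?thesis by (auto simp: closed_def)
qed

text \<open>The complement of the support is covered by the null members of a countable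
  basis.\<close>

lemma AE_support:
  fixes N :: "'b::second_countable_topology measure"
  assumes sets: "sets N = sets borel"
  shows "AE x in N. x \<in> support N"
proof -
  obtain \<B> :: "'b set set" where \<B>: "countable \<B>" "topological_basis \<B>" using ex_countable_basis by blast
  define \<N> where "\<N> = {U \<in> \<B>. emeasure N U = 0}"
  have "\<Union>\<N> \<in> null_sets N"
  proof (rule null_sets_UN'[where N = "\<lambda>U. U" and I = \<N>, simplified])
    show "countable \<N>" unfolding \<N>_def using \<B>(1) by simp
    show "U \<in> null_sets N" if "U \<in> \<N>" for U
      using that \<B>(2) by (intro null_setsI) (auto simp: \<N>_def sets topological_basis_open)
  qed
  then have "AE x in N. x \<notin> \<Union>\<N>" by (rule AE_not_in)
  then show ?thesis
  proof eventually_elim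
    case (elim x)
    show ?case
      unfolding support_def
    proof (safe)
      fix U assume U: "open U" "x \<in> U"
      then obtain B where B: "B \<in> \<B>" "x \<in> B" "B \<subseteq> U" using topological_basisE[OF \<B>(2) U] by metis
      with elim have "emeasure N B \<noteq> 0" by (auto simp: \<N>_def)
      moreover have "emeasure N B \<le> emeasure N U"
        using B U by (intro emeasure_mono) (auto simp: sets)
      ultimately show "0 < emeasure N U" by (metis not_gr_zero le_zero_eq)
    qed
  qed
qed

text \<open>Every neighbourhood of a support point has positive probability and so meets each almost
  sure event. This is how almost sure identities are moved to prescribed points.\<close>

lemma support_distr_ex:
  assumes p: "p \<in> support (distr M borel X)" and [measurable]: "X \<in> borel_measurable M"
    and ae: "AE x in M. P x" and U: "open U" "p \<in> U"
  shows "\<exists>x\<in>space M. X x \<in> U \<and> P x"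
proof (rule ccontr)
  assume no: "\<not> ?thesis"
  have [measurable]: "U \<in> sets borel" using U by simp
  have "AE x in M. X x \<notin> U" using ae AE_space by eventually_elim (use no in auto)
  then have "emeasure M {x \<in> space M. X x \<in> U} = 0"
    by (subst (asm) AE_iff_measurable[OF _ refl]) auto
  moreover have "0 < emeasure (distr M borel X) U" using p U by (auto simp: support_def)
  ultimately show False by (simp add: emeasure_distr vimage_def Int_def conj_commute)
qed

lemma support_distr_sequence:
  fixes X :: "'a \<Rightarrow> 'b::metric_space"
  assumes p: "p \<in> support (distr M borel X)" and X: "X \<in> borel_measurable M" and ae: "AE x in M. P x"
  shows "\<exists>\<omega>. (\<forall>n::nat. \<omega> n \<in> space M \<and> P (\<omega> n)) \<and> (\<lambda>n. X (\<omega> n)) \<longlonglongrightarrow> p"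
proof -
  have "\<exists>x\<in>space M. X x \<in> ball p (inverse (real (Suc n))) \<and> P x" for n
    by (rule support_distr_ex[OF p X ae]) auto
  then obtain \<omega> where \<omega>: "\<And>n. \<omega> n \<in> space M" "\<And>n. P (\<omega> n)"
      "\<And>n. X (\<omega> n) \<in> ball p (inverse (real (Suc n)))" by metis
  have "(\<lambda>n. X (\<omega> n)) \<longlonglongrightarrow> p"
  proof (rule metric_tendsto_imp_tendsto[OF LIMSEQ_inverse_real_of_nat])
    show "\<forall>\<^sub>F n in sequentially. dist (X (\<omega> n)) p \<le> dist (inverse (real (Suc n))) 0"
      using \<omega>(3) by (intro always_eventually allI) (simp add: dist_commute less_imp_le)
  qed
  with \<omega> show ?thesis by blast
qed

lemma AE_distr_support:
  fixes X :: "'a \<Rightarrow> 'b::second_countable_topology"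
  assumes [measurable]: "X \<in> borel_measurable M"
  shows "AE x in M. X x \<in> support (distr M borel X)"
proof -
  have "support (distr M borel X) \<in> sets borel" by (rule borel_closed[OF closed_support])
  then have "{x \<in> space borel. x \<in> support (distr M borel X)} \<in> sets borel" by simp
  from AE_distr_iff[OF assms this] AE_support[of "distr M borel X"] show ?thesis by simp
qed

lemma weak_conv_m_unique:
  assumes "\<And>n. real_distribution (\<mu> n)" "real_distribution N" "real_distribution N'"
    and "weak_conv_m \<mu> N" "weak_conv_m \<mu> N'"
  shows "N = N'"
proof (rule Levy_uniqueness[OF assms(2,3)])
  show "char N = char N'"
    using levy_continuity1[OF assms(1,2,4)] levy_continuity1[OF assms(1,3,5)] LIMSEQ_unique by blast
qed

text \<open>Rational half-lines suffice by right continuity of the distribution function.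
  Countability matters because the kernel identity holds almost surely for one set at a
  time.\<close>

lemma real_distribution_eqI_rat:
  assumes N: "real_distribution N" "real_distribution N'"
    and eq: "\<And>q. q \<in> \<rat> \<Longrightarrow> measure N {..q} = measure N' {..q}"
  shows "N = N'"
proof (rule cdf_unique[OF N])
  show "cdf N = cdf N'"
  proof
    fix x
    have "\<exists>q\<in>\<rat>. x < q \<and> q < x + inverse (real (Suc n))" for n by (rule Rats_dense_in_real) simp
    then obtain q where q: "\<And>n. q n \<in> \<rat>" "\<And>n. x < q n" "\<And>n. q n < x + inverse (real (Suc n))" by metis
    have "q \<longlonglongrightarrow> x"
    proof (rule real_tendsto_sandwich[OF _ _ tendsto_const LIMSEQ_inverse_real_of_nat_add])
      show "\<forall>\<^sub>F n in sequentially. x \<le> q n" "\<forall>\<^sub>F n in sequentially. q n \<le> x + inverse (real (Suc n))"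
        using q(2,3) by (auto intro!: always_eventually simp: less_imp_le simp del: of_nat_Suc One_nat_def)
    qed
    then have fl: "filterlim q (at_right x) sequentially"
      using q(2) by (auto simp: filterlim_at intro!: always_eventually)
    have lim: "(\<lambda>n. cdf N (q n)) \<longlonglongrightarrow> cdf N x" if "real_distribution N" for N
    proof -
      interpret real_distribution N by fact
      have "(cdf N \<longlongrightarrow> cdf N x) (at_right x)"
        using cdf_is_right_cont[of x] by (simp add: continuous_within)
      from filterlim_compose[OF this fl] show ?thesis .
    qed
    have "cdf N (q n) = cdf N' (q n)" for n using eq[OF q(1)[of n]] by (simp add: cdf_def)
    with lim[OF N(1)] lim[OF N(2)] show "cdf N x = cdf N' x" using LIMSEQ_unique by auto
  qed
qed

section \<open>Constancy from the ratio identity on a convex set\<close>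

lemma convex_triangle_mem:
  fixes S :: "(real \<times> real) set"
  assumes "convex S" "(0, 0) \<in> S" "(s, 0) \<in> S" "(0, s) \<in> S" "s > 0" "x \<ge> 0" "y \<ge> 0" "x + y \<le> s"
  shows "(x, y) \<in> S"
proof (cases "x + y = 0")
  case True
  then have "x = 0" "y = 0" using assms by auto
  with assms show ?thesis by simp
next
  case False
  define r where "r = x + y"
  have r: "r > 0" "r \<le> s" using False assms by (auto simp: r_def)
  have "(x / r) *\<^sub>R (s, 0) + (y / r) *\<^sub>R (0, s) \<in> S"
    using assms r by (intro convexD) (auto simp: r_def add_divide_distrib[symmetric])
  then have "(x * s / r, y * s / r) \<in> S" by simp
  then have "(r / s) *\<^sub>R (x * s / r, y * s / r) + (1 - r / s) *\<^sub>R (0, 0) \<in> S"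
    using assms r by (intro convexD) auto
  then show ?thesis using assms r by simp
qed

text \<open>Along the ray through a point of S above the diagonal, the identity expresses the value of
  f at the larger ratio by its value at a strictly smaller one, so constancy near 0 propagates.\<close>

lemma ratio_identity_const:
  fixes S :: "(real \<times> real) set" and f :: "real \<Rightarrow> 'b"
  assumes conv: "convex S" and S0: "(0, 0) \<in> S" and S1: "(s, 0) \<in> S" and S2: "(0, s) \<in> S" and s: "s > 0"
    and sym: "\<And>x y. (x, y) \<in> S \<Longrightarrow> (y, x) \<in> S"
    and le1: "\<And>x y. (x, y) \<in> S \<Longrightarrow> x + y \<le> 1"
    and id: "\<And>x y. (x, y) \<in> S \<Longrightarrow> x > 0 \<Longrightarrow> y > 0 \<Longrightarrow> f (y / (1 - x)) = f (x / (1 - y))"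
    and xy: "(x, y) \<in> S" "x > 0" "y > 0" and u: "0 < u" "u < y / (1 - x)"
  shows "f u = f (s / 4)"
proof -
  \<comment> \<open>Any fixed ratio strictly between 0 and s / 2 could serve as the reference; s / 4
    is one.\<close>
  define P where "P c \<longleftrightarrow> (\<forall>u. 0 < u \<and> u < c \<longrightarrow> f u = f (s / 4))" for c
  have s1: "s \<le> 1" using le1[OF S1] by simp
  have near0: "f u1 = f u0" if u: "0 < u0" "u0 < s / 2" "0 < u1" "u1 < s / 2" for u0 u1
  proof -
    \<comment> \<open>(x, y) is the point with the prescribed ratios y / (1 - x) = u1 and x / (1 -
      y) = u0. Ratios below s / 2 keep x + y \<le> s, inside the triangle contained in S.\<close>
    define x where "x = u0 * (1 - u1) / (1 - u0 * u1)"
    define y where "y = u1 * (1 - u0) / (1 - u0 * u1)"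
    have lt: "u0 < 1" "u1 < 1" using u s1 by auto
    have "u0 * u1 < 1 * 1" using u lt by (intro mult_strict_mono) auto
    then have D: "1 - u0 * u1 > 0" by simp
    have pos: "x > 0" "y > 0" unfolding x_def y_def using u lt D by (intro divide_pos_pos mult_pos_pos; simp)+
    have pr: "u0 * u1 > 0" using u by simp
    have "s * (u0 * u1) \<le> 1 * (u0 * u1)" using s1 u by (intro mult_right_mono) auto
    then have "u0 + u1 - 2 * (u0 * u1) \<le> s * (1 - u0 * u1)"
      unfolding right_diff_distrib using u pr by linarith
    moreover have "x + y = (u0 + u1 - 2 * (u0 * u1)) / (1 - u0 * u1)"
      by (simp add: x_def y_def add_divide_distrib[symmetric] algebra_simps)
    ultimately have "x + y \<le> s" using D by (simp add: pos_divide_le_eq)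
    then have mem: "(x, y) \<in> S" using convex_triangle_mem[OF conv S0 S1 S2 s] pos by simp
    have "1 - x = (1 - u0) / (1 - u0 * u1)" "1 - y = (1 - u1) / (1 - u0 * u1)"
      using D by (simp_all add: x_def y_def field_simps)
    then have "y / (1 - x) = u1" "x / (1 - y) = u0"
      using D lt by (simp_all add: x_def y_def)
    with id[OF mem pos] show ?thesis by simp
  qed
  have ray: "P (y / (1 - x))" if xy: "(x, y) \<in> S" "0 < x" "x < y" for x y
  proof -
    define U where "U = y / (1 - x)"
    define C where "C = {c. 0 < c \<and> c \<le> U \<and> P c}"
    have x1: "x < 1" "y < 1" using le1[OF xy(1)] xy by auto
    have U0: "U > 0" using xy x1 by (simp add: U_def)
    have "P (min (s / 2) U)"
      unfolding P_def using s by (intro allI impI near0) auto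
    then have "min (s / 2) U \<in> C" unfolding C_def using s U0 by (intro CollectI conjI; simp)
    then have C: "C \<noteq> {}" by blast
    have bdd: "bdd_above C" by (auto simp: C_def bdd_above_def)
    \<comment> \<open>\<open>c\<close> is the largest level up to which constancy is known; the
      claim is that it reaches the ratio \<open>U\<close> at the end of the ray.\<close>
    define c where "c = Sup C"
    have cU: "c \<le> U" unfolding c_def by (rule cSup_least[OF C]) (auto simp: C_def)
    have c0: "c > 0" using cSup_upper[OF \<open>min (s / 2) U \<in> C\<close> bdd] s U0 unfolding c_def by auto
    have Pc: "P c"
      unfolding P_def
    proof safe
      fix u assume "0 < u" "u < c"
      then obtain c' where "c' \<in> C" "u < c'" unfolding c_def using less_cSupE[OF _ C] by metis
      then show "f u = f (s / 4)" using \<open>0 < u\<close> by (auto simp: C_def P_def)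
    qed
    have "c = U"
    proof (rule ccontr)
      assume "c \<noteq> U"
      with cU have cltU: "c < U" by simp
      \<comment> \<open>At parameter \<open>t\<close> the larger ratio t y / (1 - t x) along the ray
        equals \<open>c\<close>.\<close>
      define t where "t = c / (y + c * x)"
      have den: "y + c * x > 0" "x + c * y > 0" using xy c0 by (auto intro!: add_pos_pos mult_pos_pos)
      have t0: "t > 0" using den c0 by (simp add: t_def)
      have t1: "t < 1" using cltU x1 den by (simp add: t_def U_def field_simps)
      have ct: "c * (1 - t * x) = t * y" using den by (simp add: t_def field_simps)
      \<comment> \<open>Because x < y and t (x + y) < 1, the smaller ratio t x / (1 - t y) is
        strictly below \<open>c\<close> at this parameter, so there is room to move past
        \<open>t\<close>.\<close>
      have "t < c / (x + c * y)"
      proof -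
        have "t * (x + y) < 1 * 1" using t0 t1 le1[OF xy(1)] xy by (intro mult_less_le_imp_less) auto
        then have "0 < (y - x) * (1 - t * (x + y))" using xy by simp
        then have "x * (1 - t * x) < y * (1 - t * y)" by (simp add: algebra_simps)
        then have "t * (x * (1 - t * x)) < t * (y * (1 - t * y))" using t0 by simp
        also have "\<dots> = c * (1 - t * y) * (1 - t * x)" using ct by (metis mult.assoc mult.commute)
        finally have "t * x * (1 - t * x) < c * (1 - t * y) * (1 - t * x)" by (simp add: mult.assoc)
        moreover have "1 - t * x > 0"
        proof -
          have "t * x < 1 * 1" using t0 t1 x1 xy by (intro mult_strict_mono) auto
          then show ?thesis by simp
        qed
        ultimately have "t * x < c * (1 - t * y)" by (simp add: mult_less_cancel_right)
        then show ?thesis using den by (simp add: field_simps)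
      qed
      with t1 obtain t2 where t2: "t < t2" "t2 < 1" "t2 < c / (x + c * y)"
        using dense[of t "min 1 (c / (x + c * y))"] by auto
      have lt1: "1 - \<tau> * z > 0" if "0 < \<tau>" "\<tau> < 1" "0 < z" "z < 1" for \<tau> z :: real
      proof -
        have "\<tau> * z < 1 * 1" using that by (intro mult_strict_mono) auto
        then show ?thesis by simp
      qed
      define u2 where "u2 = t2 * y / (1 - t2 * x)"
      have d2: "1 - t2 * x > 0" using lt1 t0 t2 xy x1 by auto
      have "P u2"
        unfolding P_def
      proof safe
        fix u assume u: "0 < u" "u < u2"
        \<comment> \<open>At this parameter the larger ratio equals u. It stays below
          \<open>t2\<close>, so the smaller ratio there is below \<open>c\<close>, where constancy
          is known.\<close>
        define \<tau> where "\<tau> = u / (y + u * x)"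
        have den: "y + u * x > 0" using xy u by (auto intro!: add_pos_pos)
        have \<tau>0: "\<tau> > 0" using u den by (simp add: \<tau>_def)
        have "u * (1 - t2 * x) < t2 * y" using u d2 by (simp add: u2_def pos_less_divide_eq)
        then have \<tau>2: "\<tau> < t2" using den by (simp add: \<tau>_def field_simps)
        have \<tau>1: "\<tau> < 1" using \<tau>2 t2 by simp
        have "\<tau> *\<^sub>R (x, y) + (1 - \<tau>) *\<^sub>R (0, 0) \<in> S"
          using \<tau>0 \<tau>1 by (intro convexD[OF conv xy(1) S0]) auto
        then have "(\<tau> * x, \<tau> * y) \<in> S" by simp
        then have "f (\<tau> * y / (1 - \<tau> * x)) = f (\<tau> * x / (1 - \<tau> * y))"
          using xy \<tau>0 by (intro id) auto
        moreover have "\<tau> * y / (1 - \<tau> * x) = u"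
        proof -
          have "1 - \<tau> * x = y / (y + u * x)" using den by (simp add: \<tau>_def field_simps)
          then show ?thesis using den xy by (simp add: \<tau>_def)
        qed
        moreover have "f (\<tau> * x / (1 - \<tau> * y)) = f (s / 4)"
        proof -
          have d: "1 - \<tau> * y > 0" using lt1 \<tau>0 \<tau>1 xy x1 by auto
          have "\<tau> < c / (x + c * y)" using \<tau>2 t2 by simp
          then have "\<tau> * x < c * (1 - \<tau> * y)" using \<open>x + c * y > 0\<close> by (simp add: field_simps)
          then have "\<tau> * x / (1 - \<tau> * y) < c" using d by (simp add: pos_divide_less_eq)
          moreover have "\<tau> * x / (1 - \<tau> * y) > 0" using d \<tau>0 xy by simp
          ultimately show ?thesis using Pc by (simp add: P_def)
        qed
        ultimately show "f u = f (s / 4)" by simp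
      qed
      moreover have "u2 \<le> U"
      proof -
        have "t2 * y / (1 - t2 * x) \<le> y / (1 - x)"
        proof (rule frac_le)
          show "t2 * y \<le> y" using t2 xy by (simp add: mult_left_le_one_le t0 less_imp_le[OF less_trans[OF t0 t2(1)]])
          have "t2 * x \<le> x" using t2 xy by (simp add: mult_left_le_one_le less_imp_le[OF less_trans[OF t0 t2(1)]])
          then show "1 - x \<le> 1 - t2 * x" by simp
        qed (use xy x1 in auto)
        then show ?thesis by (simp add: u2_def U_def)
      qed
      moreover have "u2 > c"
      proof -
        have "c < t2 * (y + c * x)" using t2(1) den by (simp add: t_def pos_divide_less_eq)
        then have "c * (1 - t2 * x) < t2 * y" by (simp add: algebra_simps)
        then show ?thesis using d2 by (simp add: u2_def pos_less_divide_eq)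
      qed
      ultimately have "u2 \<in> C" using c0 by (simp add: C_def)
      from cSup_upper[OF this bdd] \<open>u2 > c\<close> show False by (simp add: c_def)
    qed
    with Pc show ?thesis by (simp add: U_def)
  qed
  have x1: "x < 1" "y < 1" using le1[OF xy(1)] xy by auto
  consider "x < y" | "x = y" | "y < x" by linarith
  then show ?thesis
  proof cases
    case 1
    from ray[OF xy(1,2) this] u show ?thesis by (simp add: P_def)
  next
    case 2
    \<comment> \<open>On the diagonal both ratios coincide and the ray argument says nothing, so the
      point is moved slightly towards (0, s). The slack in u < x / (1 - x) bounds, through
      \<open>l\<close>, how far.\<close>
    define \<delta> where "\<delta> = x - u * (1 - x)"
    have \<delta>: "\<delta> > 0" using u x1 2 by (simp add: \<delta>_def pos_less_divide_eq)
    define D where "D = u * x + x"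
    have ux: "D > 0" using u xy by (auto simp: D_def intro!: add_pos_pos)
    define l where "l = min (1 / 2) (\<delta> / (2 * D))"
    have "0 < l" using \<delta> ux by (simp add: l_def)
    moreover have "l \<le> 1 / 2" unfolding l_def by (rule min.cobounded1)
    ultimately have l: "0 < l" "l \<le> 1 / 2" by auto
    have "l * D \<le> \<delta> / (2 * D) * D"
      using ux by (intro mult_right_mono) (auto simp: l_def)
    also have "\<dots> < \<delta>" using ux \<delta> by simp
    finally have lt: "l * D < \<delta>" .
    have "(1 - l) *\<^sub>R (x, x) + l *\<^sub>R (0, s) \<in> S"
      using xy 2 l by (intro convexD[OF conv _ S2]) auto
    then have mem: "((1 - l) * x, (1 - l) * x + l * s) \<in> S" by simp
    have "P (((1 - l) * x + l * s) / (1 - (1 - l) * x))"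
      using l xy s by (intro ray[OF mem]) auto
    moreover have "u < ((1 - l) * x + l * s) / (1 - (1 - l) * x)"
    proof -
      have "(1 - l) * x < 1 * 1" using l x1 xy by (intro mult_less_le_imp_less) auto
      then have "1 - (1 - l) * x > 0" by simp
      moreover have "u * (1 - (1 - l) * x) < (1 - l) * x + l * s"
        using lt mult_pos_pos[OF l(1) s] by (simp add: \<delta>_def D_def algebra_simps)
      ultimately show ?thesis by (simp add: pos_less_divide_eq)
    qed
    ultimately show ?thesis using u by (simp add: P_def)
  next
    case 3
    \<comment> \<open>Below the diagonal the reflected point lies in S by symmetry, and its ratio x
      / (1 - y) is at least as large.\<close>
    have "y / (1 - x) \<le> x / (1 - y)"
    proof -
      have "0 \<le> (x - y) * (1 - (x + y))" using 3 le1[OF xy(1)] by simp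
      then have "y * (1 - y) \<le> x * (1 - x)" by (simp add: algebra_simps)
      then show ?thesis using x1 by (simp add: divide_simps)
    qed
    with ray[OF sym[OF xy(1)] xy(3) 3] u show ?thesis by (simp add: P_def)
  qed
qed

section \<open>The two continuity hypotheses applied to the conditional law of v 2\<close>

context markov_stick_breaking
begin

lemma cond_law_version_kernel:
  assumes cl: "cond_law_version M (v 1) (v 2) \<phi>" and B: "B \<in> sets borel"
  shows "kernel (Suc 0) B (\<lambda>u. measure (\<phi> u) B)"
  unfolding kernel_def
proof (intro conjI ballI allI)
  have ps: "prob_space (\<phi> u)" for u using cl by (simp add: cond_law_version_def)
  show m[measurable]: "(\<lambda>u. measure (\<phi> u) B) \<in> borel_measurable borel" using cl B by (simp add: cond_law_version_def)
  fix A :: "real set" assume A[measurable]: "A \<in> sets borel"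
  have "measure M {x \<in> space M. v 1 x \<in> A \<and> v 2 x \<in> B} = (\<integral>x. indicator A (v 1 x) * measure (\<phi> (v 1 x)) B \<partial>M)"
    using cl A B by (simp add: cond_law_version_def)
  then have "emeasure M {x \<in> space M. v 1 x \<in> A \<and> v 2 x \<in> B}
      = ennreal (\<integral>x. indicator A (v 1 x) * measure (\<phi> (v 1 x)) B \<partial>M)"
    by (simp add: emeasure_eq_measure)
  also have "\<dots> = (\<integral>\<^sup>+ x. ennreal (indicator A (v 1 x) * measure (\<phi> (v 1 x)) B) \<partial>M)"
  proof (rule nn_integral_eq_integral[symmetric])
    show "integrable M (\<lambda>x. indicator A (v 1 x) * measure (\<phi> (v 1 x)) B)"
      by (rule integrable_const_bound[where B = 1])
        (auto simp: indicator_def prob_space.prob_le_1[OF ps])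
  qed auto
  also have "\<dots> = (\<integral>\<^sup>+ x. indicator A (v 1 x) * ennreal (measure (\<phi> (v 1 x)) B) \<partial>M)"
    by (intro nn_integral_cong) (auto simp: indicator_def)
  finally show "emeasure M {x \<in> space M. v (Suc 0) x \<in> A \<and> v (Suc (Suc 0)) x \<in> B}
      = (\<integral>\<^sup>+ x. indicator A (v (Suc 0) x) * ennreal (measure (\<phi> (v (Suc 0) x)) B) \<partial>M)"
    by (simp add: numeral_2_eq_2)
qed auto

lemma cond_law_version_real_distribution:
  assumes cl: "cond_law_version M X Y \<phi>"
  shows "real_distribution (\<phi> u)"
  using cl sets_eq_imp_space_eq[of "\<phi> u" borel]
  by (auto simp: cond_law_version_def real_distribution_def real_distribution_axioms_def)

text \<open>\<open>kernel_swap\<close> is applied to each rational half-line, and the countably many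
  exceptional null sets are united.\<close>

lemma cond_law_version_swap:
  assumes inv: "sb_invariant M w" and cl: "cond_law_version M (v 1) (v 2) \<phi>"
  shows "AE x in M. \<phi> (v 1 x) = \<phi> (v 0 x / (1 - (1 - v 0 x) * v 1 x))"
proof -
  have "AE x in M. \<forall>q\<in>\<rat>. measure (\<phi> (v 1 x)) {..q} = measure (\<phi> (v 0 x / (1 - (1 - v 0 x) * v 1 x))) {..q}"
  proof (subst AE_ball_countable[OF countable_rat], intro ballI)
    fix q :: real
    have B: "{..q} \<in> sets borel" by simp
    show "AE x in M. measure (\<phi> (v 1 x)) {..q} = measure (\<phi> (v 0 x / (1 - (1 - v 0 x) * v 1 x))) {..q}"
      using kernel_swap[OF inv cond_law_version_kernel[OF cl B] B] by simp
  qed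
  then show ?thesis
    by eventually_elim (intro real_distribution_eqI_rat cond_law_version_real_distribution[OF cl], auto)
qed

lemma indep_past_if_cond_law_const:
  assumes cl: "cond_law_version M (v 1) (v 2) \<phi>" and c: "AE x in M. \<phi> (v 1 x) = \<nu>"
  shows "indep_past (Suc 0)"
proof (rule indep_past_if_kernel_const)
  fix B :: "real set" assume B: "B \<in> sets borel"
  have "AE x in M. measure (\<phi> (v (Suc 0) x)) B = measure \<nu> B" using c by eventually_elim simp
  with cond_law_version_kernel[OF cl B]
  show "\<exists>h c. kernel (Suc 0) B h \<and> (AE x in M. h (v (Suc 0) x) = c)" by blast
qed

text \<open>For any target u in (0, 1) there is an a with a / (1 - (1 - a) \<epsilon>) = u, and the
  point (a, \<epsilon>) lies in the support. Along sample points approaching it the exchange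
  identity passes to the limit and gives \<psi> u = \<psi> \<epsilon>.\<close>

lemma indep_past_if_weakly_continuous:
  assumes inv: "sb_invariant M w" and \<epsilon>: "0 < \<epsilon>" "\<epsilon> < 1"
    and line: "{p \<in> {0..1} \<times> {0..1}. snd p = \<epsilon>} \<subseteq> support (distr M borel (\<lambda>x. (v 0 x, v 1 x)))"
    and cl: "cond_law_version M (v 1) (v 2) \<psi>"
    and cont: "\<And>u us. u \<in> support (distr M borel (v 1)) \<Longrightarrow> (\<And>n. us n \<in> support (distr M borel (v 1)))
       \<Longrightarrow> us \<longlonglongrightarrow> u \<Longrightarrow> weak_conv_m (\<lambda>n. \<psi> (us n)) (\<psi> u)"
  shows "indep_past (Suc 0)"
proof (rule indep_past_if_cond_law_const[OF cl])
  let ?S = "support (distr M borel (v 1))"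
  let ?b' = "\<lambda>x. v 0 x / (1 - (1 - v 0 x) * v 1 x)"
  have S: "AE x in M. v 1 x \<in> ?S" by (rule AE_distr_support) simp
  have "closed (snd -` ?S :: (real \<times> real) set)"
    by (intro closed_vimage closed_support continuous_intros)
  then have "closed {p :: real \<times> real. snd p \<in> ?S}" by (simp add: vimage_def)
  then have "{p :: real \<times> real. snd p \<in> ?S} \<in> sets borel" by simp
  \<comment> \<open>Weak continuity is assumed on the support of v 1, so the exchanged variable must
    be shown to stay in it.\<close>
  from tilt_null[OF inv this, of 0] S have S': "AE x in M. ?b' x \<in> ?S" by simp
  have good: "AE x in M. v 1 x \<in> ?S \<and> ?b' x \<in> ?S \<and> \<psi> (v 1 x) = \<psi> (?b' x)"
    using S S' cond_law_version_swap[OF inv cl] by eventually_elim simp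
  have const: "\<psi> u = \<psi> \<epsilon>" if u: "0 < u" "u < 1" for u
  proof -
    define a where "a = u * (1 - \<epsilon>) / (1 - u * \<epsilon>)"
    have "u * \<epsilon> < 1 * 1" using u \<epsilon> by (intro mult_strict_mono) auto
    then have ue: "1 - u * \<epsilon> > 0" by simp
    have a: "0 < a" "a < 1" using u \<epsilon> ue by (auto simp: a_def field_simps)
    have "1 - (1 - a) * \<epsilon> = (1 - \<epsilon>) / (1 - u * \<epsilon>)" using ue by (simp add: a_def field_simps)
    then have au: "a / (1 - (1 - a) * \<epsilon>) = u" and den: "1 - (1 - a) * \<epsilon> \<noteq> 0"
      using ue \<epsilon> by (simp_all add: a_def)
    have "(a, \<epsilon>) \<in> support (distr M borel (\<lambda>x. (v 0 x, v 1 x)))" using line a \<epsilon> by auto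
    from support_distr_sequence[OF this _ good] obtain \<omega>
      where \<omega>: "\<And>n::nat. v 1 (\<omega> n) \<in> ?S" "\<And>n. ?b' (\<omega> n) \<in> ?S" "\<And>n. \<psi> (v 1 (\<omega> n)) = \<psi> (?b' (\<omega> n))"
      and lim: "(\<lambda>n. (v 0 (\<omega> n), v 1 (\<omega> n))) \<longlonglongrightarrow> (a, \<epsilon>)" by auto
    have l0: "(\<lambda>n. v 0 (\<omega> n)) \<longlonglongrightarrow> a" and l1: "(\<lambda>n. v 1 (\<omega> n)) \<longlonglongrightarrow> \<epsilon>"
      using tendsto_fst[OF lim] tendsto_snd[OF lim] by simp_all
    have l': "(\<lambda>n. ?b' (\<omega> n)) \<longlonglongrightarrow> u"
      unfolding au[symmetric] by (intro tendsto_intros l0 l1 den)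
    have "\<epsilon> \<in> ?S" by (rule closed_sequentially[OF closed_support _ l1]) (rule \<omega>)
    then have w1: "weak_conv_m (\<lambda>n. \<psi> (v 1 (\<omega> n))) (\<psi> \<epsilon>)" by (rule cont[OF _ \<omega>(1) l1])
    have "u \<in> ?S" by (rule closed_sequentially[OF closed_support _ l']) (rule \<omega>)
    then have "weak_conv_m (\<lambda>n. \<psi> (?b' (\<omega> n))) (\<psi> u)" by (rule cont[OF _ \<omega>(2) l'])
    then have "weak_conv_m (\<lambda>n. \<psi> (v 1 (\<omega> n))) (\<psi> u)" by (simp only: \<omega>(3))
    from weak_conv_m_unique[OF _ _ _ this w1] cond_law_version_real_distribution[OF cl]
    show ?thesis by blast
  qed
  show "AE x in M. \<psi> (v 1 x) = \<psi> \<epsilon>"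
    using v_AE by eventually_elim (auto intro: const)
qed

text \<open>For i \<noteq> j the positions (i, j) are a selection of positive probability, so the
  pair of weights found there almost surely stays in the support of the first pair.\<close>

lemma weights_pair_support:
  assumes inv: "sb_invariant M w"
  shows "AE x in M. \<forall>i j. i \<noteq> j \<longrightarrow> (w i x, w j x) \<in> support (distr M borel (\<lambda>x. (w 0 x, w 1 x)))"
proof -
  let ?S = "support (distr M borel (\<lambda>x. (w 0 x, w 1 x)))"
  let ?P = "PiM {..<2 :: nat} (\<lambda>_. borel :: real measure)"
  have [measurable]: "?S \<in> sets (borel \<Otimes>\<^sub>M borel)"
    unfolding borel_prod by (rule borel_closed[OF closed_support])
  have [measurable]: "(\<lambda>y. y 0) \<in> borel_measurable ?P" "(\<lambda>y. y (Suc 0)) \<in> borel_measurable ?P" by simp_all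
  define A where "A = {y \<in> space ?P. (y 0, y (Suc 0)) \<notin> ?S}"
  have A: "A \<in> sets ?P" unfolding A_def by measurable
  have "(\<lambda>x. (w 0 x, w 1 x)) \<in> borel_measurable M" by (simp add: borel_prod[symmetric])
  from AE_distr_support[OF this] have "AE x in M. (\<lambda>i\<in>{..<2}. w i x) \<notin> A"
    by eventually_elim (simp add: A_def)
  from sb_invariant_AE_notin[OF inv A this] show ?thesis
  proof eventually_elim
    case (elim x)
    show ?case
    proof safe
      fix i j :: nat assume "i \<noteq> j"
      then have "(\<lambda>l\<in>{..<2}. w ([i, j] ! l) x) \<notin> A" by (intro elim[rule_format]) auto
      moreover have "(\<lambda>l\<in>{..<2}. w ([i, j] ! l) x) \<in> space ?P" by (auto simp: space_PiM)
      ultimately show "(w i x, w j x) \<in> ?S" by (auto simp: A_def)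
    qed
  qed
qed

text \<open>In terms of weights, v 1 = w 1 / (1 - w 0) and its exchanged value is w 0 / (1 - w 1),
  so the exchange identity is the ratio identity on the support. Since later weights tend to 0, this
  closed set contains the origin and a point on each axis; with convexity that is the setting of
  \<open>ratio_identity_const\<close>.\<close>

lemma indep_past_if_left_continuous:
  assumes inv: "sb_invariant M w"
    and conv: "convex (support (distr M borel (\<lambda>x. (w 0 x, w 1 x))))"
    and cl: "cond_law_version M (v 1) (v 2) \<phi>"
    and cont: "\<And>u us. (\<And>n. us n < u) \<Longrightarrow> us \<longlonglongrightarrow> u \<Longrightarrow> weak_conv_m (\<lambda>n. \<phi> (us n)) (\<phi> u)"
  shows "indep_past (Suc 0)"
proof -
  let ?S = "support (distr M borel (\<lambda>x. (w 0 x, w 1 x)))"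
  note rd = cond_law_version_real_distribution[OF cl]
  have W[measurable]: "(\<lambda>x. (w 0 x, w 1 x)) \<in> borel_measurable M" by (simp add: borel_prod[symmetric])
  have good: "AE x in M. (\<forall>j. w j x > 0) \<and> w 0 x + w 1 x \<le> 1 \<and> (\<lambda>j. w j x) \<longlonglongrightarrow> 0
      \<and> (\<forall>i j. i \<noteq> j \<longrightarrow> (w i x, w j x) \<in> ?S) \<and> v 1 x = w 1 x / (1 - w 0 x)
      \<and> \<phi> (w 1 x / (1 - w 0 x)) = \<phi> (w 0 x / (1 - w 1 x))"
    using weights_AE v_AE weights_pair_support[OF inv] cond_law_version_swap[OF inv cl]
  proof eventually_elim
    case (elim x)
    have v0: "v 0 x \<noteq> 1" using elim(2) by (metis less_irrefl)
    have w0: "w 0 x = v 0 x" and w1: "w (Suc 0) x = (1 - v 0 x) * v (Suc 0) x" by (simp_all add: stick_weights_def)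
    have "w 0 x + w 1 x = (\<Sum>i\<in>{0,1}. w i x)" by simp
    also have "\<dots> < 1" using elim(1) by (intro sum_less_1_if_sums) auto
    finally have "w 0 x + w 1 x \<le> 1" by simp
    moreover have "(\<lambda>j. w j x) \<longlonglongrightarrow> 0" using elim(1) by (auto intro: summable_LIMSEQ_zero sums_summable)
    moreover have "v 1 x = w 1 x / (1 - w 0 x)" using v0 by (simp add: w0 w1)
    ultimately show ?case using elim by (simp add: w0 w1)
  qed
  \<comment> \<open>A single sample point at which the almost sure facts hold supplies the side s of
    the triangle, namely its first weight.\<close>
  obtain x0 where x0: "\<And>j. w j x0 > 0" "(\<lambda>j. w j x0) \<longlonglongrightarrow> 0" "\<And>i j. i \<noteq> j \<Longrightarrow> (w i x0, w j x0) \<in> ?S"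
  proof -
    have "\<exists>x\<in>space M. (\<forall>j. w j x > 0) \<and> (\<lambda>j. w j x) \<longlonglongrightarrow> 0 \<and> (\<forall>i j. i \<noteq> j \<longrightarrow> (w i x, w j x) \<in> ?S)"
    proof (rule ccontr)
      assume no: "\<not> ?thesis"
      from good AE_space have "AE x in M. False" by eventually_elim (use no in auto)
      then show False by simp
    qed
    with that show ?thesis by blast
  qed
  define s where "s = w 0 x0"
  have s: "s > 0" using x0 by (simp add: s_def)
  have sh: "(\<lambda>j. w (Suc j) x0) \<longlonglongrightarrow> 0" "(\<lambda>j. w (Suc (Suc j)) x0) \<longlonglongrightarrow> 0"
    using x0(2) by (auto intro: LIMSEQ_Suc)
  have S1: "(s, 0) \<in> ?S"
  proof (rule closed_sequentially[OF closed_support])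
    show "(\<lambda>j. (w 0 x0, w (Suc j) x0)) \<longlonglongrightarrow> (s, 0)" unfolding s_def by (intro tendsto_intros sh)
    show "(w 0 x0, w (Suc j) x0) \<in> ?S" for j by (rule x0(3)) simp
  qed
  have S2: "(0, s) \<in> ?S"
  proof (rule closed_sequentially[OF closed_support])
    show "(\<lambda>j. (w (Suc j) x0, w 0 x0)) \<longlonglongrightarrow> (0, s)" unfolding s_def by (intro tendsto_intros sh)
    show "(w (Suc j) x0, w 0 x0) \<in> ?S" for j by (rule x0(3)) simp
  qed
  have S0: "(0, 0) \<in> ?S"
  proof (rule closed_sequentially[OF closed_support])
    show "(\<lambda>j. (w (Suc j) x0, w (Suc (Suc j)) x0)) \<longlonglongrightarrow> (0, 0)" by (intro tendsto_intros sh)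
    show "(w (Suc j) x0, w (Suc (Suc j)) x0) \<in> ?S" for j by (rule x0(3)) simp
  qed
  have flip: "AE x in M. (w 1 x, w 0 x) \<in> ?S"
    using weights_pair_support[OF inv] by (rule eventually_mono) (metis zero_neq_one)
  have sym: "(b, a) \<in> ?S" if ab: "(a, b) \<in> ?S" for a b
  proof -
    obtain \<omega> where mem: "\<And>n::nat. (w 1 (\<omega> n), w 0 (\<omega> n)) \<in> ?S"
      and lim: "(\<lambda>n. (w 0 (\<omega> n), w 1 (\<omega> n))) \<longlonglongrightarrow> (a, b)"
      using support_distr_sequence[OF ab W flip] by blast
    have "(\<lambda>n. (w 1 (\<omega> n), w 0 (\<omega> n))) \<longlonglongrightarrow> (b, a)"
      using tendsto_Pair[OF tendsto_snd[OF lim] tendsto_fst[OF lim]] by simp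
    from closed_sequentially[OF closed_support mem this] show ?thesis .
  qed
  have le1: "a + b \<le> 1" if ab: "(a, b) \<in> ?S" for a b
  proof -
    obtain \<omega> where le: "\<And>n::nat. w 0 (\<omega> n) + w 1 (\<omega> n) \<le> 1" and lim: "(\<lambda>n. (w 0 (\<omega> n), w 1 (\<omega> n))) \<longlonglongrightarrow> (a, b)"
      using support_distr_sequence[OF ab W good] by auto
    have "(\<lambda>n. w 0 (\<omega> n) + w 1 (\<omega> n)) \<longlonglongrightarrow> a + b"
      using tendsto_add[OF tendsto_fst[OF lim] tendsto_snd[OF lim]] by simp
    then show ?thesis using le by (intro LIMSEQ_le_const2) auto
  qed
  have id: "\<phi> (b / (1 - a)) = \<phi> (a / (1 - b))" if ab: "(a, b) \<in> ?S" "a > 0" "b > 0" for a b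
  proof -
    have lt1: "a < 1" "b < 1" using le1[OF ab(1)] ab by auto
    \<comment> \<open>Left continuity requires both ratios to be approached strictly from below, so
      sample points are taken with both weights strictly below a and b.\<close>
    have "\<exists>x\<in>space M. (w 0 x, w 1 x) \<in> {max 0 (a - inverse (real (Suc n)))<..<a} \<times> {max 0 (b - inverse (real (Suc n)))<..<b}
       \<and> \<phi> (w 1 x / (1 - w 0 x)) = \<phi> (w 0 x / (1 - w 1 x))" for n
    proof -
      define \<delta> where "\<delta> = inverse (real (Suc n))"
      have \<delta>: "0 < \<delta>" "\<delta> \<le> 1" by (simp_all add: \<delta>_def inverse_le_1_iff)
      \<comment> \<open>Shrinking (a, b) towards the origin stays in the support by convexity and
        lands inside the open box below (a, b).\<close>
      define t where "t = 1 - \<delta> / 2"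
      have t: "0 < t" "t < 1" using \<delta> by (auto simp: t_def)
      have "t *\<^sub>R (a, b) + (1 - t) *\<^sub>R (0, 0) \<in> ?S"
        using t by (intro convexD[OF conv ab(1) S0]) auto
      then have mem: "(t * a, t * b) \<in> ?S" by simp
      have bd: "max 0 (z - \<delta>) < t * z \<and> t * z < z" if "0 < z" "z < 1" for z
      proof -
        have "z * (\<delta> / 2) < 1 * \<delta>" using that \<delta> by (intro mult_strict_mono) auto
        then have "z - \<delta> < t * z" by (simp add: t_def algebra_simps)
        then show ?thesis using that t by simp
      qed
      show ?thesis
        unfolding \<delta>_def[symmetric]
        by (rule support_distr_ex[OF mem W])
          (use good bd[of a] bd[of b] ab lt1 in \<open>auto intro!: open_Times elim!: eventually_mono\<close>)
    qed
    then obtain \<omega> where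
      \<omega>: "\<And>n. (w 0 (\<omega> n), w 1 (\<omega> n)) \<in> {max 0 (a - inverse (real (Suc n)))<..<a} \<times> {max 0 (b - inverse (real (Suc n)))<..<b}"
      and eq: "\<And>n. \<phi> (w 1 (\<omega> n) / (1 - w 0 (\<omega> n))) = \<phi> (w 0 (\<omega> n) / (1 - w 1 (\<omega> n)))" by metis
    have bds: "0 < w 0 (\<omega> n)" "w 0 (\<omega> n) < a" "0 < w 1 (\<omega> n)" "w 1 (\<omega> n) < b"
        "a - inverse (real (Suc n)) \<le> w 0 (\<omega> n)" "b - inverse (real (Suc n)) \<le> w 1 (\<omega> n)" for n
      using \<omega>[of n] by auto
    have minus: "(\<lambda>n. z - inverse (real (Suc n))) \<longlonglongrightarrow> z" for z
      using LIMSEQ_inverse_real_of_nat_add_minus[of z] by simp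
    have la: "(\<lambda>n. w 0 (\<omega> n)) \<longlonglongrightarrow> a"
      by (rule real_tendsto_sandwich[OF _ _ minus tendsto_const])
        (auto intro!: always_eventually bds less_imp_le[OF bds(2)] simp del: of_nat_Suc One_nat_def)
    have lb: "(\<lambda>n. w 1 (\<omega> n)) \<longlonglongrightarrow> b"
      by (rule real_tendsto_sandwich[OF _ _ minus tendsto_const])
        (auto intro!: always_eventually bds less_imp_le[OF bds(4)] simp del: of_nat_Suc One_nat_def)
    have w1: "weak_conv_m (\<lambda>n. \<phi> (w 1 (\<omega> n) / (1 - w 0 (\<omega> n)))) (\<phi> (b / (1 - a)))"
    proof (rule cont)
      show "w 1 (\<omega> n) / (1 - w 0 (\<omega> n)) < b / (1 - a)" for n
        using bds[of n] lt1 by (intro frac_less) auto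
      show "(\<lambda>n. w 1 (\<omega> n) / (1 - w 0 (\<omega> n))) \<longlonglongrightarrow> b / (1 - a)"
        using lt1 by (intro tendsto_intros la lb) auto
    qed
    have "weak_conv_m (\<lambda>n. \<phi> (w 0 (\<omega> n) / (1 - w 1 (\<omega> n)))) (\<phi> (a / (1 - b)))"
    proof (rule cont)
      show "w 0 (\<omega> n) / (1 - w 1 (\<omega> n)) < a / (1 - b)" for n
        using bds[of n] lt1 by (intro frac_less) auto
      show "(\<lambda>n. w 0 (\<omega> n) / (1 - w 1 (\<omega> n))) \<longlonglongrightarrow> a / (1 - b)"
        using lt1 by (intro tendsto_intros la lb) auto
    qed
    then have "weak_conv_m (\<lambda>n. \<phi> (w 1 (\<omega> n) / (1 - w 0 (\<omega> n)))) (\<phi> (a / (1 - b)))" by (simp only: eq)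
    from weak_conv_m_unique[OF rd rd rd w1 this] show ?thesis .
  qed
  have const: "\<phi> (b / (1 - a)) = \<phi> (s / 4)" if ab: "(a, b) \<in> ?S" "a > 0" "b > 0" for a b
  proof -
    have a1: "a < 1" using le1[OF ab(1)] ab by auto
    define U where "U = b / (1 - a)"
    have U: "U > 0" using a1 ab by (simp add: U_def)
    \<comment> \<open>Constancy is known strictly below the ratio \<open>U\<close>; a sequence
      increasing to \<open>U\<close> and left continuity add the endpoint.\<close>
    define us where "us n = U * (1 - inverse (real (Suc (Suc n))))" for n :: nat
    have us: "0 < us n" "us n < U" for n
      using U by (simp_all add: us_def inverse_less_1_iff algebra_simps)
    have "(\<lambda>n. inverse (real (Suc (Suc n)))) \<longlonglongrightarrow> 0"
      using LIMSEQ_Suc[OF LIMSEQ_inverse_real_of_nat] .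
    then have "us \<longlonglongrightarrow> U * (1 - 0)" unfolding us_def by (intro tendsto_intros)
    then have "weak_conv_m (\<lambda>n. \<phi> (us n)) (\<phi> U)" using us by (intro cont) auto
    moreover have "\<phi> (us n) = \<phi> (s / 4)" for n
      using ratio_identity_const[where f = \<phi>, OF conv S0 S1 S2 s sym le1 id ab us(1)] us(2) by (simp add: U_def)
    ultimately have w1: "weak_conv_m (\<lambda>n::nat. \<phi> (s / 4)) (\<phi> U)" by simp
    have w2: "weak_conv_m (\<lambda>n::nat. \<phi> (s / 4)) (\<phi> (s / 4))"
      by (simp add: weak_conv_m_def weak_conv_def)
    show ?thesis using weak_conv_m_unique[OF rd rd rd w1 w2] by (simp add: U_def)
  qed
  show ?thesis
  proof (rule indep_past_if_cond_law_const[OF cl])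
    show "AE x in M. \<phi> (v 1 x) = \<phi> (s / 4)"
      using good by eventually_elim (auto intro!: const)
  qed
qed

end

section \<open>From invariance to independent beta laws\<close>

lemma AE_beta_measure_iff:
  assumes "p > 0" "q > 0"
  shows "(AE b in beta_measure p q. Q b) \<longleftrightarrow> (AE b in lborel. 0 < b \<and> b < 1 \<longrightarrow> Q b)"
proof -
  have "ennreal (beta_density p q b) > 0 \<longleftrightarrow> 0 < b \<and> b < 1" for b
    using Beta_real_pos[OF assms] by (auto simp: beta_density_def indicator_def)
  then show ?thesis unfolding beta_measure_def by (subst AE_density) auto
qed

context markov_stick_breaking
begin

abbreviation law :: "nat \<Rightarrow> real measure" where "law n \<equiv> distr M borel (v n)"

lemma AE_law_iff: "{b. Q b} \<in> sets borel \<Longrightarrow> (AE b in law n. Q b) \<longleftrightarrow> (AE x in M. Q (v n x))"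
  by (subst AE_distr_iff) auto

lemma unit_law_law: "unit_law (law n)"
  unfolding unit_law_def
proof (intro conjI)
  show "prob_space (law n)" by (rule prob_space_distr) simp
  show "AE a in law n. 0 < a \<and> a < 1"
    using v_AE by (subst AE_distr_iff) (auto elim!: eventually_mono)
qed simp

section \<open>Laws conditioned on an event of an earlier variable\<close>

definition cond_space :: "nat \<Rightarrow> real set \<Rightarrow> 'a measure" where
  "cond_space i A = uniform_measure M {x \<in> space M. v i x \<in> A}"

definition cond_law :: "nat \<Rightarrow> nat \<Rightarrow> real set \<Rightarrow> real measure" where
  "cond_law i n A = distr (cond_space i A) borel (v n)"

context
  fixes i n :: nat and A :: "real set"
  assumes indep: "indep_past n" and i: "i < n \<or> i = n \<and> A = UNIV" and A[measurable]: "A \<in> sets borel"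
    and pos: "prob {x \<in> space M. v i x \<in> A} > 0"
begin

lemma prob_space_cond_space: "prob_space (cond_space i A)"
  unfolding cond_space_def using pos by (intro prob_space_uniform_measure) (auto simp: emeasure_eq_measure)

lemma sets_cond_space[measurable_cong]: "sets (cond_space i A) = sets M"
  by (simp add: cond_space_def)

lemma unit_law_cond_law: "unit_law (cond_law i n A)"
  unfolding unit_law_def
proof (intro conjI)
  show "prob_space (cond_law i n A)" unfolding cond_law_def by (intro prob_space.prob_space_distr prob_space_cond_space) measurable
  have "AE x in (cond_space i A). 0 < v n x \<and> v n x < 1"
    unfolding cond_space_def using v_AE pos
    by (intro AE_uniform_measureI) (auto elim!: eventually_mono)
  then show "AE a in (cond_law i n A). 0 < a \<and> a < 1"
    unfolding cond_law_def by (subst AE_distr_iff) (auto simp: cond_space_def)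
qed (simp add: cond_law_def)

text \<open>The conditioning event and v n both belong to the past of v (n + 1), so conditioning
  keeps v (n + 1) independent of v n and leaves its law unchanged.\<close>

lemma distr_pair_cond_space:
  "(cond_law i n A) \<Otimes>\<^sub>M law (Suc n) = distr (cond_space i A) (borel \<Otimes>\<^sub>M borel) (\<lambda>x. (v n x, v (Suc n) x))"
proof (rule pair_measure_eqI)
  interpret C: prob_space "cond_law i n A" by (rule unit_law_prob[OF unit_law_cond_law])
  interpret L: prob_space "law (Suc n)" by (rule unit_law_prob[OF unit_law_law])
  show "sigma_finite_measure (cond_law i n A)" "sigma_finite_measure (law (Suc n))" by unfold_locales
  show "sets ((cond_law i n A) \<Otimes>\<^sub>M law (Suc n)) = sets (distr (cond_space i A) (borel \<Otimes>\<^sub>M borel) (\<lambda>x. (v n x, v (Suc n) x)))"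
    by (simp add: cond_law_def cong: sets_pair_measure_cong)
  fix X Y assume "X \<in> sets (cond_law i n A)" "Y \<in> sets (law (Suc n))"
  then have [measurable]: "X \<in> sets borel" "Y \<in> sets borel" by (simp_all add: cond_law_def)
  let ?C = "{x \<in> space M. v i x \<in> A}"
  let ?D = "?C \<inter> {x \<in> space M. v n x \<in> X}"
  have D: "?D \<in> sets (past n)"
  proof -
    have "v i -` A \<inter> space M \<in> sets (past n)" "v n -` X \<inter> space M \<in> sets (past n)"
      using i by (auto intro!: gen_sigma_gen)
    then have "(v i -` A \<inter> space M) \<inter> (v n -` X \<inter> space M) \<in> sets (past n)" by (rule sets.Int)
    moreover have "(v i -` A \<inter> space M) \<inter> (v n -` X \<inter> space M) = ?D" by auto
    ultimately show ?thesis by simp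
  qed
  have cX: "emeasure (cond_law i n A) X = ennreal (prob ?D / prob ?C)"
  proof -
    have "emeasure (cond_law i n A) X = emeasure (cond_space i A) {x \<in> space M. v n x \<in> X}"
      unfolding cond_law_def by (subst emeasure_distr) (auto simp: cond_space_def vimage_def Int_def conj_commute)
    also have "\<dots> = emeasure M ?D / emeasure M ?C"
      unfolding cond_space_def by (rule emeasure_uniform_measure) auto
    finally show ?thesis using pos by (simp add: emeasure_eq_measure divide_ennreal)
  qed
  have lY: "emeasure (law (Suc n)) Y = ennreal (prob {x \<in> space M. v (Suc n) x \<in> Y})"
    by (subst emeasure_distr) (auto simp: emeasure_eq_measure vimage_def Int_def conj_commute)
  have "emeasure (distr (cond_space i A) (borel \<Otimes>\<^sub>M borel) (\<lambda>x. (v n x, v (Suc n) x))) (X \<times> Y)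
      = emeasure (cond_space i A) {x \<in> space M. v n x \<in> X \<and> v (Suc n) x \<in> Y}"
    by (subst emeasure_distr, measurable)
      (auto intro!: arg_cong2[where f = emeasure] simp: sets_eq_imp_space_eq[OF sets_cond_space])
  also have "\<dots> = emeasure M (?C \<inter> {x \<in> space M. v n x \<in> X \<and> v (Suc n) x \<in> Y}) / emeasure M ?C"
    unfolding cond_space_def by (rule emeasure_uniform_measure) auto
  also have "?C \<inter> {x \<in> space M. v n x \<in> X \<and> v (Suc n) x \<in> Y} = ?D \<inter> {x \<in> space M. v (Suc n) x \<in> Y}" by auto
  also have "emeasure M (?D \<inter> {x \<in> space M. v (Suc n) x \<in> Y}) / emeasure M ?C
    = ennreal (prob ?D * prob {x \<in> space M. v (Suc n) x \<in> Y} / prob ?C)"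
    using indep D pos unfolding indep_past_def by (simp add: emeasure_eq_measure divide_ennreal)
  also have "\<dots> = emeasure (cond_law i n A) X * emeasure (law (Suc n)) Y"
    unfolding cX lY by (simp add: ennreal_mult[symmetric])
  finally show "emeasure (cond_law i n A) X * emeasure (law (Suc n)) Y
    = emeasure (distr (cond_space i A) (borel \<Otimes>\<^sub>M borel) (\<lambda>x. (v n x, v (Suc n) x))) (X \<times> Y)" by simp
qed

text \<open>The exchange at n leaves v i fixed for i < n, so the indicator of the conditioning event
  is carried through it. The alternative i = n with A = \<open>UNIV\<close> is the unconditioned
  case.\<close>

lemma tilt_sym_cond_law:
  assumes inv: "sb_invariant M w"
  shows "tilt_sym (cond_law i n A) (law (Suc n))"
  unfolding tilt_sym_def
proof (intro allI impI)
  fix f :: "real \<times> real \<Rightarrow> ennreal" assume "f \<in> borel_measurable borel"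
  then have [measurable]: "f \<in> borel_measurable (borel \<Otimes>\<^sub>M borel)" by (simp add: borel_prod)
  interpret L: prob_space "law (Suc n)" by (rule unit_law_prob[OF unit_law_law])
  let ?C = "{x \<in> space M. v i x \<in> A}"
  have val: "(\<integral>\<^sup>+ a. \<integral>\<^sup>+ b. ennreal (1 - a) * g (a, b) \<partial>law (Suc n) \<partial>(cond_law i n A))
    = (\<integral>\<^sup>+ x. ennreal (1 - v n x) * (indicator A (v i x) * g (v n x, v (Suc n) x)) \<partial>M) / emeasure M ?C"
    if [measurable]: "g \<in> borel_measurable (borel \<Otimes>\<^sub>M borel)" for g :: "real \<times> real \<Rightarrow> ennreal"
  proof -
    let ?g = "\<lambda>p. ennreal (1 - fst p) * g p"
    have m: "?g \<in> borel_measurable ((cond_law i n A) \<Otimes>\<^sub>M law (Suc n))"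
      by (subst measurable_cong_sets[OF sets_pair_measure_cong[of _ borel _ borel] refl])
        (auto simp: cond_law_def)
    have "(\<integral>\<^sup>+ a. \<integral>\<^sup>+ b. ennreal (1 - a) * g (a, b) \<partial>law (Suc n) \<partial>(cond_law i n A))
      = (\<integral>\<^sup>+ p. ?g p \<partial>((cond_law i n A) \<Otimes>\<^sub>M law (Suc n)))"
      using L.nn_integral_fst[OF m] by simp
    also have "\<dots> = (\<integral>\<^sup>+ x. ?g (v n x, v (Suc n) x) \<partial>(cond_space i A))"
      unfolding distr_pair_cond_space by (rule nn_integral_distr) measurable
    also have "\<dots> = (\<integral>\<^sup>+ x. ?g (v n x, v (Suc n) x) * indicator ?C x \<partial>M) / emeasure M ?C"
      unfolding cond_space_def by (rule nn_integral_uniform_measure) measurable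
    also have "(\<integral>\<^sup>+ x. ?g (v n x, v (Suc n) x) * indicator ?C x \<partial>M)
      = (\<integral>\<^sup>+ x. ennreal (1 - v n x) * (indicator A (v i x) * g (v n x, v (Suc n) x)) \<partial>M)"
      by (intro nn_integral_cong) (auto simp: indicator_def)
    finally show ?thesis .
  qed
  let ?T = "\<lambda>p :: real \<times> real. ((1 - fst p) * snd p, fst p / (1 - (1 - fst p) * snd p))"
  let ?k = "Suc (Suc n)"
  let ?G = "\<lambda>y :: nat \<Rightarrow> real. indicator A (y i) * f (y n, y (Suc n)) :: ennreal"
  have comp: "(\<lambda>y. y j) \<in> borel_measurable (listM ?k)" if "j < ?k" for j
    using that by simp
  have [measurable]: "(\<lambda>y. y n) \<in> borel_measurable (listM ?k)"
    "(\<lambda>y. y (Suc n)) \<in> borel_measurable (listM ?k)"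
    "(\<lambda>y. y i) \<in> borel_measurable (listM ?k)"
    using i by (auto intro!: comp)
  have "?G \<in> borel_measurable (listM ?k)" by measurable
  note sw = sb_invariant_vswap[OF inv this, of n]
  have ind: "indicator A (vswap n (\<lambda>i. v i x) i) = (indicator A (v i x) :: ennreal)" for x
    using i by (auto simp: vswap_def)
  have ik: "i < ?k" using i by auto
  have "(\<integral>\<^sup>+ x. ennreal (1 - v n x) * (indicator A (v i x) * f (v n x, v (Suc n) x)) \<partial>M)
    = (\<integral>\<^sup>+ x. ennreal (1 - v n x) * (indicator A (v i x) * f (?T (v n x, v (Suc n) x))) \<partial>M)"
    using sw ik ind by (simp add: vswap_def)
  moreover have "(\<lambda>p. f (?T p)) \<in> borel_measurable (borel \<Otimes>\<^sub>M borel)" by measurable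
  ultimately show "(\<integral>\<^sup>+ a. \<integral>\<^sup>+ b. ennreal (1 - a) * f (a, b) \<partial>law (Suc n) \<partial>(cond_law i n A))
    = (\<integral>\<^sup>+ a. \<integral>\<^sup>+ b. ennreal (1 - a) * f ((1 - a) * b, a / (1 - (1 - a) * b)) \<partial>law (Suc n) \<partial>(cond_law i n A))"
    using val[of f] val[of "\<lambda>p. f (?T p)"] by simp
qed

end

lemma uniform_measure_space: "uniform_measure M (space M) = M"
proof -
  have "density M (indicator (space M)) = density M (\<lambda>_. 1)"
    by (rule density_cong) auto
  then show ?thesis by (simp add: uniform_measure_def emeasure_space_1 density_1 divide_ennreal_def)
qed

lemma cond_law_UNIV: "cond_law n n UNIV = law n"
  unfolding cond_law_def cond_space_def by (simp add: uniform_measure_space)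

lemma tilt_sym_law:
  assumes "sb_invariant M w" "indep_past n"
  shows "tilt_sym (law n) (law (Suc n))"
  using tilt_sym_cond_law[of n n UNIV, OF assms(2) _ _ _ assms(1)] by (simp add: cond_law_UNIV prob_space)

lemma pair_law:
  assumes "indep_past n"
  shows "law n \<Otimes>\<^sub>M law (Suc n) = distr M (borel \<Otimes>\<^sub>M borel) (\<lambda>x. (v n x, v (Suc n) x))"
  using distr_pair_cond_space[of n n UNIV, OF assms]
  by (simp add: cond_law_UNIV cond_space_def uniform_measure_space prob_space)

text \<open>The conditional law of v 1 and its unconditional law are both first partners of the law
  of v 2, which conditioning on v 0 does not alter; uniqueness of the first partner identifies
  them.\<close>

lemma indep_past_0:
  assumes inv: "sb_invariant M w" and ind: "indep_past (Suc 0)"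
  shows "indep_past 0"
  unfolding indep_past_def
proof (intro ballI)
  fix B :: "real set" and C assume B[measurable]: "B \<in> sets borel" and "C \<in> sets (past 0)"
  then have "C \<in> sets (gen_sigma M v {0})" by simp
  then obtain A where A[measurable]: "A \<in> sets borel" and C: "C = v 0 -` A \<inter> space M"
    using sets_gen_sigma_singleton by blast
  have C': "C = {x \<in> space M. v 0 x \<in> A}" by (auto simp: C)
  show "prob (C \<inter> {x \<in> space M. v (Suc 0) x \<in> B}) = prob C * prob {x \<in> space M. v (Suc 0) x \<in> B}"
  proof (cases "prob C = 0")
    case True
    have "prob (C \<inter> {x \<in> space M. v (Suc 0) x \<in> B}) \<le> prob C"
      unfolding C' by (intro finite_measure_mono) auto
    with True show ?thesis using measure_nonneg[of M "C \<inter> {x \<in> space M. v (Suc 0) x \<in> B}"] by simp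
  next
    case False
    then have pos: "prob {x \<in> space M. v 0 x \<in> A} > 0" unfolding C' by (simp add: less_le)
    have "cond_law 0 (Suc 0) A = law (Suc 0)"
      by (rule tilt_sym_left_unique[OF unit_law_cond_law unit_law_law unit_law_law
            tilt_sym_cond_law tilt_sym_law])
        (use inv ind pos in auto)
    then have "emeasure (cond_law 0 (Suc 0) A) B = emeasure (law (Suc 0)) B" by simp
    moreover have "emeasure (cond_law 0 (Suc 0) A) B = emeasure M (C \<inter> {x \<in> space M. v (Suc 0) x \<in> B}) / emeasure M C"
    proof -
      have "emeasure (cond_law 0 (Suc 0) A) B = emeasure (cond_space 0 A) {x \<in> space M. v (Suc 0) x \<in> B}"
        unfolding cond_law_def
        by (subst emeasure_distr) (auto simp: cond_space_def vimage_def Int_def conj_commute)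
      also have "\<dots> = emeasure M (C \<inter> {x \<in> space M. v (Suc 0) x \<in> B}) / emeasure M C"
        unfolding cond_space_def C' by (rule emeasure_uniform_measure) auto
      finally show ?thesis .
    qed
    moreover have "emeasure (law (Suc 0)) B = emeasure M {x \<in> space M. v (Suc 0) x \<in> B}"
      by (subst emeasure_distr) (auto simp: vimage_def Int_def conj_commute)
    ultimately have "prob (C \<inter> {x \<in> space M. v (Suc 0) x \<in> B}) / prob C = prob {x \<in> space M. v (Suc 0) x \<in> B}"
      using pos C' by (simp add: emeasure_eq_measure divide_ennreal)
    then show ?thesis using False by (simp add: field_simps)
  qed
qed

lemma not_Dirac:
  assumes inv: "sb_invariant M w" and c: "AE x in M. v 0 x = c"
  shows False
proof -
  let ?P = "PiM {..<1 :: nat} (\<lambda>_. borel :: real measure)"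
  have [measurable]: "(\<lambda>y. y 0) \<in> borel_measurable ?P" by simp
  define A where "A = {y \<in> space ?P. y 0 \<noteq> c}"
  have A: "A \<in> sets ?P" unfolding A_def by measurable
  have "AE x in M. (\<lambda>i\<in>{..<1}. w i x) \<notin> A"
    using c by eventually_elim (simp add: A_def stick_weights_def)
  from sb_invariant_AE_notin[OF inv A this] weights_AE have "AE x in M. False"
  proof eventually_elim
    case (elim x)
    \<comment> \<open>A selection of length one may be any position, so every weight, not just the
      first, equals c.\<close>
    have "w j x = c" for j
    proof -
      have "(\<lambda>l\<in>{..<1}. w ([j] ! l) x) \<notin> A" by (intro elim(1)[rule_format]) auto
      moreover have "(\<lambda>l\<in>{..<1}. w ([j] ! l) x) \<in> space ?P" by (auto simp: space_PiM)
      ultimately show ?thesis by (auto simp: A_def)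
    qed
    moreover have "(\<lambda>j. w j x) \<longlonglongrightarrow> 0" using elim(2) by (auto intro: summable_LIMSEQ_zero sums_summable)
    ultimately have "c = 0" by (simp add: LIMSEQ_const_iff)
    with \<open>\<And>j. w j x = c\<close> elim(2) show False by (metis less_irrefl)
  qed
  then show False by simp
qed

text \<open>By independence the pair has a product law, so Fubini turns an almost sure property of
  the pair into one valid for almost every point of the square.\<close>

lemma indep_past_if_beta:
  assumes inv: "sb_invariant M w" and ind: "indep_past n"
    and pos: "p > 0" "q > 0" "p' > 0" "q' > 0"
    and law: "law n = beta_measure p q" "law (Suc n) = beta_measure p' q'"
  shows "indep_past (Suc n)"
proof (rule indep_past_if_ac_square[OF inv])
  fix Q :: "real \<Rightarrow> real \<Rightarrow> bool"
  assume Q: "{p. Q (fst p) (snd p)} \<in> sets borel" and ae: "AE x in M. Q (v n x) (v (Suc n) x)"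
  interpret L0: prob_space "law n" by (rule unit_law_prob[OF unit_law_law])
  interpret L1: prob_space "law (Suc n)" by (rule unit_law_prob[OF unit_law_law])
  interpret P: pair_sigma_finite "law n" "law (Suc n)" ..
  have "{p \<in> space (borel \<Otimes>\<^sub>M borel). Q (fst p) (snd p)} \<in> sets (borel \<Otimes>\<^sub>M borel)"
    unfolding borel_prod using Q by simp
  with ae have "AE p in law n \<Otimes>\<^sub>M law (Suc n). Q (fst p) (snd p)"
    unfolding pair_law[OF ind] by (subst AE_distr_iff) auto
  from P.AE_pair[OF this] have "AE a in law n. AE b in law (Suc n). Q a b" by simp
  then have "AE a in lborel. 0 < a \<and> a < 1 \<longrightarrow> (AE b in lborel. 0 < b \<and> b < 1 \<longrightarrow> Q a b)"
    unfolding law AE_beta_measure_iff[OF pos(1,2)] AE_beta_measure_iff[OF pos(3,4)] .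
  then show "AE a in lborel. AE b in lborel. 0 < a \<and> a < 1 \<and> 0 < b \<and> b < 1 \<longrightarrow> Q a b"
  proof eventually_elim
    case (elim a)
    then show ?case by (cases "0 < a \<and> a < 1") (auto elim!: eventually_mono)
  qed
next
  fix Q :: "real \<Rightarrow> bool"
  assume Q: "{b. Q b} \<in> sets borel" and ae: "AE b in lborel. 0 < b \<and> b < 1 \<longrightarrow> Q b"
  then have "AE b in law (Suc n). Q b" unfolding law AE_beta_measure_iff[OF pos(3,4)] by blast
  then show "AE x in M. Q (v (Suc n) x)" by (simp add: AE_law_iff[OF Q])
qed

lemma indep_past_if_ac:
  assumes inv: "sb_invariant M w"
    and ac1: "absolutely_continuous (distr M borel (\<lambda>x. (v 0 x, v 1 x)))
        (density lborel (indicator ({0..1} \<times> {0..1}) :: real \<times> real \<Rightarrow> ennreal))"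
    and ac2: "absolutely_continuous (density lborel (indicator ({0..1} \<times> {0..1}) :: real \<times> real \<Rightarrow> ennreal))
        (distr M borel (\<lambda>x. (v 0 x, v 1 x)))"
  shows "indep_past (Suc 0)"
proof (rule indep_past_if_ac_square[OF inv])
  let ?D = "distr M borel (\<lambda>x. (v 0 x, v 1 x))"
  let ?L = "density lborel (indicator ({0..1} \<times> {0..1}) :: real \<times> real \<Rightarrow> ennreal)"
  have W[measurable]: "(\<lambda>x. (v 0 x, v 1 x)) \<in> borel_measurable M" by (simp add: borel_prod[symmetric])
  have ind[measurable]: "(indicator ({0..1} \<times> {0..1}) :: real \<times> real \<Rightarrow> ennreal) \<in> borel_measurable borel"
    by (intro borel_measurable_indicator borel_closed closed_Times) auto
  have AE_L: "(AE p in ?L. R p) \<longleftrightarrow> (AE p in lborel. p \<in> {0..1} \<times> {0..1} \<longrightarrow> R p)" for R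
    by (subst AE_density) (auto simp: indicator_def split: if_splits)
  have AE_ac: "AE x in N'. R x" if "absolutely_continuous N N'" "AE x in N. R x" "sets N = sets N'"
    for N N' :: "(real \<times> real) measure" and R
    using that absolutely_continuous_AE[of N' N R] by simp
  {
    fix Q :: "real \<Rightarrow> real \<Rightarrow> bool"
    assume Q: "{p. Q (fst p) (snd p)} \<in> sets borel" and ae: "AE x in M. Q (v 0 x) (v (Suc 0) x)"
    have "AE p in ?D. Q (fst p) (snd p)" using ae Q by (subst AE_distr_iff) auto
    from AE_ac[OF ac1 this] have "AE p in ?L. Q (fst p) (snd p)" by simp
    then have "AE p in (lborel \<Otimes>\<^sub>M lborel). p \<in> {0..1} \<times> {0..1} \<longrightarrow> Q (fst p) (snd p)"
      unfolding AE_L lborel_prod .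
    from lborel_pair.AE_pair[OF this]
    show "AE a in lborel. AE b in lborel. 0 < a \<and> a < 1 \<and> 0 < b \<and> b < 1 \<longrightarrow> Q a b"
      by (elim eventually_mono) (auto elim!: eventually_mono)
  }
  fix Q :: "real \<Rightarrow> bool"
  assume Q: "{b. Q b} \<in> sets borel" and ae: "AE b in lborel. 0 < b \<and> b < 1 \<longrightarrow> Q b"
  \<comment> \<open>Absolute continuity speaks of the closed square, whereas Q is known on the open
    interval; the endpoints are Lebesgue null.\<close>
  have ne: "AE b in lborel. b \<noteq> (0::real)" "AE b in lborel. b \<noteq> (1::real)" by (rule AE_lborel_singleton)+
  have "AE b in lborel. b \<in> {0..1} \<longrightarrow> Q b"
    using ae ne by eventually_elim auto
  have "AE a in lborel. AE b in lborel. (a :: real, b) \<in> {0..1} \<times> {0..1} \<longrightarrow> Q (snd (a, b))"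
  proof (rule AE_I2)
    fix a :: real
    show "AE b in lborel. (a, b) \<in> {0..1} \<times> {0..1} \<longrightarrow> Q (snd (a, b))"
      using \<open>AE b in lborel. b \<in> {0..1} \<longrightarrow> Q b\<close> by eventually_elim auto
  qed
  moreover have "{x \<in> space (lborel \<Otimes>\<^sub>M lborel). x \<in> {0..1} \<times> {0..1} \<longrightarrow> Q (snd (x :: real \<times> real))} \<in> sets (lborel \<Otimes>\<^sub>M lborel)"
  proof -
    have [measurable]: "Measurable.pred borel Q" using Q by (simp add: pred_def)
    show ?thesis by measurable
  qed
  ultimately have "AE p in lborel \<Otimes>\<^sub>M lborel. p \<in> {0..1} \<times> {0..1} \<longrightarrow> Q (snd (p :: real \<times> real))"
    by (intro lborel_pair.AE_pair_measure)
  then have "AE p in ?L. Q (snd p)" unfolding AE_L lborel_prod .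
  from AE_ac[OF ac2 this] have "AE p in ?D. Q (snd p)" by simp
  then have "AE x in M. Q (snd (v 0 x, v 1 x))" by (rule AE_distrD[OF W])
  then show "AE x in M. Q (v (Suc 0) x)" by simp
qed

section \<open>Mutual independence and the parameters\<close>

lemma prob_cylinder:
  assumes ind: "\<And>n. indep_past n" and B: "\<And>i. B i \<in> sets borel"
  shows "prob {x \<in> space M. \<forall>i<n. v i x \<in> B i} = (\<Prod>i<n. prob {x \<in> space M. v i x \<in> B i})"
proof (induction n)
  case 0
  then show ?case by (simp add: prob_space)
next
  case (Suc n)
  note IH = Suc.IH
  show ?case
  \<comment> \<open>The event on the first n = m + 1 variables belongs to \<open>past m\<close>; for
    n = 0 there is no such past, hence the separate case.\<close>
  proof (cases n)
    case 0
    then show ?thesis by simp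
  next
    case m: (Suc m)
    let ?C = "{x \<in> space M. \<forall>i<n. v i x \<in> B i}"
    have mem: "(\<Inter>i\<in>{..m}. v i -` B i \<inter> space M) \<in> sets (past m)"
      by (intro sets.finite_INT gen_sigma_gen B) auto
    have "(\<Inter>i\<in>{..m}. v i -` B i \<inter> space M) = ?C" using m by auto
    with mem have C: "?C \<in> sets (past m)" by (rule subst[rotated])
    have "prob (?C \<inter> {x \<in> space M. v (Suc m) x \<in> B n}) = prob ?C * prob {x \<in> space M. v (Suc m) x \<in> B n}"
      using ind[of m] B[of n] C unfolding indep_past_def by blast
    moreover have "?C \<inter> {x \<in> space M. v (Suc m) x \<in> B n} = {x \<in> space M. \<forall>i<Suc n. v i x \<in> B i}"
      unfolding m[symmetric] by (auto simp: less_Suc_eq)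
    ultimately have "prob {x \<in> space M. \<forall>i<Suc n. v i x \<in> B i} = prob ?C * prob {x \<in> space M. v n x \<in> B n}"
      unfolding m[symmetric] by (simp only:)
    then show ?thesis unfolding IH by (simp only: prod.lessThan_Suc)
  qed
qed

lemma indep_vars_if_indep_past:
  assumes ind: "\<And>n. indep_past n"
  shows "indep_vars (\<lambda>_. borel) v UNIV"
  unfolding indep_vars_def2 indep_sets_def
proof (intro conjI ballI allI impI)
  fix J :: "nat set" and A assume J: "J \<noteq> {}" "finite J"
    and A: "A \<in> Pi J (\<lambda>i. {v i -` A \<inter> space M |A. A \<in> sets borel})"
  then have "\<forall>j\<in>J. \<exists>B. B \<in> sets borel \<and> A j = v j -` B \<inter> space M" by (auto simp: Pi_iff)
  then obtain B' where B': "\<And>j. j \<in> J \<Longrightarrow> B' j \<in> sets borel \<and> A j = v j -` B' j \<inter> space M" by metis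
  \<comment> \<open>Indices outside J get the full line, which extends J to an initial segment
    without changing the event.\<close>
  define B where "B j = (if j \<in> J then B' j else UNIV)" for j
  have B: "B j \<in> sets borel" for j using B' by (auto simp: B_def)
  define n where "n = Suc (Max J)"
  have Jn: "J \<subseteq> {..<n}" using J by (auto simp: n_def le_imp_less_Suc)
  have AJ: "A j = {x \<in> space M. v j x \<in> B j}" if "j \<in> J" for j using B'[OF that] that by (auto simp: B_def)
  have "(\<Inter>j\<in>J. A j) = {x \<in> space M. \<forall>i<n. v i x \<in> B i}"
  proof -
    have "(\<Inter>j\<in>J. A j) = (\<Inter>j\<in>J. {x \<in> space M. v j x \<in> B j})" using AJ by simp
    also have "\<dots> = {x \<in> space M. \<forall>i<n. v i x \<in> B i}"
      using J Jn by (auto simp: B_def subset_eq)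
    finally show ?thesis .
  qed
  then have "prob (\<Inter>j\<in>J. A j) = (\<Prod>i<n. prob {x \<in> space M. v i x \<in> B i})"
    using prob_cylinder[OF ind B] by simp
  also have "\<dots> = (\<Prod>j\<in>J. prob {x \<in> space M. v j x \<in> B j})"
    using Jn by (intro prod.mono_neutral_right) (auto simp: B_def prob_space)
  also have "\<dots> = (\<Prod>j\<in>J. prob (A j))" using AJ by simp
  finally show "prob (\<Inter>j\<in>J. A j) = (\<Prod>j\<in>J. prob (A j))" .
qed (auto intro: measurable_sets)

lemma beta_if_sb_invariant:
  assumes inv: "sb_invariant M w" and ind1: "indep_past (Suc 0)"
  shows "\<exists>\<sigma> \<theta>. 0 \<le> \<sigma> \<and> \<sigma> < 1 \<and> \<theta> > - \<sigma> \<and> indep_vars (\<lambda>_. borel) v UNIV \<and>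
    (\<forall>j. law j = beta_measure (1 - \<sigma>) (\<theta> + real (Suc j) * \<sigma>))"
proof -
  have ind0: "indep_past 0" by (rule indep_past_0[OF inv ind1])
  have "\<not> (\<exists>c. AE a in law 0. a = c)"
  proof
    assume "\<exists>c. AE a in law 0. a = c"
    then obtain c where "AE a in law 0. a = c" by blast
    then have "AE x in M. v 0 x = c" by (rule AE_distrD[rotated]) simp
    then show False by (rule not_Dirac[OF inv])
  qed
  then obtain p q where p: "p > 0" and q: "q > 0" and law0: "law 0 = beta_measure p q"
    using tilt_sym_left_cases[OF unit_law_law unit_law_law tilt_sym_law[OF inv ind0]] by blast
  \<comment> \<open>Each step from n to n + 1 keeps the first beta parameter p and adds 1 - p to the
    second.\<close>
  define Q where "Q n = q + real n * (1 - p)" for n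
  have next_law: "Q (Suc n) > 0 \<and> law (Suc n) = beta_measure p (Q (Suc n))"
    if "indep_past n" "Q n > 0" "law n = beta_measure p (Q n)" for n
  proof -
    have "Q n + 1 - p = Q (Suc n)" by (simp add: Q_def algebra_simps)
    moreover have "tilt_sym (beta_measure p (Q n)) (law (Suc n))"
      using tilt_sym_law[OF inv that(1)] that(3) by simp
    ultimately show ?thesis
      using tilt_sym_beta_right[OF p that(2) unit_law_law] by metis
  qed
  have step: "indep_past n \<and> Q n > 0 \<and> law n = beta_measure p (Q n)" for n
  proof (induction n)
    case 0
    then show ?case using ind0 q law0 by (simp add: Q_def)
  next
    case (Suc n)
    with next_law have nx: "Q (Suc n) > 0" "law (Suc n) = beta_measure p (Q (Suc n))" by blast+
    moreover have "indep_past (Suc n)"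
      by (rule indep_past_if_beta[OF inv _ p _ p nx(1) _ nx(2), of "Q n"]) (use Suc in auto)
    ultimately show ?case by blast
  qed
  \<comment> \<open>If p exceeded 1, the second parameters would eventually be negative.\<close>
  have p1: "p \<le> 1"
  proof (rule ccontr)
    assume "\<not> p \<le> 1"
    then have "p - 1 > 0" by simp
    then obtain n :: nat where "q < real n * (p - 1)" using reals_Archimedean3 by blast
    then have "Q n < 0" by (simp add: Q_def algebra_simps)
    with step[of n] show False by simp
  qed
  show ?thesis
  proof (intro exI conjI allI)
    \<comment> \<open>The witnesses are \<sigma> = 1 - p and \<theta> = q - \<sigma>; the shift by
      \<sigma> compensates for the factor \<open>Suc j\<close> in the law of v j.\<close>
    show "0 \<le> 1 - p" "1 - p < 1" "- (1 - p) < q - (1 - p)" using p p1 q by auto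
    show "indep_vars (\<lambda>_. borel) v UNIV" by (rule indep_vars_if_indep_past) (use step in blast)
    fix j
    have "q - (1 - p) + real (Suc j) * (1 - p) = Q j" by (simp add: Q_def algebra_simps)
    then show "law j = beta_measure (1 - (1 - p)) (q - (1 - p) + real (Suc j) * (1 - p))"
      using step[of j] by simp
  qed
qed

end

section \<open>Invariance of independent beta laws\<close>

text \<open>In the coordinates x = a, y = (1 - a) b the tilted product density is proportional to
  x powr (p - 1) * y powr (p - 1) * (1 - x - y) powr (q - p), which is symmetric in x and y.\<close>

lemma tilt_sym_beta:
  assumes p: "p > 0" and q: "q > 0" and pq: "q + 1 - p > 0"
  shows "tilt_sym (beta_measure p q) (beta_measure p (q + 1 - p))"
proof -
  define K where "K = 1 / (Beta p q * Beta p (q + 1 - p))"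
  define D :: "real \<Rightarrow> real \<Rightarrow> real" where
    "D x y = (if 0 < x \<and> 0 < y \<and> x + y < 1 then K * x powr (p - 1) * y powr (p - 1) * (1 - x - y) powr (q - p) else 0)" for x y
  have K: "K > 0" using Beta_real_pos[OF p q] Beta_real_pos[OF p pq] by (simp add: K_def)
  have D_sym: "D x y = D y x" for x y by (auto simp: D_def algebra_simps)
  have [measurable]: "case_prod D \<in> borel_measurable (borel \<Otimes>\<^sub>M borel)"
    unfolding D_def[abs_def] by measurable
  have val: "(\<integral>\<^sup>+ a. \<integral>\<^sup>+ b. ennreal (1 - a) * f (a, b) \<partial>beta_measure p (q + 1 - p) \<partial>beta_measure p q)
    = (\<integral>\<^sup>+ x. \<integral>\<^sup>+ y. ennreal (D x y) * f (x, y / (1 - x)) \<partial>lborel \<partial>lborel)"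
    if [measurable]: "f \<in> borel_measurable (borel \<Otimes>\<^sub>M borel)" for f :: "real \<times> real \<Rightarrow> ennreal"
  proof -
    have "(\<integral>\<^sup>+ a. \<integral>\<^sup>+ b. ennreal (1 - a) * f (a, b) \<partial>beta_measure p (q + 1 - p) \<partial>beta_measure p q)
      = (\<integral>\<^sup>+ a. ennreal (beta_density p q a) * (\<integral>\<^sup>+ b. ennreal (beta_density p (q + 1 - p) b) * (ennreal (1 - a) * f (a, b)) \<partial>lborel) \<partial>lborel)"
    proof -
      have "(\<integral>\<^sup>+ b. ennreal (1 - a) * f (a, b) \<partial>beta_measure p (q + 1 - p))
        = (\<integral>\<^sup>+ b. ennreal (beta_density p (q + 1 - p) b) * (ennreal (1 - a) * f (a, b)) \<partial>lborel)" for a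
        unfolding beta_measure_def by (rule nn_integral_density) measurable
      then show ?thesis
        unfolding beta_measure_def[of p q] by (simp only:) (rule nn_integral_density, measurable)
    qed
    also have "\<dots> = (\<integral>\<^sup>+ x. \<integral>\<^sup>+ y. ennreal (D x y) * f (x, y / (1 - x)) \<partial>lborel \<partial>lborel)"
    proof (rule nn_integral_cong)
      fix x :: real
      show "ennreal (beta_density p q x) * (\<integral>\<^sup>+ b. ennreal (beta_density p (q + 1 - p) b) * (ennreal (1 - x) * f (x, b)) \<partial>lborel)
        = (\<integral>\<^sup>+ y. ennreal (D x y) * f (x, y / (1 - x)) \<partial>lborel)"
      proof (cases "0 < x \<and> x < 1")
        case False
        then have "D x y = 0" for y by (auto simp: D_def)
        moreover have "beta_density p q x = 0" using False by (auto simp: beta_density_def)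
        ultimately show ?thesis by simp
      next
        case True
        \<comment> \<open>The substitution b = y / (1 - x) has Jacobian 1 / (1 - x), which cancels
          the tilt 1 - x.\<close>
        let ?c = "1 / (1 - x)"
        have c: "?c > 0" using True by simp
        have "(\<integral>\<^sup>+ b. ennreal (beta_density p (q + 1 - p) b) * (ennreal (1 - x) * f (x, b)) \<partial>lborel)
          = ennreal ?c * (\<integral>\<^sup>+ y. ennreal (beta_density p (q + 1 - p) (?c * y)) * (ennreal (1 - x) * f (x, ?c * y)) \<partial>lborel)"
        proof -
          have "(\<lambda>b. ennreal (beta_density p (q + 1 - p) b) * (ennreal (1 - x) * f (x, b))) \<in> borel_measurable borel"
            by measurable
          from nn_integral_real_affine[OF this, of ?c 0] c show ?thesis by (simp add: abs_of_pos)
        qed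
        also have "\<dots> = (\<integral>\<^sup>+ y. ennreal ?c * (ennreal (beta_density p (q + 1 - p) (?c * y)) * (ennreal (1 - x) * f (x, ?c * y))) \<partial>lborel)"
          by (rule nn_integral_cmult[symmetric]) measurable
        finally have "ennreal (beta_density p q x) * (\<integral>\<^sup>+ b. ennreal (beta_density p (q + 1 - p) b) * (ennreal (1 - x) * f (x, b)) \<partial>lborel)
          = (\<integral>\<^sup>+ y. ennreal (beta_density p q x) * (ennreal ?c * (ennreal (beta_density p (q + 1 - p) (?c * y)) * (ennreal (1 - x) * f (x, ?c * y)))) \<partial>lborel)"
          by (simp only:) (rule nn_integral_cmult[symmetric], measurable)
        also have "\<dots> = (\<integral>\<^sup>+ y. ennreal (D x y) * f (x, y / (1 - x)) \<partial>lborel)"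
        proof (rule nn_integral_cong)
          fix y :: real
          have dens: "beta_density p q x * (?c * (beta_density p (q + 1 - p) (?c * y) * (1 - x))) = D x y"
          proof (cases "0 < y \<and> x + y < 1")
            case False
            then have "\<not> (0 < ?c * y \<and> ?c * y < 1)" using True by (auto simp: zero_less_divide_iff)
            then show ?thesis using False by (auto simp: beta_density_def D_def)
          next
            case T2: True
            \<comment> \<open>With r = 1 - x, the power q - 1 of r from the first density cancels
              against the powers p - 1 and q - p that the rescaled second density puts in the
              denominator.\<close>
            define r where "r = 1 - x"
            have r: "r > 0" using True by (simp add: r_def)
            have yr: "0 < y / r" "y / r < 1" using T2 r by (auto simp: r_def)
            have "1 - y / r = (1 - x - y) / r" using r by (simp add: r_def field_simps)
            moreover have "r powr (q - 1) = r powr (p - 1) * r powr (q - p)"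
              by (simp add: powr_add[symmetric])
            ultimately show ?thesis
              using True T2 r yr unfolding beta_density_def D_def K_def r_def[symmetric]
              by (simp add: powr_divide r_def[symmetric])
          qed
          have nn: "beta_density p q x \<ge> 0" "beta_density p (q + 1 - p) (?c * y) \<ge> 0" "?c \<ge> 0" "1 - x \<ge> 0"
            using True by (auto intro!: beta_density_nonneg p q pq)
          have "ennreal (D x y) = ennreal (beta_density p q x) * (ennreal ?c * (ennreal (beta_density p (q + 1 - p) (?c * y)) * ennreal (1 - x)))"
            unfolding dens[symmetric] using nn by (simp only: ennreal_mult mult_nonneg_nonneg)
          then show "ennreal (beta_density p q x) * (ennreal ?c * (ennreal (beta_density p (q + 1 - p) (?c * y)) * (ennreal (1 - x) * f (x, ?c * y))))
            = ennreal (D x y) * f (x, y / (1 - x))"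
            by (simp add: mult.assoc)
        qed
        finally show ?thesis .
      qed
    qed
    finally show ?thesis .
  qed
  show ?thesis
    unfolding tilt_sym_def
  proof (intro allI impI)
    fix f :: "real \<times> real \<Rightarrow> ennreal" assume "f \<in> borel_measurable borel"
    then have [measurable]: "f \<in> borel_measurable (borel \<Otimes>\<^sub>M borel)" by (simp add: borel_prod)
    have "(\<lambda>p. f ((1 - fst p) * snd p, fst p / (1 - (1 - fst p) * snd p))) \<in> borel_measurable (borel \<Otimes>\<^sub>M borel)"
      by measurable
    from val[OF this]
    have "(\<integral>\<^sup>+ a. \<integral>\<^sup>+ b. ennreal (1 - a) * f ((1 - a) * b, a / (1 - (1 - a) * b)) \<partial>beta_measure p (q + 1 - p) \<partial>beta_measure p q)
      = (\<integral>\<^sup>+ x. \<integral>\<^sup>+ y. ennreal (D x y) * f ((1 - x) * (y / (1 - x)), x / (1 - (1 - x) * (y / (1 - x)))) \<partial>lborel \<partial>lborel)"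
      by simp
    also have "\<dots> = (\<integral>\<^sup>+ x. \<integral>\<^sup>+ y. ennreal (D x y) * f (y, x / (1 - y)) \<partial>lborel \<partial>lborel)"
    proof (intro nn_integral_cong)
      fix x y :: real
      show "ennreal (D x y) * f ((1 - x) * (y / (1 - x)), x / (1 - (1 - x) * (y / (1 - x))))
        = ennreal (D x y) * f (y, x / (1 - y))"
        by (cases "x = 1") (auto simp: D_def)
    qed
    \<comment> \<open>Fubini interchanges the two coordinates, and the symmetry of \<open>D\<close>
      restores the original integral.\<close>
    also have "\<dots> = (\<integral>\<^sup>+ y. \<integral>\<^sup>+ x. ennreal (D x y) * f (y, x / (1 - y)) \<partial>lborel \<partial>lborel)"
      by (rule lborel_pair.Fubini'[symmetric]) measurable
    also have "\<dots> = (\<integral>\<^sup>+ x. \<integral>\<^sup>+ y. ennreal (D x y) * f (x, y / (1 - x)) \<partial>lborel \<partial>lborel)"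
      by (intro nn_integral_cong) (simp add: D_sym)
    also have "\<dots> = (\<integral>\<^sup>+ a. \<integral>\<^sup>+ b. ennreal (1 - a) * f (a, b) \<partial>beta_measure p (q + 1 - p) \<partial>beta_measure p q)"
      by (rule val[symmetric]) measurable
    finally show "(\<integral>\<^sup>+ a. \<integral>\<^sup>+ b. ennreal (1 - a) * f (a, b) \<partial>beta_measure p (q + 1 - p) \<partial>beta_measure p q)
      = (\<integral>\<^sup>+ a. \<integral>\<^sup>+ b. ennreal (1 - a) * f ((1 - a) * b, a / (1 - (1 - a) * b)) \<partial>beta_measure p (q + 1 - p) \<partial>beta_measure p q)" by simp
  qed
qed

section \<open>Size-biased picks as compositions of adjacent exchanges\<close>

abbreviation seqM :: "(nat \<Rightarrow> real) measure" where "seqM \<equiv> PiM UNIV (\<lambda>_. borel)"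

abbreviation swap :: "nat \<Rightarrow> nat \<Rightarrow> nat" where "swap n \<equiv> Transposition.transpose n (Suc n)"

text \<open>The products of 1 - u agree before and after the exchange at every cut except the one
  between positions n and n + 1.\<close>

lemma stick_vswap:
  fixes u :: "nat \<Rightarrow> real"
  assumes "0 < u n" "u n < 1" "0 < u (Suc n)" "u (Suc n) < 1"
  shows "vswap n u j * (\<Prod>i<j. 1 - vswap n u i) = u (swap n j) * (\<Prod>i<swap n j. 1 - u i)"
proof -
  have "(1 - u n) * u (Suc n) < 1 * 1" using assms by (intro mult_strict_mono) auto
  then have ne: "1 - (1 - u n) * u (Suc n) \<noteq> 0" by simp
  have low: "(\<Prod>i<j. 1 - vswap n u i) = (\<Prod>i<j. 1 - u i)" if "j \<le> n" for j
    using that by (intro prod.cong) (auto simp: vswap_def)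
  have pr: "(1 - (1 - u n) * u (Suc n)) * (1 - u n / (1 - (1 - u n) * u (Suc n))) = (1 - u n) * (1 - u (Suc n))"
    using ne by (simp add: right_diff_distrib)
  have high: "(\<Prod>i<Suc (Suc n) + k. 1 - vswap n u i) = (\<Prod>i<Suc (Suc n) + k. 1 - u i)" for k
  proof (induction k)
    case 0
    have "(\<Prod>i<Suc (Suc n). 1 - vswap n u i) = (\<Prod>i<n. 1 - u i) * ((1 - (1 - u n) * u (Suc n)) * (1 - u n / (1 - (1 - u n) * u (Suc n))))"
      by (simp add: low[OF order_refl]) (simp add: vswap_def)
    also have "\<dots> = (\<Prod>i<Suc (Suc n). 1 - u i)" unfolding pr by simp
    finally show ?case by simp
  next
    case (Suc k)
    then show ?case by (simp add: vswap_def)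
  qed
  consider "j < n" | "j = n" | "j = Suc n" | k where "j = Suc (Suc n) + k"
    by (metis less_iff_Suc_add linorder_neqE_nat add_Suc add_Suc_right le_iff_add Suc_leI not_less_eq)
  then show ?thesis
  proof cases
    case 1
    then show ?thesis by (simp add: Transposition.transpose_def low vswap_def)
  next
    case 2
    then show ?thesis by (simp add: low) (simp add: vswap_def mult_ac)
  next
    case 3
    have "(\<Prod>i<Suc n. 1 - vswap n u i) = (\<Prod>i<n. 1 - u i) * (1 - (1 - u n) * u (Suc n))"
      by (simp add: low) (simp add: vswap_def)
    then show ?thesis using 3 ne by (simp add: vswap_def)
  next
    case 4
    then show ?thesis using high[of k] by (simp add: Transposition.transpose_def) (simp add: vswap_def)
  qed
qed

definition good_weights :: "(nat \<Rightarrow> real) \<Rightarrow> bool" where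
  "good_weights u \<longleftrightarrow> (\<forall>j. u j > 0) \<and> u sums 1"

text \<open>Positive terms sum unconditionally, so any rearrangement keeps the sum 1.\<close>

lemma good_weights_bij:
  assumes u: "good_weights u" and \<pi>: "bij \<pi>"
  shows "good_weights (u \<circ> \<pi>)"
proof -
  have "(u has_sum 1) UNIV"
    using u by (intro norm_summable_imp_has_sum) (auto simp: good_weights_def less_imp_le sums_iff)
  then have "((\<lambda>x. u (\<pi> x)) has_sum 1) UNIV" using has_sum_reindex_bij_betw[OF \<pi>] by metis
  then have "(\<lambda>x. u (\<pi> x)) sums 1" by (rule has_sum_imp_sums)
  with u show ?thesis by (simp add: good_weights_def comp_def)
qed

text \<open>cyc p k moves the entry at position p + k to position p and keeps the order of the others.\<close>

fun cyc :: "nat \<Rightarrow> nat \<Rightarrow> nat \<Rightarrow> nat" where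
  "cyc p 0 = id"
| "cyc p (Suc k) = swap (p + k) \<circ> cyc p k"

lemma bij_cyc: "bij (cyc p k)"
proof (induction k)
  case (Suc k)
  then show ?case unfolding cyc.simps by (rule bij_comp) simp
qed (simp only: cyc.simps bij_id)

lemma cyc_at: "cyc p k p = p + k"
  by (induction k) auto

lemma cyc_below: "i < p \<Longrightarrow> cyc p k i = i"
  by (induction k) (auto simp: Transposition.transpose_def)

text \<open>One size-biased pick among the positions from p on, averaged over the picked position p
  + k: the picked weight is moved to position p before F is applied, and its probability is
  renormalised by the mass beyond the first p weights.\<close>

definition pick :: "nat \<Rightarrow> ((nat \<Rightarrow> real) \<Rightarrow> ennreal) \<Rightarrow> (nat \<Rightarrow> real) \<Rightarrow> ennreal" where
  "pick p F u = (\<Sum>k. ennreal (u (p + k) / (1 - (\<Sum>l<p. u l))) * F (u \<circ> cyc p k))"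

lemma good_weights_sum_less: "good_weights u \<Longrightarrow> finite S \<Longrightarrow> (\<Sum>i\<in>S. u i) < 1"
  by (rule sum_less_1_if_sums) (auto simp: good_weights_def)

lemma pick_le_1:
  assumes u: "good_weights u" and F: "\<And>u. good_weights u \<Longrightarrow> F u \<le> 1"
  shows "pick p F u \<le> 1"
proof -
  let ?r = "1 - (\<Sum>l<p. u l)"
  have r: "?r > 0" using good_weights_sum_less[OF u, of "{..<p}"] by simp
  have nn: "u (p + k) / ?r \<ge> 0" for k using r u by (auto simp: good_weights_def less_imp_le)
  have "(\<lambda>k. u (p + k)) sums ?r"
    using sums_split_initial_segment[of u 1 p] u by (simp add: good_weights_def add.commute)
  then have s: "(\<lambda>k. u (p + k) / ?r) sums (?r / ?r)" by (rule sums_divide)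
  have "pick p F u \<le> (\<Sum>k. ennreal (u (p + k) / ?r) * 1)"
    unfolding pick_def
    by (intro suminf_le mult_left_mono F good_weights_bij u bij_cyc) auto
  also have "\<dots> = ennreal (?r / ?r)"
    using s nn by (simp add: suminf_ennreal2 sums_iff)
  also have "\<dots> = 1" using r by simp
  finally show ?thesis .
qed

lemma measurable_comp_seqM[measurable]: "(\<lambda>u. u \<circ> \<pi>) \<in> seqM \<rightarrow>\<^sub>M seqM"
  unfolding comp_def by (rule measurable_abs_UNIV) simp

lemma pick_measurable:
  assumes F: "F \<in> borel_measurable seqM"
  shows "pick p F \<in> borel_measurable seqM"
proof -
  have [measurable]: "(\<lambda>u. F (u \<circ> cyc p k)) \<in> borel_measurable seqM" for k
    by (rule measurable_compose[OF measurable_comp_seqM F])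
  have [measurable]: "(\<lambda>u. u l) \<in> borel_measurable seqM" for l :: nat by simp
  show ?thesis unfolding pick_def[abs_def] by measurable
qed

text \<open>For a list rs of distinct indices, listed in reverse order of selection, picked rs is a
  permutation starting with the selected indices and followed by the remaining ones.\<close>

fun picked :: "nat list \<Rightarrow> nat \<Rightarrow> nat" where
  "picked [] = id"
| "picked (j # rs) = picked rs \<circ> cyc (length rs) (inv (picked rs) j - length rs)"

lemma bij_picked: "bij (picked rs)"
proof (induction rs)
  case (Cons j rs)
  show ?case unfolding picked.simps by (rule bij_comp[OF bij_cyc Cons.IH])
qed (simp only: picked.simps bij_id)

lemma picked_nth: "distinct rs \<Longrightarrow> i < length rs \<Longrightarrow> picked rs i = rev rs ! i"
proof (induction rs arbitrary: i)
  case (Cons j rs)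
  show ?case
  proof (cases "i < length rs")
    case True
    then show ?thesis using Cons by (simp add: cyc_below nth_append)
  next
    case False
    then have i: "i = length rs" using Cons.prems by simp
    have eq: "picked rs (inv (picked rs) j) = j" by (rule surj_f_inv_f[OF bij_is_surj[OF bij_picked]])
    \<comment> \<open>An index not yet selected sits at or after position \<open>length rs\<close>,
      so the truncated subtraction in \<open>picked\<close> is exact.\<close>
    have "inv (picked rs) j \<ge> length rs"
    proof (rule ccontr)
      assume "\<not> ?thesis"
      then have "picked rs (inv (picked rs) j) \<in> set rs"
        using Cons by (metis distinct.simps(2) length_rev linorder_not_le nth_mem set_rev)
      with Cons.prems eq show False by simp
    qed
    then show ?thesis using eq by (simp add: i cyc_at nth_append)
  qed
qed simp

lemma picked_image: "distinct rs \<Longrightarrow> picked rs ` {..<length rs} = set rs"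
  using picked_nth[of rs] by (auto simp: in_set_conv_nth image_iff rev_nth[symmetric])
    (metis in_set_conv_nth length_rev set_rev lessThan_iff)+

text \<open>Extending a selection by a new index amounts to choosing its offset k among the
  positions not yet used; this converts sums over longer selections into iterated sums over
  k.\<close>

lemma bij_betw_picked_Cons:
  "bij_betw (\<lambda>(rs, k). picked rs (p + k) # rs) ({rs. length rs = p \<and> distinct rs} \<times> UNIV)
     {rs. length rs = Suc p \<and> distinct rs}"
proof (rule bij_betw_byWitness[where f' = "\<lambda>rs. (tl rs, inv (picked (tl rs)) (hd rs) - p)"])
  show "\<forall>a\<in>{rs. length rs = p \<and> distinct rs} \<times> UNIV.
      (\<lambda>rs. (tl rs, inv (picked (tl rs)) (hd rs) - p)) ((\<lambda>(rs, k). picked rs (p + k) # rs) a) = a"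
    using bij_picked by (auto simp: bij_is_inj)
  show "\<forall>a'\<in>{rs. length rs = Suc p \<and> distinct rs}.
      (\<lambda>(rs, k). picked rs (p + k) # rs) ((\<lambda>rs. (tl rs, inv (picked (tl rs)) (hd rs) - p)) a') = a'"
  proof
    fix a :: "nat list" assume "a \<in> {rs. length rs = Suc p \<and> distinct rs}"
    then obtain j rs where a: "a = j # rs" "length rs = p" "j \<notin> set rs" "distinct rs" by (cases a) auto
    have eq: "picked rs (inv (picked rs) j) = j" by (rule surj_f_inv_f[OF bij_is_surj[OF bij_picked]])
    have "inv (picked rs) j \<ge> p"
    proof (rule ccontr)
      assume "\<not> ?thesis"
      then have "picked rs (inv (picked rs) j) \<in> set rs" using a picked_image[OF a(4)] by auto
      with a eq show False by simp
    qed
    then show "(\<lambda>(rs, k). picked rs (p + k) # rs) ((\<lambda>rs. (tl rs, inv (picked (tl rs)) (hd rs) - p)) a) = a"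
      using a eq by simp
  qed
  show "(\<lambda>(rs, k). picked rs (p + k) # rs) ` ({rs. length rs = p \<and> distinct rs} \<times> UNIV)
      \<subseteq> {rs. length rs = Suc p \<and> distinct rs}"
  proof safe
    fix rs :: "nat list" and k assume rs: "distinct rs" "p = length rs"
    show "distinct (picked rs (length rs + k) # rs)"
    proof -
      have "picked rs (length rs + k) \<notin> picked rs ` {..<length rs}"
        using bij_is_inj[OF bij_picked] by (auto simp: inj_image_mem_iff dest: injD)
      then show ?thesis using rs picked_image[OF rs(1)] by simp
    qed
  qed auto
qed (auto simp: distinct_tl)

context stick_breaking
begin

lemma good_weights_AE: "AE x in M. good_weights (\<lambda>j. w j x)"
  using weights_AE by eventually_elim (simp add: good_weights_def)

context
  assumes swap: "\<And>n F. F \<in> borel_measurable seqM \<Longrightarrow>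
    (\<integral>\<^sup>+ x. ennreal (1 - (\<Sum>l<Suc n. w l x)) * F (\<lambda>j. w j x) \<partial>M)
    = (\<integral>\<^sup>+ x. ennreal (1 - (\<Sum>l<Suc n. w l x)) * F (\<lambda>j. w (swap n j) x) \<partial>M)"
begin

text \<open>The mass from position p + k on splits into w (p + k) and the mass after it. The first
  part is the k-th term of the pick; in the second, positions p + k and p + k + 1 may be exchanged,
  which gives the same expression for k + 1. The remainder \<open>e N\<close> tends to 0, so the
  terms sum to \<open>e 0\<close>.\<close>

lemma nn_integral_pick:
  assumes F[measurable]: "F \<in> borel_measurable seqM" and F1: "\<And>u. good_weights u \<Longrightarrow> F u \<le> 1"
  shows "(\<integral>\<^sup>+ x. pick p F (\<lambda>j. w j x) \<partial>M) = (\<integral>\<^sup>+ x. F (\<lambda>j. w j x) \<partial>M)"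
proof -
  define R where "R i x = 1 - (\<Sum>l<i. w l x)" for i x
  have [measurable]: "R i \<in> borel_measurable M" for i unfolding R_def[abs_def] by measurable
  let ?F = "\<lambda>k x. F (\<lambda>j. w (cyc p k j) x)"
  have Fm[measurable]: "?F k \<in> borel_measurable M" for k
    by (rule measurable_compose[OF _ F]) (rule measurable_abs_UNIV, simp)
  define e where "e k = (\<integral>\<^sup>+ x. ennreal (R (p + k) x / R p x) * ?F k x \<partial>M)" for k
  define a where "a k = (\<integral>\<^sup>+ x. ennreal (w (p + k) x / R p x) * ?F k x \<partial>M)" for k
  have Rpos: "AE x in M. \<forall>i. R i x > 0"
    using good_weights_AE
  proof eventually_elim
    case (elim x)
    show ?case using good_weights_sum_less[OF elim, of "{..<i}" for i] by (simp add: R_def)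
  qed
  have step: "e k = a k + e (Suc k)" for k
  proof -
    let ?n = "p + k"
    let ?s = "\<lambda>u :: nat \<Rightarrow> real. 1 - (\<Sum>l<p. u l)"
    let ?G = "\<lambda>u. ennreal (1 / ?s u) * F (u \<circ> cyc p k)"
    have comp: "(\<lambda>u. u l) \<in> borel_measurable seqM" for l :: nat by simp
    have [measurable]: "?s \<in> borel_measurable seqM"
      by (intro borel_measurable_diff borel_measurable_sum comp) auto
    have "?G \<in> borel_measurable seqM" by measurable
    \<comment> \<open>The mass remaining after position p + k is exactly the weight under which this
      exchange is allowed, and composing the exchange with \<open>cyc p k\<close> gives
      \<open>cyc p (Suc k)\<close>.\<close>
    from swap[OF this, of ?n]
    have sw: "(\<integral>\<^sup>+ x. ennreal (R (Suc ?n) x) * (ennreal (1 / R p x) * ?F k x) \<partial>M)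
      = (\<integral>\<^sup>+ x. ennreal (R (Suc ?n) x) * (ennreal (1 / ?s (\<lambda>j. w (swap ?n j) x)) * ?F (Suc k) x) \<partial>M)"
      by (simp add: R_def comp_def)
    have s_swap: "?s (\<lambda>j. w (swap ?n j) x) = R p x" for x
      unfolding R_def by (intro arg_cong2[where f = "(-)"] refl sum.cong) (auto simp: Transposition.transpose_def)
    have "e k = (\<integral>\<^sup>+ x. ennreal (w ?n x / R p x) * ?F k x + ennreal (R (Suc ?n) x) * (ennreal (1 / R p x) * ?F k x) \<partial>M)"
      unfolding e_def
    proof (rule nn_integral_cong_AE, use Rpos good_weights_AE in eventually_elim)
      case (elim x)
      have w0: "w ?n x > 0" using elim by (simp add: good_weights_def)
      have Rp: "R p x > 0" "R (Suc ?n) x > 0" using elim by auto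
      have "R ?n x / R p x = w ?n x / R p x + R (Suc ?n) x * (1 / R p x)"
        by (simp add: R_def add_divide_distrib[symmetric])
      then have "ennreal (R ?n x / R p x) = ennreal (w ?n x / R p x) + ennreal (R (Suc ?n) x) * ennreal (1 / R p x)"
        using w0 Rp by (simp only: ennreal_plus[symmetric] ennreal_mult[symmetric] divide_nonneg_nonneg less_imp_le
            mult_nonneg_nonneg zero_le_one)
      then show ?case by (simp add: distrib_right mult.assoc)
    qed
    also have "\<dots> = a k + (\<integral>\<^sup>+ x. ennreal (R (Suc ?n) x) * (ennreal (1 / R p x) * ?F k x) \<partial>M)"
      unfolding a_def by (rule nn_integral_add) measurable
    also have "(\<integral>\<^sup>+ x. ennreal (R (Suc ?n) x) * (ennreal (1 / R p x) * ?F k x) \<partial>M)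
      = (\<integral>\<^sup>+ x. ennreal (R (Suc ?n) x) * (ennreal (1 / R p x) * ?F (Suc k) x) \<partial>M)"
      unfolding sw s_swap ..
    also have "\<dots> = e (Suc k)"
      unfolding e_def
    proof (rule nn_integral_cong_AE, use Rpos in eventually_elim)
      case (elim x)
      have "ennreal (R (p + Suc k) x / R p x) = ennreal (R (Suc ?n) x) * ennreal (1 / R p x)"
        using elim by (simp add: ennreal_mult[symmetric] less_imp_le)
      then show ?case by (simp add: mult.assoc)
    qed
    finally show ?thesis .
  qed
  have partial: "e 0 = (\<Sum>k<N. a k) + e N" for N
  proof (induction N)
    case (Suc N)
    then show ?case using step[of N] by (simp add: add.assoc)
  qed simp
  \<comment> \<open>The integrand is bounded by 1 and carries a remaining mass that tends to
    0.\<close>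
  have "e \<longlonglongrightarrow> (\<integral>\<^sup>+ x. 0 \<partial>M)"
    unfolding e_def
  proof (rule nn_integral_dominated_convergence[where w = "\<lambda>_. 1"])
    show "AE x in M. ennreal (R (p + k) x / R p x) * ?F k x \<le> 1" for k
      using Rpos good_weights_AE
    proof eventually_elim
      case (elim x)
      have "R (p + k) x \<le> R p x"
        unfolding R_def using elim(2)
        by (auto intro!: sum_mono2 simp: good_weights_def less_imp_le)
      then have "R (p + k) x / R p x \<le> 1" using elim by simp
      then have "ennreal (R (p + k) x / R p x) * ?F k x \<le> 1 * 1"
        using F1[OF good_weights_bij[OF elim(2) bij_cyc, of p k]]
        by (intro mult_mono) (auto simp: comp_def ennreal_le_1)
      then show ?case by simp
    qed
    show "AE x in M. (\<lambda>k. ennreal (R (p + k) x / R p x) * ?F k x) \<longlonglongrightarrow> 0"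
      using Rpos good_weights_AE
    proof eventually_elim
      case (elim x)
      have "(\<lambda>k. \<Sum>l<k. w l x) \<longlonglongrightarrow> 1" using elim(2) by (simp add: good_weights_def sums_def)
      then have "(\<lambda>k. R k x) \<longlonglongrightarrow> 1 - 1" unfolding R_def by (intro tendsto_intros)
      then have "(\<lambda>k. R k x / R p x) \<longlonglongrightarrow> (1 - 1) / R p x"
        using elim by (intro tendsto_intros) (auto dest: spec[of _ p])
      then have "(\<lambda>k. R (p + k) x / R p x) \<longlonglongrightarrow> 0"
        using LIMSEQ_ignore_initial_segment[of "\<lambda>k. R k x / R p x" 0 p] by (simp add: add.commute)
      then have lim: "(\<lambda>k. ennreal (R (p + k) x / R p x)) \<longlonglongrightarrow> 0"
        using tendsto_ennrealI[of _ 0] by simp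
      show ?case
      proof (rule tendsto_sandwich[OF _ _ tendsto_const lim])
        show "\<forall>\<^sub>F k in sequentially. ennreal (R (p + k) x / R p x) * ?F k x \<le> ennreal (R (p + k) x / R p x)"
        proof (intro always_eventually allI)
          fix k
          show "ennreal (R (p + k) x / R p x) * ?F k x \<le> ennreal (R (p + k) x / R p x)"
            using mult_left_mono[OF F1[OF good_weights_bij[OF elim(2) bij_cyc, of p k]], of "ennreal (R (p + k) x / R p x)"]
            by (simp add: comp_def)
        qed
      qed simp
    qed
    show "(\<integral>\<^sup>+ x. 1 \<partial>M) < \<infinity>" by (simp add: emeasure_space_1)
  qed measurable
  then have e0: "e \<longlonglongrightarrow> 0" by simp
  have "(\<lambda>N. \<Sum>k<N. a k) \<longlonglongrightarrow> (\<Sum>k. a k)" by (rule summable_LIMSEQ) simp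
  then have "(\<lambda>N. (\<Sum>k<N. a k) + e N) \<longlonglongrightarrow> (\<Sum>k. a k) + 0" by (intro tendsto_add e0)
  then have "(\<lambda>N::nat. e 0) \<longlonglongrightarrow> (\<Sum>k. a k)" by (simp add: partial[symmetric])
  then have "(\<Sum>k. a k) = e 0" by (simp add: LIMSEQ_const_iff)
  moreover have "(\<Sum>k. a k) = (\<integral>\<^sup>+ x. pick p F (\<lambda>j. w j x) \<partial>M)"
    unfolding a_def by (subst nn_integral_suminf[symmetric]) (auto simp: pick_def R_def comp_def)
  moreover have "e 0 = (\<integral>\<^sup>+ x. F (\<lambda>j. w j x) \<partial>M)"
    unfolding e_def by (rule nn_integral_cong_AE, use Rpos in eventually_elim) (auto dest: spec[of _ p])
  ultimately show ?thesis by simp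
qed

text \<open>Induction on the number of picks. Summing over the last pick replaces F by
  \<open>pick p F\<close>, evaluated after the earlier picks; the induction hypothesis removes
  those, and \<open>nn_integral_pick\<close> removes the last.\<close>

lemma nn_integral_picked:
  assumes F: "F \<in> borel_measurable seqM" "\<And>u. good_weights u \<Longrightarrow> F u \<le> 1"
  shows "(\<integral>\<^sup>+ x. (\<integral>\<^sup>+ rs. ennreal (sb_prob_rev (\<lambda>j. w j x) rs) * F ((\<lambda>j. w j x) \<circ> picked rs)
      \<partial>count_space {rs. length rs = p \<and> distinct rs}) \<partial>M) = (\<integral>\<^sup>+ x. F (\<lambda>j. w j x) \<partial>M)"
  using F
proof (induction p arbitrary: F)
  case 0
  have "{rs :: nat list. length rs = 0 \<and> distinct rs} = {[]}" by auto
  then show ?case by (simp add: nn_integral_count_space_finite comp_def)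
next
  case (Suc p)
  let ?D = "\<lambda>p. {rs :: nat list. length rs = p \<and> distinct rs}"
  have cD: "countable (?D p)" by (rule countable_subset[OF subset_UNIV]) auto
  interpret U: sigma_finite_measure "count_space (UNIV :: nat set)"
    by (rule sigma_finite_measure_count_space_countable) auto
  have "(\<integral>\<^sup>+ x. (\<integral>\<^sup>+ rs. ennreal (sb_prob_rev (\<lambda>j. w j x) rs) * F ((\<lambda>j. w j x) \<circ> picked rs) \<partial>count_space (?D (Suc p))) \<partial>M)
    = (\<integral>\<^sup>+ x. (\<integral>\<^sup>+ rs. ennreal (sb_prob_rev (\<lambda>j. w j x) rs) * pick p F ((\<lambda>j. w j x) \<circ> picked rs) \<partial>count_space (?D p)) \<partial>M)"
    using good_weights_AE
  proof (intro nn_integral_cong_AE, eventually_elim)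
    case (elim x)
    have gw: "good_weights (\<lambda>j. w j x)" by (rule elim)
    let ?u = "\<lambda>j. w j x"
    let ?g = "\<lambda>rs. ennreal (sb_prob_rev ?u rs) * F (?u \<circ> picked rs)"
    have "(\<integral>\<^sup>+ rs. ?g rs \<partial>count_space (?D (Suc p)))
      = (\<integral>\<^sup>+ q. ?g ((\<lambda>(rs, k). picked rs (p + k) # rs) q) \<partial>count_space (?D p \<times> UNIV))"
      by (rule nn_integral_bij_count_space[OF bij_betw_picked_Cons, symmetric])
    also have "\<dots> = (\<integral>\<^sup>+ q. ?g ((\<lambda>(rs, k). picked rs (p + k) # rs) q) \<partial>(count_space (?D p) \<Otimes>\<^sub>M count_space UNIV))"
      by (subst pair_measure_countable[OF cD]) auto
    also have "\<dots> = (\<integral>\<^sup>+ rs. \<integral>\<^sup>+ k. ?g (picked rs (p + k) # rs) \<partial>count_space UNIV \<partial>count_space (?D p))"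
      by (subst U.nn_integral_fst[symmetric]) (auto simp: pair_measure_countable[OF cD])
    also have "\<dots> = (\<integral>\<^sup>+ rs. ennreal (sb_prob_rev ?u rs) * pick p F (?u \<circ> picked rs) \<partial>count_space (?D p))"
    proof (rule nn_integral_cong)
      fix rs assume "rs \<in> space (count_space (?D p))"
      then have rs: "length rs = p" "distinct rs" by auto
      have lt: "(\<Sum>i\<in>set rs. ?u i) < 1" by (rule good_weights_sum_less[OF gw]) simp
      have img: "(\<Sum>i\<in>set rs. ?u i) = (\<Sum>l<p. (?u \<circ> picked rs) l)"
        using picked_image[OF rs(2)] bij_is_inj[OF bij_picked] rs(1)
        by (subst picked_image[OF rs(2), symmetric], subst sum.reindex) (auto intro: inj_on_subset)
      have notin: "picked rs (p + k) \<notin> set rs" for k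
      proof -
        have "(\<lambda>(rs, k). picked rs (p + k) # rs) (rs, k) \<in> ?D (Suc p)"
          using bij_betw_picked_Cons[of p, THEN bij_betwE] rs by blast
        then show ?thesis by simp
      qed
      have inv: "inv (picked rs) (picked rs (p + k)) = p + k" for k
        using bij_is_inj[OF bij_picked] by (rule inv_f_f)
      have "sb_prob ?u (rev rs) > 0"
        using gw rs by (intro sb_prob_pos) (auto simp: good_weights_def)
      then have nn: "sb_prob_rev ?u rs \<ge> 0" by (simp add: sb_prob_def)
      have tm: "?g (picked rs (p + k) # rs) = ennreal (sb_prob_rev ?u rs) *
          (ennreal ((?u \<circ> picked rs) (p + k) / (1 - (\<Sum>l<p. (?u \<circ> picked rs) l))) * F (?u \<circ> picked rs \<circ> cyc p k))" for k
      proof -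
        have st: "sb_step ?u rs (picked rs (p + k)) = (?u \<circ> picked rs) (p + k) / (1 - (\<Sum>l<p. (?u \<circ> picked rs) l))"
          using lt notin[of k] by (simp add: sb_step_def img comp_def)
        have "sb_step ?u rs (picked rs (p + k)) \<ge> 0"
          using lt gw notin[of k] by (auto simp: sb_step_def good_weights_def less_imp_le)
        then have "ennreal (sb_prob_rev ?u (picked rs (p + k) # rs))
            = ennreal (sb_prob_rev ?u rs) * ennreal (sb_step ?u rs (picked rs (p + k)))"
          using nn by (simp add: ennreal_mult)
        then show ?thesis unfolding st by (simp add: inv rs(1) mult.assoc comp_assoc)
      qed
      show "(\<integral>\<^sup>+ k. ?g (picked rs (p + k) # rs) \<partial>count_space UNIV)
          = ennreal (sb_prob_rev ?u rs) * pick p F (?u \<circ> picked rs)"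
        unfolding tm pick_def by (subst nn_integral_cmult) (auto simp: nn_integral_count_space_nat)
    qed
    finally show ?case .
  qed
  also have "\<dots> = (\<integral>\<^sup>+ x. pick p F (\<lambda>j. w j x) \<partial>M)"
    by (rule Suc.IH[OF pick_measurable[OF Suc.prems(1)] pick_le_1[OF _ Suc.prems(2)]])
  also have "\<dots> = (\<integral>\<^sup>+ x. F (\<lambda>j. w j x) \<partial>M)"
    by (rule nn_integral_pick[OF Suc.prems])
  finally show ?case .
qed

lemma sb_invariant_if_swap: "sb_invariant M w"
  unfolding sb_invariant_def
proof (intro allI ballI)
  fix k :: nat and A assume A[measurable]: "A \<in> sets (PiM {..<k} (\<lambda>_. borel :: real measure))"
  let ?L = "{js :: nat list. length js = k}"
  let ?F = "\<lambda>u :: nat \<Rightarrow> real. indicator A (\<lambda>i\<in>{..<k}. u i) :: ennreal"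
  have F: "?F \<in> borel_measurable seqM"
    by (rule measurable_compose[OF _ borel_measurable_indicator[OF A]]) (rule measurable_restrict, simp)
  have "(\<integral>\<^sup>+ x. (\<integral>\<^sup>+ js. ennreal (sb_prob (\<lambda>j. w j x) js) * indicator A (\<lambda>i\<in>{..<k}. w (js ! i) x)
              \<partial>count_space ?L) \<partial>M)
    = (\<integral>\<^sup>+ x. (\<integral>\<^sup>+ rs. ennreal (sb_prob_rev (\<lambda>j. w j x) rs) * ?F ((\<lambda>j. w j x) \<circ> picked rs)
      \<partial>count_space {rs. length rs = k \<and> distinct rs}) \<partial>M)"
    using good_weights_AE
  proof (intro nn_integral_cong_AE, eventually_elim)
    case (elim x)
    let ?u = "\<lambda>j. w j x"
    let ?g = "\<lambda>js. ennreal (sb_prob ?u js) * indicator A (\<lambda>i\<in>{..<k}. w (js ! i) x)"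
    have "bij_betw rev ?L ?L" by (rule bij_betw_byWitness[where f' = rev]) auto
    from nn_integral_bij_count_space[OF this, of ?g]
    have "(\<integral>\<^sup>+ js. ?g js \<partial>count_space ?L) = (\<integral>\<^sup>+ rs. ?g (rev rs) \<partial>count_space ?L)" by simp
    \<comment> \<open>Lists with repetitions have selection probability 0.\<close>
    also have "\<dots> = (\<integral>\<^sup>+ rs. ?g (rev rs) \<partial>count_space {rs. length rs = k \<and> distinct rs})"
      by (rule nn_integral_count_space_eq)
        (use elim in \<open>auto simp: sb_prob_eq good_weights_def\<close>)
    also have "\<dots> = (\<integral>\<^sup>+ rs. ennreal (sb_prob_rev ?u rs) * ?F (?u \<circ> picked rs) \<partial>count_space {rs. length rs = k \<and> distinct rs})"
    proof (rule nn_integral_cong)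
      fix rs :: "nat list" assume "rs \<in> space (count_space {rs. length rs = k \<and> distinct rs})"
      then have "(\<lambda>i\<in>{..<k}. w (rev rs ! i) x) = (\<lambda>i\<in>{..<k}. (?u \<circ> picked rs) i)"
        using picked_nth[of rs] by (auto simp: restrict_def)
      then show "?g (rev rs) = ennreal (sb_prob_rev ?u rs) * ?F (?u \<circ> picked rs)"
        by (simp only: sb_prob_def rev_rev_ident)
    qed
    finally show ?case .
  qed
  also have "\<dots> = (\<integral>\<^sup>+ x. ?F (\<lambda>j. w j x) \<partial>M)"
    by (rule nn_integral_picked[OF F]) (auto simp: indicator_def)
  also have "\<dots> = (\<integral>\<^sup>+ x. indicator {x \<in> space M. (\<lambda>i\<in>{..<k}. w i x) \<in> A} x \<partial>M)"
    by (intro nn_integral_cong) (auto simp: indicator_def)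
  also have "\<dots> = emeasure M {x \<in> space M. (\<lambda>i\<in>{..<k}. w i x) \<in> A}"
    by (rule nn_integral_indicator) measurable
  finally show "(\<integral>\<^sup>+ x. (\<integral>\<^sup>+ js. ennreal (sb_prob (\<lambda>j. w j x) js) * indicator A (\<lambda>i\<in>{..<k}. w (js ! i) x)
              \<partial>count_space ?L) \<partial>M) = emeasure M {x \<in> space M. (\<lambda>i\<in>{..<k}. w i x) \<in> A}" .
qed

end

text \<open>\<open>tilt_sym\<close> concerns two coordinates only. By independence all other
  coordinates can be frozen and integrated last, so the symmetry extends to functions of the whole
  sequence.\<close>

lemma indep_vars_vswap:
  assumes ind: "indep_vars (\<lambda>_. borel) v UNIV"
    and tilt: "tilt_sym (distr M borel (v n)) (distr M borel (v (Suc n)))"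
    and G[measurable]: "G \<in> borel_measurable seqM"
  shows "(\<integral>\<^sup>+ x. ennreal (1 - v n x) * G (\<lambda>i. v i x) \<partial>M)
    = (\<integral>\<^sup>+ x. ennreal (1 - v n x) * G (vswap n (\<lambda>i. v i x)) \<partial>M)"
proof -
  let ?J = "{n, Suc n}" and ?K = "- {n, Suc n}"
  let ?l = "distr M borel (v n)" and ?l' = "distr M borel (v (Suc n))"
  let ?P = "PiM ?K (\<lambda>_. borel :: real measure)"
  let ?X = "\<lambda>x. (v n x, v (Suc n) x)" and ?Y = "\<lambda>x. restrict (\<lambda>i. v i x) ?K"
  interpret l': prob_space ?l' by (rule prob_space_distr) simp
  have "indep_var (PiM {n} (\<lambda>_. borel)) (\<lambda>x. restrict (\<lambda>i. v i x) {n}) (PiM {Suc n} (\<lambda>_. borel)) (\<lambda>x. restrict (\<lambda>i. v i x) {Suc n})"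
    by (rule indep_var_restrict[OF ind]) auto
  from indep_var_compose[OF this, of "\<lambda>y. y n" borel "\<lambda>y. y (Suc n)" borel]
  have "indep_var borel (v n) borel (v (Suc n))" by (simp add: comp_def)
  then have pair: "distr M (borel \<Otimes>\<^sub>M borel) ?X = ?l \<Otimes>\<^sub>M ?l'"
    unfolding indep_var_distribution_eq by simp
  let ?PJ = "PiM ?J (\<lambda>_. borel :: real measure)" and ?Z = "\<lambda>x. restrict (\<lambda>i. v i x) ?J"
  have "indep_var ?PJ ?Z ?P ?Y"
    by (rule indep_var_restrict[OF ind]) auto
  then have joint: "distr M (?PJ \<Otimes>\<^sub>M ?P) (\<lambda>x. (?Z x, ?Y x)) = distr M ?PJ ?Z \<Otimes>\<^sub>M distr M ?P ?Y"
    and Y[measurable]: "?Y \<in> M \<rightarrow>\<^sub>M ?P" and Z[measurable]: "?Z \<in> M \<rightarrow>\<^sub>M ?PJ"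
    unfolding indep_var_distribution_eq by simp_all
  let ?Q = "distr M ?P ?Y" and ?N = "distr M ?PJ ?Z"
  interpret Q: prob_space ?Q by (rule prob_space_distr[OF Y])
  interpret N: prob_space ?N by (rule prob_space_distr[OF Z])
  interpret NQ: pair_sigma_finite ?N ?Q ..
  define mrg where "mrg z y i = (if i = n then fst z else if i = Suc n then snd z else y i)"
    for z :: "real \<times> real" and y :: "nat \<Rightarrow> real" and i
  have [measurable]: "(\<lambda>(z, y). mrg z y) \<in> (borel \<Otimes>\<^sub>M borel) \<Otimes>\<^sub>M ?P \<rightarrow>\<^sub>M seqM"
    unfolding split_beta'
  proof (rule measurable_abs_UNIV)
    fix i
    have "(\<lambda>x. snd x i) \<in> borel_measurable ((borel \<Otimes>\<^sub>M borel) \<Otimes>\<^sub>M ?P)" if "i \<in> ?K"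
      using that by measurable
    then show "(\<lambda>x. mrg (fst x) (snd x) i) \<in> borel_measurable ((borel \<Otimes>\<^sub>M borel) \<Otimes>\<^sub>M ?P)"
      unfolding mrg_def by (cases "i \<in> ?K") auto
  qed
  have mrg: "mrg (?X x) (?Y x) = (\<lambda>i. v i x)" for x by (auto simp: mrg_def fun_eq_iff)
  have val: "(\<integral>\<^sup>+ x. ennreal (1 - v n x) * H (\<lambda>i. v i x) \<partial>M)
    = (\<integral>\<^sup>+ y. \<integral>\<^sup>+ a. \<integral>\<^sup>+ b. ennreal (1 - a) * H (mrg (a, b) y) \<partial>?l' \<partial>?l \<partial>?Q)"
    if [measurable]: "H \<in> borel_measurable seqM" for H
  proof -
    let ?h = "\<lambda>p. ennreal (1 - fst (fst p)) * H (mrg (fst p) (snd p))"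
    have m: "?h \<in> borel_measurable ((borel \<Otimes>\<^sub>M borel) \<Otimes>\<^sub>M ?P)"
      using measurable_compose[OF \<open>(\<lambda>(z, y). mrg z y) \<in> _\<close> that]
      by (intro borel_measurable_times_ennreal) (simp_all add: split_beta')
    let ?pr = "\<lambda>z :: nat \<Rightarrow> real. (z n, z (Suc n))"
    have pr: "?pr \<in> ?PJ \<rightarrow>\<^sub>M borel \<Otimes>\<^sub>M borel"
      by (intro measurable_Pair measurable_component_singleton) auto
    have "(\<lambda>p. (?pr (fst p), snd p)) \<in> ?PJ \<Otimes>\<^sub>M ?P \<rightarrow>\<^sub>M (borel \<Otimes>\<^sub>M borel) \<Otimes>\<^sub>M ?P"
      by (intro measurable_Pair measurable_compose[OF measurable_fst pr] measurable_snd)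
    from measurable_compose[OF this m]
    have m': "(\<lambda>p. ?h (?pr (fst p), snd p)) \<in> borel_measurable (?PJ \<Otimes>\<^sub>M ?P)" .
    have "(\<integral>\<^sup>+ x. ennreal (1 - v n x) * H (\<lambda>i. v i x) \<partial>M) = (\<integral>\<^sup>+ x. (\<lambda>p. ?h (?pr (fst p), snd p)) (?Z x, ?Y x) \<partial>M)"
      by (simp add: mrg)
    also have "\<dots> = (\<integral>\<^sup>+ p. ?h (?pr (fst p), snd p) \<partial>(?N \<Otimes>\<^sub>M ?Q))"
      unfolding joint[symmetric] using m' by (subst nn_integral_distr[OF measurable_Pair[OF Z Y]]) simp_all
    also have "\<dots> = (\<integral>\<^sup>+ y. \<integral>\<^sup>+ z. ?h (?pr (fst (z, y)), snd (z, y)) \<partial>?N \<partial>?Q)"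
      using m' by (intro NQ.nn_integral_snd[symmetric]) (simp cong: measurable_cong_sets sets_pair_measure_cong)
    also have "\<dots> = (\<integral>\<^sup>+ y. \<integral>\<^sup>+ a. \<integral>\<^sup>+ b. ?h ((a, b), y) \<partial>?l' \<partial>?l \<partial>?Q)"
    proof (rule nn_integral_cong)
      fix y assume "y \<in> space ?Q"
      then have y: "y \<in> space ?P" by simp
      have hy: "(\<lambda>z. ?h (z, y)) \<in> borel_measurable (borel \<Otimes>\<^sub>M borel)"
        by (rule measurable_compose[OF measurable_Pair2'[OF y] m])
      have "(\<integral>\<^sup>+ z. ?h (?pr z, y) \<partial>?N) = (\<integral>\<^sup>+ x. ?h (?pr (?Z x), y) \<partial>M)"
        using measurable_compose[OF pr hy] by (subst nn_integral_distr[OF Z]) simp_all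
      also have "\<dots> = (\<integral>\<^sup>+ z. ?h (z, y) \<partial>distr M (borel \<Otimes>\<^sub>M borel) ?X)"
        using hy by (subst nn_integral_distr) simp_all
      also have "\<dots> = (\<integral>\<^sup>+ z. ?h (z, y) \<partial>(?l \<Otimes>\<^sub>M ?l'))" unfolding pair ..
      also have "\<dots> = (\<integral>\<^sup>+ a. \<integral>\<^sup>+ b. ?h ((a, b), y) \<partial>?l' \<partial>?l)"
        using hy by (intro l'.nn_integral_fst[symmetric]) (simp cong: measurable_cong_sets sets_pair_measure_cong)
      finally show "(\<integral>\<^sup>+ z. ?h (?pr (fst (z, y)), snd (z, y)) \<partial>?N)
        = (\<integral>\<^sup>+ a. \<integral>\<^sup>+ b. ?h ((a, b), y) \<partial>?l' \<partial>?l)" by simp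
    qed
    finally show ?thesis by simp
  qed
  have vs: "vswap n \<in> seqM \<rightarrow>\<^sub>M seqM"
  proof -
    have comp: "(\<lambda>u. u l) \<in> borel_measurable seqM" for l :: nat by simp
    have "(\<lambda>u. vswap n u i) \<in> borel_measurable seqM" for i
      unfolding vswap_def fun_upd_def
      by (cases "i = Suc n"; cases "i = n")
        (auto intro!: comp borel_measurable_times borel_measurable_diff borel_measurable_divide)
    then show ?thesis by (rule measurable_abs_UNIV)
  qed
  have "(\<integral>\<^sup>+ x. ennreal (1 - v n x) * G (\<lambda>i. v i x) \<partial>M)
    = (\<integral>\<^sup>+ y. \<integral>\<^sup>+ a. \<integral>\<^sup>+ b. ennreal (1 - a) * G (mrg (a, b) y) \<partial>?l' \<partial>?l \<partial>?Q)"
    by (rule val[OF G])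
  also have "\<dots> = (\<integral>\<^sup>+ y. \<integral>\<^sup>+ a. \<integral>\<^sup>+ b. ennreal (1 - a) * G (vswap n (mrg (a, b) y)) \<partial>?l' \<partial>?l \<partial>?Q)"
  proof (rule nn_integral_cong)
    fix y assume "y \<in> space ?Q"
    then have y: "y \<in> space ?P" by simp
    have "(\<lambda>z. (\<lambda>(z, y). mrg z y) (z, y)) \<in> (borel \<Otimes>\<^sub>M borel) \<rightarrow>\<^sub>M seqM"
      by (rule measurable_compose[OF measurable_Pair2'[OF y]]) measurable
    then have "(\<lambda>z. G (mrg z y)) \<in> borel_measurable (borel \<Otimes>\<^sub>M borel)"
      by (intro measurable_compose[OF _ G]) simp
    then have "(\<lambda>z. G (mrg z y)) \<in> borel_measurable borel" by (simp add: borel_prod)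
    from tilt[unfolded tilt_sym_def, rule_format, OF this]
    have "(\<integral>\<^sup>+ a. \<integral>\<^sup>+ b. ennreal (1 - a) * G (mrg (a, b) y) \<partial>?l' \<partial>?l)
      = (\<integral>\<^sup>+ a. \<integral>\<^sup>+ b. ennreal (1 - a) * G (mrg ((1 - a) * b, a / (1 - (1 - a) * b)) y) \<partial>?l' \<partial>?l)" .
    moreover have "mrg ((1 - a) * b, a / (1 - (1 - a) * b)) y = vswap n (mrg (a, b) y)" for a b
      by (auto simp: mrg_def vswap_def fun_eq_iff)
    ultimately show "(\<integral>\<^sup>+ a. \<integral>\<^sup>+ b. ennreal (1 - a) * G (mrg (a, b) y) \<partial>?l' \<partial>?l)
      = (\<integral>\<^sup>+ a. \<integral>\<^sup>+ b. ennreal (1 - a) * G (vswap n (mrg (a, b) y)) \<partial>?l' \<partial>?l)" by simp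
  qed
  also have "\<dots> = (\<integral>\<^sup>+ x. ennreal (1 - v n x) * G (vswap n (\<lambda>i. v i x)) \<partial>M)"
    by (rule val[OF measurable_compose[OF vs G], symmetric])
  finally show ?thesis .
qed

text \<open>The mass left after position n is 1 - v n times the product of the earlier factors 1 - v
  l, which the exchange does not touch. That product is absorbed into the test function, leaving
  exactly the tilt of \<open>tilt_sym\<close>.\<close>

lemma sb_invariant_if_beta:
  assumes ind: "indep_vars (\<lambda>_. borel) v UNIV" and \<sigma>: "0 \<le> \<sigma>" "\<sigma> < 1" "\<theta> > - \<sigma>"
    and law: "\<And>j. distr M borel (v j) = beta_measure (1 - \<sigma>) (\<theta> + real (Suc j) * \<sigma>)"
  shows "sb_invariant M w"
proof (rule sb_invariant_if_swap)
  fix n and F :: "(nat \<Rightarrow> real) \<Rightarrow> ennreal" assume F[measurable]: "F \<in> borel_measurable seqM"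
  let ?q = "\<theta> + real (Suc n) * \<sigma>"
  have "real n * \<sigma> \<ge> 0" using \<sigma> by simp
  moreover have "?q = \<theta> + \<sigma> + real n * \<sigma>" by (simp add: algebra_simps)
  ultimately have q: "?q > 0" using \<sigma> by linarith
  \<comment> \<open>The parameter q + 1 - p demanded of the second beta law is the one prescribed at
    index n + 1.\<close>
  have q': "?q + 1 - (1 - \<sigma>) = \<theta> + real (Suc (Suc n)) * \<sigma>" by (simp add: algebra_simps)
  have "\<theta> + real (Suc (Suc n)) * \<sigma> > 0" using q \<sigma> by (simp add: algebra_simps)
  then have tilt: "tilt_sym (distr M borel (v n)) (distr M borel (v (Suc n)))"
    unfolding law using tilt_sym_beta[of "1 - \<sigma>" ?q] q \<sigma> by (simp only: q')
  define stick where "stick u j = u j * (\<Prod>i<j. 1 - u i)" for u :: "nat \<Rightarrow> real" and j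
  have comp: "(\<lambda>u. u l) \<in> borel_measurable seqM" for l :: nat by simp
  have stick[measurable]: "stick \<in> seqM \<rightarrow>\<^sub>M seqM"
    unfolding stick_def[abs_def]
    by (rule measurable_abs_UNIV) (intro borel_measurable_times borel_measurable_prod borel_measurable_diff comp, auto)
  have w_stick: "(\<lambda>j. w j x) = stick (\<lambda>i. v i x)" for x
    by (simp add: stick_def stick_weights_def fun_eq_iff)
  let ?G = "\<lambda>u. ennreal (\<Prod>l<n. 1 - u l) * F (stick u)"
  have [measurable]: "(\<lambda>u :: nat \<Rightarrow> real. \<Prod>l<n. 1 - u l) \<in> borel_measurable seqM"
    by (intro borel_measurable_prod borel_measurable_diff comp) auto
  have G: "?G \<in> borel_measurable seqM" by measurable
  have R: "ennreal (1 - (\<Sum>l<Suc n. w l x)) = ennreal (1 - v n x) * ennreal (\<Prod>l<n. 1 - v l x)"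
    if "\<forall>j. 0 < v j x \<and> v j x < 1" for x
    unfolding stick_weights_sum using that
    by (subst ennreal_mult[symmetric]) (auto intro!: prod_nonneg simp: less_imp_le mult.commute)
  have "(\<integral>\<^sup>+ x. ennreal (1 - (\<Sum>l<Suc n. w l x)) * F (\<lambda>j. w j x) \<partial>M)
    = (\<integral>\<^sup>+ x. ennreal (1 - v n x) * ?G (\<lambda>i. v i x) \<partial>M)"
  proof (rule nn_integral_cong_AE, use v_AE in eventually_elim)
    case (elim x)
    show ?case by (simp only: R[OF elim] mult.assoc) (simp only: w_stick)
  qed
  also have "\<dots> = (\<integral>\<^sup>+ x. ennreal (1 - v n x) * ?G (vswap n (\<lambda>i. v i x)) \<partial>M)"
    by (rule indep_vars_vswap[OF ind tilt G])
  also have "\<dots> = (\<integral>\<^sup>+ x. ennreal (1 - (\<Sum>l<Suc n. w l x)) * F (\<lambda>j. w (swap n j) x) \<partial>M)"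
  proof (rule nn_integral_cong_AE, use v_AE in eventually_elim)
    case (elim x)
    have "stick (vswap n (\<lambda>i. v i x)) = (\<lambda>j. w (swap n j) x)"
      using stick_vswap[of "\<lambda>i. v i x" n] elim by (simp add: stick_def stick_weights_def fun_eq_iff)
    moreover have "(\<Prod>l<n. 1 - vswap n (\<lambda>i. v i x) l) = (\<Prod>l<n. 1 - v l x)"
      by (intro prod.cong) (auto simp: vswap_def)
    ultimately show ?case by (simp only: R[OF elim] mult.assoc)
  qed
  finally show "(\<integral>\<^sup>+ x. ennreal (1 - (\<Sum>l<Suc n. w l x)) * F (\<lambda>j. w j x) \<partial>M)
    = (\<integral>\<^sup>+ x. ennreal (1 - (\<Sum>l<Suc n. w l x)) * F (\<lambda>j. w (swap n j) x) \<partial>M)" .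
qed

end

theorem mainTheorem6:
  fixes M :: "'a measure" and v :: "nat \<Rightarrow> 'a \<Rightarrow> real"
  assumes prob: "prob_space M"
    and meas: "\<And>j. v j \<in> borel_measurable M"
    and range01: "\<And>j x. x \<in> space M \<Longrightarrow> v j x \<in> {0..1}"
    and markov: "markov_chain M v"
    and sum1_pos: "AE x in M. (\<lambda>j. stick_weights v j x) sums 1 \<and> (\<forall>j. stick_weights v j x > 0)"
    and cases:
      "(absolutely_continuous (distr M borel (\<lambda>x. (v 0 x, v 1 x)))
          (density lborel (indicator ({0..1} \<times> {0..1}) :: real \<times> real \<Rightarrow> ennreal))
        \<and> absolutely_continuous (density lborel (indicator ({0..1} \<times> {0..1}) :: real \<times> real \<Rightarrow> ennreal))
          (distr M borel (\<lambda>x. (v 0 x, v 1 x))))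
       \<or> (convex (support (distr M borel (\<lambda>x. (stick_weights v 0 x, stick_weights v 1 x))))
          \<and> (\<exists>\<phi>. cond_law_version M (v 1) (v 2) \<phi>
                 \<and> (\<forall>u us. (\<forall>n. us n < u) \<longrightarrow> us \<longlonglongrightarrow> u
                          \<longrightarrow> weak_conv_m (\<lambda>n. \<phi> (us n)) (\<phi> u))))
       \<or> (\<exists>\<epsilon>::real. 0 < \<epsilon> \<and> \<epsilon> < 1
            \<and> {p \<in> {0..1} \<times> {0..1}. snd p = \<epsilon>} \<subseteq> support (distr M borel (\<lambda>x. (v 0 x, v 1 x)))
            \<and> (\<exists>\<psi>. cond_law_version M (v 1) (v 2) \<psi>
                 \<and> (\<forall>u us. u \<in> support (distr M borel (v 1)) \<longrightarrow> (\<forall>n. us n \<in> support (distr M borel (v 1)))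
                          \<longrightarrow> us \<longlonglongrightarrow> u \<longrightarrow> weak_conv_m (\<lambda>n. \<psi> (us n)) (\<psi> u))))"
  shows "sb_invariant M (stick_weights v) \<longleftrightarrow>
    (\<exists>\<sigma>::real. \<exists>\<theta>::real. 0 \<le> \<sigma> \<and> \<sigma> < 1 \<and> \<theta> > - \<sigma> \<and>
       prob_space.indep_vars M (\<lambda>_. borel) v UNIV \<and>
       (\<forall>j. distr M borel (v j) = beta_measure (1 - \<sigma>) (\<theta> + real (Suc j) * \<sigma>)))"
proof -
  interpret prob_space M by (rule prob)
  interpret markov_stick_breaking M v
    by unfold_locales (use meas range01 markov sum1_pos in auto)
  show ?thesis
  proof
    assume inv: "sb_invariant M (stick_weights v)"
    \<comment> \<open>Whatever the alternative, it delivers independence of v 2 from (v 0, v 1),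
      from which the common argument starts.\<close>
    have "indep_past (Suc 0)"
      using cases
    proof (elim disjE exE conjE)
      assume "absolutely_continuous (distr M borel (\<lambda>x. (v 0 x, v 1 x)))
          (density lborel (indicator ({0..1} \<times> {0..1}) :: real \<times> real \<Rightarrow> ennreal))"
        "absolutely_continuous (density lborel (indicator ({0..1} \<times> {0..1}) :: real \<times> real \<Rightarrow> ennreal))
          (distr M borel (\<lambda>x. (v 0 x, v 1 x)))"
      then show ?thesis by (rule indep_past_if_ac[OF inv])
    next
      fix \<phi>
      assume "convex (support (distr M borel (\<lambda>x. (stick_weights v 0 x, stick_weights v 1 x))))"
        and "cond_law_version M (v 1) (v 2) \<phi>"
        and "\<forall>u us. (\<forall>n. us n < u) \<longrightarrow> us \<longlonglongrightarrow> u \<longrightarrow> weak_conv_m (\<lambda>n. \<phi> (us n)) (\<phi> u)"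
      then show ?thesis by (intro indep_past_if_left_continuous[OF inv]) auto
    next
      fix \<epsilon> \<psi>
      assume "0 < \<epsilon>" "\<epsilon> < 1"
        and "{p \<in> {0..1} \<times> {0..1}. snd p = \<epsilon>} \<subseteq> support (distr M borel (\<lambda>x. (v 0 x, v 1 x)))"
        and "cond_law_version M (v 1) (v 2) \<psi>"
        and "\<forall>u us. u \<in> support (distr M borel (v 1)) \<longrightarrow> (\<forall>n. us n \<in> support (distr M borel (v 1)))
                          \<longrightarrow> us \<longlonglongrightarrow> u \<longrightarrow> weak_conv_m (\<lambda>n. \<psi> (us n)) (\<psi> u)"
      then show ?thesis by (intro indep_past_if_weakly_continuous[OF inv, of \<epsilon> \<psi>]) blast+
    qed
    from beta_if_sb_invariant[OF inv this]
    show "\<exists>\<sigma> \<theta>. 0 \<le> \<sigma> \<and> \<sigma> < 1 \<and> \<theta> > - \<sigma> \<and> indep_vars (\<lambda>_. borel) v UNIV \<and>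
       (\<forall>j. distr M borel (v j) = beta_measure (1 - \<sigma>) (\<theta> + real (Suc j) * \<sigma>))" .
  next
    assume "\<exists>\<sigma> \<theta>. 0 \<le> \<sigma> \<and> \<sigma> < 1 \<and> \<theta> > - \<sigma> \<and> indep_vars (\<lambda>_. borel) v UNIV \<and>
       (\<forall>j. distr M borel (v j) = beta_measure (1 - \<sigma>) (\<theta> + real (Suc j) * \<sigma>))"
    then show "sb_invariant M (stick_weights v)" using sb_invariant_if_beta by blast
  qed
qed

end
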